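(* Let $X$ be a compact, non-positively curved cube complex. If the link of every vertex of $X$ is connected and has no cut simplices, then $\pi_1(X)$ has at most one end.
   Context: Cube complexes here are connected, their cubes are embedded, and the intersection of any two cubes is either empty or a common face. The link of a vertex $x$ of $X$ is the simplicial complex whose simplices are the corners at $x$ of the cubes incident at $x$. For a simplicial complex $A$ and a full subcomplex $B\subseteq A$ (i.e. a simplex of $A$ all of whose vertices lie in $B$ is in $B$), the open star $\mathrm{St}_A(B)$ is the union of the interiors of the simplices of $A$ that contain a simplex of $B$ as a face. A simplex $\sigma$ of $A$ (of any dimension $\geq 0$) is a cut simplex of $A$ if $A\smallsetminus\mathrm{St}_A(\sigma)$ is disconnected. *)

theory Defs
  imports "HOL-Analysis.Analysis" "HOL-Algebra.Generated_Groups"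
begin

section \<open>Simplicial complexes\<close>

text \<open>A simplicial complex is given by the set of its nonempty simplices, each simplex being a
  finite set of vertices.  Its points are described by barycentric coordinates.\<close>

definition closed_simplex :: "'b set \<Rightarrow> ('b \<Rightarrow> real) set" where
  "closed_simplex s = {f. (\<forall>v\<in>s. 0 \<le> f v) \<and> (\<forall>v. v \<notin> s \<longrightarrow> f v = 0) \<and> sum f s = 1}"

definition open_simplex :: "'b set \<Rightarrow> ('b \<Rightarrow> real) set" where
  "open_simplex s = {f. (\<forall>v\<in>s. 0 < f v) \<and> (\<forall>v. v \<notin> s \<longrightarrow> f v = 0) \<and> sum f s = 1}"

text \<open>The realization carries the weak topology determined by its closed simplices.\<close>

definition simplicial_realization :: "'b set set \<Rightarrow> ('b \<Rightarrow> real) topology" where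
  "simplicial_realization A = topology (\<lambda>U. U \<subseteq> (\<Union>s\<in>A. closed_simplex s) \<and>
     (\<forall>s\<in>A. openin (top_of_set (closed_simplex s)) (U \<inter> closed_simplex s)))"

lemma openin_simplicial_realization:
  "openin (simplicial_realization A) U \<longleftrightarrow>
     U \<subseteq> (\<Union>s\<in>A. closed_simplex s) \<and>
     (\<forall>s\<in>A. openin (top_of_set (closed_simplex s)) (U \<inter> closed_simplex s))"
proof -
  have "istopology (\<lambda>U. U \<subseteq> (\<Union>s\<in>A. closed_simplex s) \<and>
     (\<forall>s\<in>A. openin (top_of_set (closed_simplex s)) (U \<inter> closed_simplex s)))"
    unfolding istopology_def
  proof (intro conjI allI impI; (elim conjE)?)
    fix S T :: "('a \<Rightarrow> real) set"
    assume S: "\<forall>s\<in>A. openin (top_of_set (closed_simplex s)) (S \<inter> closed_simplex s)"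
      and T: "\<forall>s\<in>A. openin (top_of_set (closed_simplex s)) (T \<inter> closed_simplex s)"
    show "\<forall>s\<in>A. openin (top_of_set (closed_simplex s)) (S \<inter> T \<inter> closed_simplex s)"
    proof
      fix s assume "s \<in> A"
      have "S \<inter> T \<inter> closed_simplex s = (S \<inter> closed_simplex s) \<inter> (T \<inter> closed_simplex s)"
        by blast
      then show "openin (top_of_set (closed_simplex s)) (S \<inter> T \<inter> closed_simplex s)"
        using S T \<open>s \<in> A\<close> by (metis openin_Int)
    qed
  next
    fix \<K> :: "('a \<Rightarrow> real) set set"
    assume K: "\<forall>K\<in>\<K>. K \<subseteq> (\<Union>s\<in>A. closed_simplex s) \<and>
       (\<forall>s\<in>A. openin (top_of_set (closed_simplex s)) (K \<inter> closed_simplex s))"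
    show "\<forall>s\<in>A. openin (top_of_set (closed_simplex s)) (\<Union>\<K> \<inter> closed_simplex s)"
    proof
      fix s assume "s \<in> A"
      have "\<Union>\<K> \<inter> closed_simplex s = (\<Union>K\<in>\<K>. K \<inter> closed_simplex s)"
        by blast
      then show "openin (top_of_set (closed_simplex s)) (\<Union>\<K> \<inter> closed_simplex s)"
        using K \<open>s \<in> A\<close> openin_clauses(3)[of "(\<lambda>K. K \<inter> closed_simplex s) ` \<K>"] by auto
    qed
  qed blast+
  then show ?thesis
    by (simp add: simplicial_realization_def topology_inverse')
qed

lemma topspace_simplicial_realization:
  "topspace (simplicial_realization A) = (\<Union>s\<in>A. closed_simplex s)"
proof
  show "topspace (simplicial_realization A) \<subseteq> (\<Union>s\<in>A. closed_simplex s)"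
    using openin_simplicial_realization openin_topspace by blast
  have "(\<Union>s\<in>A. closed_simplex s) \<inter> closed_simplex t = closed_simplex t" if "t \<in> A" for t
    using that by blast
  then have "openin (simplicial_realization A) (\<Union>s\<in>A. closed_simplex s)"
    by (simp add: openin_simplicial_realization)
  then show "(\<Union>s\<in>A. closed_simplex s) \<subseteq> topspace (simplicial_realization A)"
    by (rule openin_subset)
qed

definition open_star :: "'b set set \<Rightarrow> 'b set set \<Rightarrow> ('b \<Rightarrow> real) set" where
  "open_star A B = (\<Union>s\<in>{s \<in> A. \<exists>t\<in>B. t \<subseteq> s}. open_simplex s)"

text \<open>In the open star of a simplex, the simplex is regarded as the subcomplex formed by all of
  its faces.  Thus the interior of a simplex lies in the open star as soon as the two simplices
  share a vertex.\<close>

definition faces_of_simplex :: "'b set \<Rightarrow> 'b set set" where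
  "faces_of_simplex s = {t. t \<noteq> {} \<and> t \<subseteq> s}"

text \<open>The empty space counts as connected.\<close>

definition cut_simplex :: "'b set set \<Rightarrow> 'b set \<Rightarrow> bool" where
  "cut_simplex A s \<longleftrightarrow> s \<in> A \<and>
     \<not> connectedin (simplicial_realization A)
         (topspace (simplicial_realization A) - open_star A (faces_of_simplex s))"

definition flag_complex :: "'b set set \<Rightarrow> bool" where
  "flag_complex A \<longleftrightarrow>
     (\<forall>s. finite s \<and> s \<noteq> {} \<and> (\<forall>u\<in>s. \<forall>v\<in>s. {u, v} \<in> A) \<longrightarrow> s \<in> A)"


section \<open>Cube complexes\<close>

definition unit_cube :: "nat \<Rightarrow> (nat \<Rightarrow> real) set" where
  "unit_cube n = {..<n} \<rightarrow>\<^sub>E {0..1}"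

definition unit_cube_topology :: "nat \<Rightarrow> (nat \<Rightarrow> real) topology" where
  "unit_cube_topology n = product_topology (\<lambda>_. top_of_set {0..1}) {..<n}"

definition cube_dist :: "nat \<Rightarrow> (nat \<Rightarrow> real) \<Rightarrow> (nat \<Rightarrow> real) \<Rightarrow> real" where
  "cube_dist n x y = L2_set (\<lambda>i. x i - y i) {..<n}"

definition cube_face :: "nat \<Rightarrow> nat \<Rightarrow> (nat \<Rightarrow> real) set \<Rightarrow> bool" where
  "cube_face n k F \<longleftrightarrow>
     (\<exists>J e. J \<subseteq> {..<n} \<and> card J + k = n \<and> (\<forall>i\<in>J. e i \<in> {0, 1}) \<and>
        F = {x \<in> unit_cube n. \<forall>i\<in>J. x i = e i})"

definition face_isometry ::
  "nat \<Rightarrow> (nat \<Rightarrow> real) set \<Rightarrow> nat \<Rightarrow> (nat \<Rightarrow> real) set \<Rightarrow> ((nat \<Rightarrow> real) \<Rightarrow> nat \<Rightarrow> real) \<Rightarrow> bool"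
  where "face_isometry n F m F' h \<longleftrightarrow>
     h ` F = F' \<and> (\<forall>x\<in>F. \<forall>y\<in>F. cube_dist m (h x) (h y) = cube_dist n x y)"

record ('a, 'i) cube_structure =
  cspace :: "'a topology"
  cindex :: "'i set"
  cdim :: "'i \<Rightarrow> nat"
  cmap :: "'i \<Rightarrow> (nat \<Rightarrow> real) \<Rightarrow> 'a"

text \<open>This is the definition of a cubical complex in Bridson and Haefliger (Definition I.7.32),
  restricted to connected complexes: the space is the quotient of a disjoint union of unit cubes,
  every cube embeds, and two cubes that meet do so in a common face, the identification being an
  isometry between faces.  The topology is the quotient topology.  The index set need not contain
  the proper faces of a cube as separate members.\<close>

definition cube_complex :: "('a, 'i) cube_structure \<Rightarrow> bool" where
  "cube_complex K \<longleftrightarrow>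
     topspace (cspace K) = (\<Union>l\<in>cindex K. cmap K l ` unit_cube (cdim K l)) \<and>
     (\<forall>U. U \<subseteq> topspace (cspace K) \<longrightarrow>
        (openin (cspace K) U \<longleftrightarrow>
          (\<forall>l\<in>cindex K. openin (unit_cube_topology (cdim K l))
             {x \<in> unit_cube (cdim K l). cmap K l x \<in> U}))) \<and>
     (\<forall>l\<in>cindex K. inj_on (cmap K l) (unit_cube (cdim K l))) \<and>
     (\<forall>l\<in>cindex K. \<forall>m\<in>cindex K.
        cmap K l ` unit_cube (cdim K l) \<inter> cmap K m ` unit_cube (cdim K m) \<noteq> {} \<longrightarrow>
        (\<exists>j k F F' h. cube_face (cdim K l) j F \<and> cube_face (cdim K m) k F' \<and>
           face_isometry (cdim K l) F (cdim K m) F' h \<and>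
           (\<forall>x\<in>unit_cube (cdim K l). \<forall>y\<in>unit_cube (cdim K m).
              cmap K l x = cmap K m y \<longleftrightarrow> x \<in> F \<and> y = h x))) \<and>
     connected_space (cspace K)"

text \<open>The cubes of dimension \<open>k\<close>, as subsets of the space.\<close>

definition is_cube :: "('a, 'i) cube_structure \<Rightarrow> nat \<Rightarrow> 'a set \<Rightarrow> bool" where
  "is_cube K k c \<longleftrightarrow> (\<exists>l\<in>cindex K. \<exists>F. cube_face (cdim K l) k F \<and> c = cmap K l ` F)"

definition cube_vertices :: "('a, 'i) cube_structure \<Rightarrow> 'a set" where
  "cube_vertices K = {x. is_cube K 0 {x}}"

text \<open>Cubes are embedded, so a cube incident at \<open>x\<close> has a single corner there, and this corner
  is a simplex whose vertices are the corners at \<open>x\<close> of the edges of the cube.  An edge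
  stands for its corner at \<open>x\<close>.  The vertex \<open>x\<close> itself would yield the empty simplex,
  which is left out.\<close>

definition vertex_link :: "('a, 'i) cube_structure \<Rightarrow> 'a \<Rightarrow> 'a set set set" where
  "vertex_link K x =
     {s. s \<noteq> {} \<and> (\<exists>k c. is_cube K k c \<and> x \<in> c \<and> s = {e. is_cube K 1 e \<and> x \<in> e \<and> e \<subseteq> c})}"

text \<open>Non-positive curvature in the sense of Gromov's link condition; the links are already
  simplicial complexes.\<close>

definition nonpositively_curved :: "('a, 'i) cube_structure \<Rightarrow> bool" where
  "nonpositively_curved K \<longleftrightarrow> (\<forall>x\<in>cube_vertices K. flag_complex (vertex_link K x))"


section \<open>The fundamental group\<close>

definition based_loops :: "'a topology \<Rightarrow> 'a \<Rightarrow> (real \<Rightarrow> 'a) set" where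
  "based_loops X a = {p. pathin X p \<and> p 0 = a \<and> p 1 = a}"

definition loop_homotopic :: "'a topology \<Rightarrow> 'a \<Rightarrow> (real \<Rightarrow> 'a) \<Rightarrow> (real \<Rightarrow> 'a) \<Rightarrow> bool" where
  "loop_homotopic X a = homotopic_with (\<lambda>r. r 0 = a \<and> r 1 = a) (top_of_set {0..1}) X"

definition loop_class :: "'a topology \<Rightarrow> 'a \<Rightarrow> (real \<Rightarrow> 'a) \<Rightarrow> (real \<Rightarrow> 'a) set" where
  "loop_class X a p = {q \<in> based_loops X a. loop_homotopic X a p q}"

definition loop_concat :: "(real \<Rightarrow> 'a) \<Rightarrow> (real \<Rightarrow> 'a) \<Rightarrow> real \<Rightarrow> 'a" where
  "loop_concat p q = (\<lambda>t. if t \<le> 1/2 then p (2 * t) else q (2 * t - 1))"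

definition fundamental_group :: "'a topology \<Rightarrow> 'a \<Rightarrow> (real \<Rightarrow> 'a) set monoid" where
  "fundamental_group X a =
     \<lparr>carrier = loop_class X a ` based_loops X a,
      monoid.mult = (\<lambda>P Q. \<Union>p\<in>P. \<Union>q\<in>Q. loop_class X a (loop_concat p q)),
      one = loop_class X a (\<lambda>_. a)\<rparr>"


section \<open>Ends of groups\<close>

text \<open>A graph is given by its vertex set and a symmetric adjacency relation.\<close>

definition graph_components :: "'v set \<Rightarrow> ('v \<times> 'v) set \<Rightarrow> 'v set set" where
  "graph_components V E = (\<lambda>v. {w. (v, w) \<in> (E \<inter> V \<times> V)\<^sup>*}) ` V"

definition ecard :: "'v set \<Rightarrow> enat" where
  "ecard A = (if finite A then enat (card A) else \<infinity>)"

text \<open>For a locally finite graph: the supremum, over finite vertex sets \<open>F\<close>, of the number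
  of infinite components that remain when \<open>F\<close> is removed.\<close>

definition number_of_graph_ends :: "'v set \<Rightarrow> ('v \<times> 'v) set \<Rightarrow> enat" where
  "number_of_graph_ends V E =
     (SUP F\<in>{F. finite F \<and> F \<subseteq> V}. ecard {C \<in> graph_components (V - F) E. infinite C})"

definition cayley_edges :: "('g, 'm) monoid_scheme \<Rightarrow> 'g set \<Rightarrow> ('g \<times> 'g) set" where
  "cayley_edges G S = {(g, h). g \<in> carrier G \<and> h \<in> carrier G \<and>
     (\<exists>s\<in>S. h = g \<otimes>\<^bsub>G\<^esub> s \<or> g = h \<otimes>\<^bsub>G\<^esub> s)}"

definition finite_generating_set :: "('g, 'm) monoid_scheme \<Rightarrow> 'g set \<Rightarrow> bool" where
  "finite_generating_set G S \<longleftrightarrow> finite S \<and> S \<subseteq> carrier G \<and> generate G S = carrier G"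

text \<open>Ends are considered for finitely generated groups only; the number of ends of a Cayley
  graph does not depend on the finite generating set.  Finite generation is part of the
  definition, so that it does not hold vacuously when no finite generating set exists.\<close>

definition at_most_one_end :: "('g, 'm) monoid_scheme \<Rightarrow> bool" where
  "at_most_one_end G \<longleftrightarrow>
     (\<exists>S. finite_generating_set G S) \<and>
     (\<forall>S. finite_generating_set G S \<longrightarrow>
        number_of_graph_ends (carrier G) (cayley_edges G S) \<le> 1)"

end

theory Submission
  imports Defs
begin

text \<open>The theorem is Morse theory for the distance to a base vertex in the universal cover of
  \<open>X\<close>. Let \<open>v\<close> be a vertex at distance \<open>n\<close> from the
  base vertex. By non-positive curvature, any two edges at \<open>v\<close> that lead towards
  the base vertex span a square, so the flag condition makes the descending edges at
  \<open>v\<close> into a simplex \<open>\<sigma>\<close> of the link of \<open>v\<close>; it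
  is empty only at the base vertex. The ascending edges are the vertices of the link outside
  of \<open>\<sigma>\<close>. As links are connected and have no cut simplices, any two
  ascending edges are joined by a path in the link that avoids \<open>\<sigma>\<close>. Such a
  path is a sequence of squares at \<open>v\<close>, whose sides opposite to \<open>v\<close>
  pass around \<open>v\<close> at distance greater than \<open>n\<close>. So a path in the
  universal cover can be pushed off its lowest vertices again and again, and the complement of
  every ball is connected (\<open>far_connected\<close>). As \<open>\<pi>\<^sub>1(X)\<close> acts freely
  and cocompactly, the same follows coarsely for its Cayley graphs: outside of a finite set
  there is only one infinite component (\<open>infinite_components_equal\<close>).

  The universal cover is built from words. Its vertices are reduced edge paths in
  \<open>X\<close> up to exchanging the two halves of the boundaries of squares. The flag
  condition enters through the lemma \<open>sim_heads\<close>, a variant of Garside's lemma for monoids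
  with complemented presentations: paths that agree up to such exchanges and end with
  different edges have a square in common at the end. It follows that reduced paths are unique
  up to exchanges, that edges act on their classes (\<open>act_square\<close>), and that descending edges
  span squares (\<open>down_square\<close>).

  It remains to identify the loops in \<open>X\<close> up to homotopy with the closed edge
  paths up to combinatorial homotopy. For this purpose \<open>X\<close> is mapped to the
  polyhedron that has the vertices of \<open>X\<close> and one simplex for each cube, spanned
  by the vertices of the cube. Multilinear coordinates give a map \<open>\<beta>\<close> to
  it, and averaging gives a retraction \<open>\<rho>\<close> back to \<open>X\<close>, with
  \<open>\<beta> \<circ> \<rho>\<close> homotopic to the identity along segments. In the
  polyhedron, all points of a simplex see each other, so loops become polygonal
  (\<open>path_approximable\<close>) and combinatorial homotopies become homotopies (\<open>homot_poly_eq\<close>).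
  Conversely, the classes of reduced paths form a local system over the polyhedron, hence a
  covering space (\<open>covering_total\<close>), and monodromy shows that homotopic edge loops have the
  same reduced form. That \<open>\<beta>\<close> and \<open>\<rho>\<close> are well defined
  depends on the fact that an isometry between faces of cubes is a permutation of the
  coordinates followed by reflections (\<open>face_isometry_signed_permutation\<close>).\<close>

section \<open>Edge paths in a square complex\<close>

lemma rtranclp_mapI:
  assumes "R\<^sup>*\<^sup>* x y" and "\<And>a b. R a b \<Longrightarrow> S (f a) (f b)"
  shows "S\<^sup>*\<^sup>* (f x) (f y)"
  using assms(1) by (induction) (auto intro: rtranclp.rtrancl_into_rtrancl assms(2))

text \<open>The 1-skeleton of a cube complex together with its squares; \<open>sq u a v b\<close> lists
  the vertices of a square in cyclic order. The last axiom is what the flag condition becomes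
  for squares: if three squares meet at the vertex \<open>g\<close> like the sides of a cube
  at a corner, then the other three squares of that cube exist, and they meet at a vertex
  \<open>s\<close>.\<close>

locale squared_graph =
  fixes adj :: "'v \<Rightarrow> 'v \<Rightarrow> bool" and sq :: "'v \<Rightarrow> 'v \<Rightarrow> 'v \<Rightarrow> 'v \<Rightarrow> bool"
  assumes adj_sym: "adj u v \<Longrightarrow> adj v u"
    and sq_rotate: "sq u a v b \<Longrightarrow> sq a v b u"
    and sq_flip: "sq u a v b \<Longrightarrow> sq u b v a"
    and sq_adj: "sq u a v b \<Longrightarrow> adj u a"
    and sq_diag: "sq u a v b \<Longrightarrow> u \<noteq> v"
    and sq_unique: "sq u a v b \<Longrightarrow> sq u a v b' \<Longrightarrow> b = b'"
    and sq_cube: "sq u a v g \<Longrightarrow> sq u' g v b \<Longrightarrow> sq t u g u' \<Longrightarrow>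
                   \<exists>s. sq s a v b \<and> sq t u a s \<and> sq t u' b s"
begin

lemma sq_sides:
  assumes "sq u a v b"
  shows "adj u a" "adj a v" "adj v b" "adj b u" "a \<noteq> b" "u \<noteq> v"
  using assms sq_rotate sq_adj sq_diag by blast+

lemma sq_opposite: "sq u a v b \<Longrightarrow> sq v a u b"
  using sq_rotate sq_flip by meson

text \<open>Edge paths are lists of vertices in reverse order: the head is the end point, so that a path
  grows at its head. A flip replaces one half of the boundary of a square by the other half;
  it keeps the length. Paths are compared by flips alone as long as possible, and backtracks
  are treated separately by passing to reduced paths.\<close>

inductive flip :: "'v list \<Rightarrow> 'v list \<Rightarrow> bool" where
  corner: "sq u a v b \<Longrightarrow> flip (v # a # u # r) (v # b # u # r)"
| step: "flip p q \<Longrightarrow> flip (x # p) (x # q)"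

inductive_cases flip_ConsE: "flip (v # p) (w # q)"

abbreviation sim :: "'v list \<Rightarrow> 'v list \<Rightarrow> bool" (infix "\<simeq>" 50) where
  "p \<simeq> q \<equiv> flip\<^sup>*\<^sup>* p q"

definition walk :: "'v list \<Rightarrow> bool" where
  "walk p \<longleftrightarrow> p \<noteq> [] \<and> successively adj p"

lemma walk_simps [simp]:
  "\<not> walk []" "walk [v]" "walk (v # u # p) \<longleftrightarrow> adj v u \<and> walk (u # p)"
  by (auto simp: walk_def)

lemma flip_sym: "flip p q \<Longrightarrow> flip q p"
  by (induction rule: flip.induct) (auto intro: flip.intros dest: sq_flip)

lemma sim_sym: "p \<simeq> q \<Longrightarrow> q \<simeq> p"
  by (metis flip_sym sympI sympD symp_rtranclp)

lemma sim_Cons: "p \<simeq> q \<Longrightarrow> x # p \<simeq> x # q"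
  by (rule rtranclp_mapI[where f = "(#) x" and S = flip and R = flip]) (auto intro: flip.step)

lemma sim_corner: "sq u a v b \<Longrightarrow> v # a # u # r \<simeq> v # b # u # r"
  by (auto intro: flip.corner)

lemma flip_invariants:
  "flip p q \<Longrightarrow> length q = length p \<and> hd q = hd p \<and> last q = last p \<and> p \<noteq> [] \<and> q \<noteq> [] \<and> (walk p \<longrightarrow> walk q)"
proof (induction rule: flip.induct)
  case (corner u a v b r)
  then show ?case using sq_sides[OF corner] adj_sym by auto
next
  case (step p q x)
  then show ?case by (cases p; cases q) auto
qed

lemma sim_invariants:
  assumes "p \<simeq> q"
  shows "length q = length p" "hd q = hd p" "last q = last p" "p = [] \<longleftrightarrow> q = []" "walk p \<Longrightarrow> walk q"
  using assms by (induction, auto dest: flip_invariants)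

text \<open>The analogue of Garside's lemma for positive words. If two paths that agree up to flips
  enter their common end point along different edges, then these edges are two sides of a
  square and both paths can be routed through the opposite vertex \<open>u\<close> of it. The
  proof follows a chain of flips. The only serious case is that the paths already enter
  \<open>v\<close> along two sides of a square through \<open>g\<close> and the next flip is
  at \<open>v\<close>: then the path up to \<open>g\<close>, which is shorter, enters
  \<open>g\<close> in two ways, so by induction three squares meet at \<open>g\<close>, and
  the cube axiom completes them.\<close>

lemma sim_heads:
  "v # a # P \<simeq> w # b # Q \<Longrightarrow>
     v = w \<and> (a = b \<and> a # P \<simeq> b # Q \<or>
       (\<exists>u r. sq u a v b \<and> a # P \<simeq> a # u # r \<and> b # Q \<simeq> b # u # r))"
proof (induction "length P" arbitrary: v a P w b Q rule: less_induct)
  case less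
  have "v # a # P \<simeq> x \<Longrightarrow> \<forall>g S. x = v # g # S \<longrightarrow>
      (a = g \<and> a # P \<simeq> g # S \<or> (\<exists>u r. sq u a v g \<and> a # P \<simeq> a # u # r \<and> g # S \<simeq> g # u # r))" for x
  proof (induction rule: rtranclp_induct)
    case base
    then show ?case by auto
  next
    case (step y z)
    have "length y = length (v # a # P)" "hd y = v"
      using sim_invariants[OF step(1)] by auto
    then obtain g S where y: "y = v # g # S"
      by (cases y; cases "tl y") auto
    show ?case
    proof (intro allI impI)
      fix h R assume z: "z = v # h # R"
      from step(2) consider (in_tail) "flip (g # S) (h # R)"
        | (at_corner) u' S' where "S = u' # S'" "R = u' # S'" "sq u' g v h"
        unfolding y z by (rule flip_ConsE) blast+
      then show "a = h \<and> a # P \<simeq> h # R \<or> (\<exists>u r. sq u a v h \<and> a # P \<simeq> a # u # r \<and> h # R \<simeq> h # u # r)"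
      proof cases
        case in_tail
        then have "g = h" using flip_invariants by force
        moreover have "h # R \<simeq> g # S" using in_tail flip_sym by blast
        moreover have "a = g \<and> a # P \<simeq> g # S \<or> 
            (\<exists>u r. sq u a v g \<and> a # P \<simeq> a # u # r \<and> g # S \<simeq> g # u # r)"
          using step(3) y by simp
        moreover have "a # P \<simeq> g # S \<Longrightarrow> a # P \<simeq> h # R"
          using in_tail by (meson rtranclp.rtrancl_into_rtrancl)
        moreover have "g # S \<simeq> g # u # r \<Longrightarrow> h # R \<simeq> g # u # r" for u r
          using calculation(2) by (rule rtranclp_trans)
        ultimately show ?thesis by blast
      next
        case at_corner
        from step(3) y consider "a = g" "a # P \<simeq> g # S"
          | u r where "sq u a v g" "a # P \<simeq> a # u # r" "g # S \<simeq> g # u # r" by blast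
        then show ?thesis
        proof cases
          case 1
          then show ?thesis using at_corner by blast
        next
          case (2 u r)
          have "length S' < length P"
            using sim_invariants(1)[OF 2(2)] sim_invariants(1)[OF 2(3)] at_corner by simp
          then have "u = u' \<and> u # r \<simeq> u' # S' \<or>
             (\<exists>t T. sq t u' g u \<and> u' # S' \<simeq> u' # t # T \<and> u # r \<simeq> u # t # T)"
            using less(1)[of S' g u' g u r] 2(3) at_corner(1) sim_sym by blast
          then consider "u = u'" "u # r \<simeq> u' # S'"
            | t T where "sq t u' g u" "u' # S' \<simeq> u' # t # T" "u # r \<simeq> u # t # T" by blast
          then show ?thesis
          proof cases
            case 1
            have "sq u g v a" using 2(1) sq_flip by blast
            then have "a = h" using at_corner(3) 1(1) sq_unique by blast
            moreover have "a # P \<simeq> a # u' # S'" using 2(2) sim_Cons[OF 1(2)] by (rule rtranclp_trans)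
            ultimately show ?thesis using at_corner(2) by simp
          next
            case (2 t T)
            note sq3 = \<open>sq u a v g\<close> at_corner(3) sq_flip[OF 2(1)]
            obtain s where s: "sq s a v h" "sq t u a s" "sq t u' h s"
              using sq_cube[OF sq3] by blast
            have "a # P \<simeq> a # u # t # T"
              using \<open>a # P \<simeq> a # u # r\<close> sim_Cons[OF 2(3)] by (rule rtranclp_trans)
            also have "a # u # t # T \<simeq> a # s # t # T" using s(2) sim_corner by blast
            finally have 1: "a # P \<simeq> a # s # t # T" .
            have "h # R \<simeq> h # u' # t # T" using at_corner(2) sim_Cons[OF 2(2)] by simp
            also have "h # u' # t # T \<simeq> h # s # t # T" using s(3) sim_corner by blast
            finally show ?thesis using 1 s(1) by blast
          qed
        qed
      qed
    qed
  qed
  moreover have "w = v" using sim_invariants(2)[OF less(2)] by simp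
  ultimately show ?case using less(2) by blast
qed

text \<open>Cancellation of a common last edge.\<close>

lemma sim_ConsD:
  assumes "x # p \<simeq> x # q" "p \<noteq> []" "hd p = hd q"
  shows "p \<simeq> q"
proof -
  have "q \<noteq> []" using sim_invariants(1)[OF assms(1)] assms(2) by auto
  then obtain a P Q where "p = a # P" "q = a # Q" using assms by (cases p; cases q) auto
  moreover have "\<not> sq u a x a" for u using sq_sides(5) by blast
  moreover have "a # P \<simeq> a # Q" if "x # a # P \<simeq> x # a # Q"
    using sim_heads[OF that] calculation(3) by blast
  ultimately show ?thesis using assms(1) by simp
qed

fun backtracks :: "'v list \<Rightarrow> bool" where
  "backtracks (a # b # c # r) \<longleftrightarrow> a = c \<or> backtracks (b # c # r)"
| "backtracks _ \<longleftrightarrow> False"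

text \<open>A path is reduced if no sequence of flips makes a backtrack visible.\<close>

definition reduced :: "'v list \<Rightarrow> bool" where
  "reduced p \<longleftrightarrow> (\<forall>q. p \<simeq> q \<longrightarrow> \<not> backtracks q)"

lemma backtracks_Cons: "backtracks p \<Longrightarrow> backtracks (x # p)"
  by (cases p rule: backtracks.cases) auto

lemma reduced_Cons: "reduced (x # p) \<Longrightarrow> reduced p"
  unfolding reduced_def using sim_Cons backtracks_Cons by blast

lemma reduced_sim: "reduced p \<Longrightarrow> p \<simeq> q \<Longrightarrow> reduced q"
  unfolding reduced_def by (meson rtranclp_trans)

lemma reduced_singleton: "reduced [v]"
  unfolding reduced_def
proof (intro allI impI)
  fix q assume "[v] \<simeq> q"
  then have "length q = 1" using sim_invariants(1) by fastforce
  then show "\<not> backtracks q" by (cases q rule: backtracks.cases) auto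
qed

text \<open>A reduced path stays reduced when it is extended by an edge that is not the inverse of a
  possible last edge. If flips bring up a backtrack in the longer path, the square given by
  \<open>sim_heads\<close> transports it into a shorter path of the same kind, or else exhibits
  \<open>v\<close> as a possible predecessor of \<open>u\<close>.\<close>

lemma reduced_extend:
  assumes "reduced (u # p)" "\<nexists>r. u # p \<simeq> u # v # r"
  shows "reduced (v # u # p)"
  using assms
proof (induction "length p" arbitrary: v u p rule: less_induct)
  case less
  show ?case unfolding reduced_def
  proof (intro allI impI notI)
    fix q assume q: "v # u # p \<simeq> q" "backtracks q"
    then obtain b Q where bQ: "q = v # b # Q"
      using sim_invariants(1,2)[OF q(1)] by (cases q; cases "tl q") auto
    from sim_heads q(1) bQ consider "u = b" "u # p \<simeq> b # Q"
      | t r where "sq t u v b" "u # p \<simeq> u # t # r" "b # Q \<simeq> b # t # r" by blast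
    then show False
    proof cases
      case 1
      then have "\<not> backtracks (b # Q)" using less(2) reduced_def by blast
      then have "\<exists>y. Q = v # y" using q(2) bQ by (cases Q) auto
      then show False using 1 less(3) by blast
    next
      case (2 t r)
      have red: "reduced (u # t # r)" using reduced_sim[OF less(2) 2(2)] .
      show False
      proof (cases "backtracks (b # Q)")
        case True
        have "length r < length p" using sim_invariants(1)[OF 2(2)] by simp
        moreover have "reduced (t # r)" using red reduced_Cons by blast
        moreover have "\<not> reduced (b # t # r)"
          using True sim_sym[OF 2(3)] unfolding reduced_def by blast
        ultimately obtain r' where r': "t # r \<simeq> t # b # r'" using less(1) by blast
        have "sq b t u v" using 2(1) sq_rotate by blast
        then have "u # t # b # r' \<simeq> u # v # b # r'" using sim_corner by blast
        then show False using less(3) 2(2) sim_Cons[OF r', of u] by (meson rtranclp_trans)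
      next
        case False
        then obtain y where "Q = v # y" using q(2) bQ by (cases Q) auto
        then have "b # v # y \<simeq> b # t # r" using 2(3) by simp
        from sim_heads[OF this] sq_sides(6)[OF 2(1)] obtain s r' where
          s: "sq s v b t" "t # r \<simeq> t # s # r'" by blast
        have "sq v b t s" "sq v b t u" using s(1) 2(1) sq_rotate by blast+
        then have "s = u" using sq_unique by blast
        then have "u # t # r \<simeq> u # t # u # r'" using s(2) sim_Cons by blast
        then show False using red unfolding reduced_def by force
      qed
    qed
  qed
qed

text \<open>A chosen element of each flip class; reduced paths of this form are the vertices of the
  universal cover in the sequel.\<close>

definition rep :: "'v list \<Rightarrow> 'v list" where
  "rep p = (SOME q. p \<simeq> q)"

lemma sim_rep: "p \<simeq> rep p"
  unfolding rep_def by (rule someI[of _ p]) simp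

lemma rep_cong: "p \<simeq> q \<Longrightarrow> rep p = rep q"
proof -
  assume "p \<simeq> q"
  then have "(\<simeq>) p = (\<simeq>) q" by (meson ext rtranclp_trans sim_sym)
  then show ?thesis unfolding rep_def by simp
qed

definition normal :: "'v list \<Rightarrow> bool" where
  "normal p \<longleftrightarrow> walk p \<and> reduced p \<and> rep p = p"

text \<open>The neighbours of the end point that lie one step closer to the start of the path.\<close>

definition down :: "'v list \<Rightarrow> 'v set" where
  "down p = {w. \<exists>r. p \<simeq> hd p # w # r}"

text \<open>One step in the universal cover: a possible last edge is taken back, any other edge is
  appended. That this depends only on the flip class rests on cancellation.\<close>

definition act :: "'v \<Rightarrow> 'v list \<Rightarrow> 'v list" where
  "act w p = (if w \<in> down p then rep (w # (SOME r. p \<simeq> hd p # w # r)) else rep (w # p))"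

lemma act_down: 
  assumes "p \<simeq> u # w # r"
  shows "act w p = rep (w # r)"
proof -
  have u: "u = hd p" using sim_invariants(2)[OF assms] by simp
  define r' where "r' = (SOME r. p \<simeq> hd p # w # r)"
  have "p \<simeq> hd p # w # r'" using assms u unfolding r'_def by (metis (mono_tags, lifting) someI)
  then have "u # w # r \<simeq> u # w # r'" using assms u sim_sym by (meson rtranclp_trans)
  then have "w # r \<simeq> w # r'" using sim_ConsD by fastforce
  moreover have "w \<in> down p" using assms u by (auto simp: down_def)
  ultimately show ?thesis unfolding act_def r'_def using rep_cong by metis
qed

lemma act_up: "w \<notin> down p \<Longrightarrow> act w p = rep (w # p)"
  by (simp add: act_def)

lemma normal_rep: "walk p \<Longrightarrow> reduced p \<Longrightarrow> normal (rep p)"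
  unfolding normal_def using sim_rep rep_cong reduced_sim sim_invariants(5) by metis

lemma normalD: "normal p \<Longrightarrow> p \<noteq> []" "normal p \<Longrightarrow> p = hd p # tl p"
  by (auto simp: normal_def walk_def)

lemma reduced_up:
  assumes "normal p" "w \<notin> down p"
  shows "reduced (w # p)"
  using reduced_extend[of "hd p" "tl p" w] assms normalD[OF assms(1)]
  unfolding down_def normal_def by auto

lemma act_facts:
  assumes p: "normal p" and w: "adj (hd p) w"
  shows "normal (act w p)" and "hd (act w p) = w" and "last (act w p) = last p"
    and "w \<in> down p \<Longrightarrow> Suc (length (act w p)) = length p"
    and "w \<notin> down p \<Longrightarrow> length (act w p) = Suc (length p)"
    and "act (hd p) (act w p) = p"
proof -
  have red: "reduced p" "walk p" "rep p = p" using p by (auto simp: normal_def)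
  have "normal (act w p) \<and> hd (act w p) = w \<and> last (act w p) = last p \<and>
    (w \<in> down p \<longrightarrow> Suc (length (act w p)) = length p) \<and> 
    (w \<notin> down p \<longrightarrow> length (act w p) = Suc (length p)) \<and> act (hd p) (act w p) = p"
  proof (cases "w \<in> down p")
    case True
    then obtain r where r: "p \<simeq> hd p # w # r" by (auto simp: down_def)
    have a: "act w p = rep (w # r)" using act_down[OF r] .
    have wr: "walk (w # r)" "reduced (w # r)"
      using sim_invariants(5)[OF r red(2)] reduced_sim[OF red(1) r] reduced_Cons by auto
    note inv = sim_invariants[OF sim_rep[of "w # r"]] 
    have "hd p \<notin> down (rep (w # r))"
    proof
      assume "hd p \<in> down (rep (w # r))"
      then obtain r' where "rep (w # r) \<simeq> w # hd p # r'" using inv by (auto simp: down_def)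
      then have "w # r \<simeq> w # hd p # r'" using sim_rep by (meson rtranclp_trans)
      then have "p \<simeq> hd p # w # hd p # r'" using r sim_Cons by (meson rtranclp_trans)
      then show False using red(1) unfolding reduced_def by force
    qed
    then have "act (hd p) (act w p) = rep (hd p # rep (w # r))" using act_up a by simp
    also have "\<dots> = rep (hd p # w # r)" using rep_cong[OF sim_Cons[OF sim_rep]] by metis
    also have "\<dots> = p" using rep_cong[OF r] red by simp
    finally have b: "act (hd p) (act w p) = p" .
    show ?thesis using b True inv a normal_rep[OF wr] sim_invariants(1,3)[OF r] by auto
  next
    case False
    have a: "act w p = rep (w # p)" using act_up[OF False] .
    have wr: "walk (w # p)" "reduced (w # p)"
      using reduced_up[OF p False] red w adj_sym normalD(2)[OF p] 
      by (metis walk_simps(3))+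
    note inv = sim_invariants[OF sim_rep[of "w # p"]]
    have "w # p \<simeq> w # hd p # tl p" using normalD(2)[OF p] by simp
    then have "rep (w # p) \<simeq> w # hd p # tl p" using sim_sym[OF sim_rep] by (meson rtranclp_trans)
    then have "act (hd p) (act w p) = p" using act_down a normalD(2)[OF p] red(3) by metis
    then show ?thesis using False inv a normal_rep[OF wr] normalD(1)[OF p] by auto
  qed
  then show "normal (act w p)" and "hd (act w p) = w" and "last (act w p) = last p"
    and "w \<in> down p \<Longrightarrow> Suc (length (act w p)) = length p"
    and "w \<notin> down p \<Longrightarrow> length (act w p) = Suc (length p)"
    and "act (hd p) (act w p) = p" by auto
qed

lemma down_up:
  assumes p: "normal p" and s: "sq u a v b" and u: "hd p = u" and a: "a \<notin> down p" and b: "b \<notin> down p"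
  shows "v \<notin> down (act a p)" 
proof
  have adj: "adj (hd p) a" using s u sq_sides by blast
  assume "v \<in> down (act a p)"
  then obtain r where "act a p \<simeq> a # v # r" using act_facts(2)[OF p adj] by (auto simp: down_def)
  then have "a # p \<simeq> a # v # r" using act_up[OF a] sim_rep by (metis rtranclp_trans)
  then have "a # u # tl p \<simeq> a # v # r" using normalD(2)[OF p] u by simp
  from sim_heads[OF this] sq_sides[OF s] obtain t r' where
    t: "sq t u a v" "u # tl p \<simeq> u # t # r'" by blast
  have "sq u a v t" "sq u a v b" using t(1) s sq_rotate by blast+
  then have "t = b" using sq_unique by blast
  then show False using t(2) b u normalD(2)[OF p] by (auto simp: down_def)
qed

text \<open>This is where non-positive curvature enters the Morse argument: by \<open>sim_heads\<close> any two
  descending edges span a square, so that all of them together form the corner of a cube.\<close>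

lemma down_square:
  assumes p: "normal p" and a: "a \<in> down p" and b: "b \<in> down p" and ab: "a \<noteq> b"
  shows "\<exists>t. sq (hd p) a t b \<and> b \<in> down p \<and> t \<in> down (act a p) \<and> t \<in> down (act b p) \<and> 
     act t (act a p) = act t (act b p)"
proof -
  obtain r r' where r: "p \<simeq> hd p # a # r" "p \<simeq> hd p # b # r'"
    using a b by (auto simp: down_def)
  then have "hd p # a # r \<simeq> hd p # b # r'" using sim_sym by (meson rtranclp_trans)
  from sim_heads[OF this] ab obtain t R where
    t: "sq t a (hd p) b" "a # r \<simeq> a # t # R" "b # r' \<simeq> b # t # R" by blast
  have 1: "act a p \<simeq> a # t # R" "act b p \<simeq> b # t # R"
    using act_down[OF r(1)] act_down[OF r(2)] sim_sym[OF sim_rep] t(2,3) by (metis rtranclp_trans)+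
  then have "act t (act a p) = act t (act b p)" using act_down by metis
  moreover have "t \<in> down (act a p)" "t \<in> down (act b p)"
    using 1 sim_invariants(2)[OF 1(1)] sim_invariants(2)[OF 1(2)] by (auto simp: down_def)
  ultimately show ?thesis using sq_opposite[OF t(1)] b by blast
qed

text \<open>The two ways around a square agree also when one of them starts by going down and the other
  one by going up.\<close>

lemma act_square_aux:
  assumes p: "normal p" and s: "sq u a v b" and u: "hd p = u" and a: "a \<in> down p" and b: "b \<notin> down p"
  shows "act v (act a p) = act v (act b p)"
proof -
  have adj: "adj (hd p) a" "adj (hd p) b" using u sq_sides[OF s] adj_sym by auto
  obtain r where r: "p \<simeq> u # a # r" using a u by (auto simp: down_def)
  have "sq a u b v" using s sq_flip sq_rotate by meson
  then have "b # u # a # r \<simeq> b # v # a # r" using sim_corner by blast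
  then have 1: "b # p \<simeq> b # v # a # r" using sim_Cons[OF r] by (meson rtranclp_trans)
  have bp: "act b p \<simeq> b # v # a # r" using act_up[OF b] sim_sym[OF sim_rep] 1 by (metis rtranclp_trans)
  have "reduced (b # v # a # r)" using reduced_sim[OF reduced_up[OF p b] 1] .
  then have red: "reduced (v # a # r)" using reduced_Cons by blast
  have ap: "act a p = rep (a # r)" using act_down[OF r] .
  have "v \<notin> down (act a p)"
  proof
    assume "v \<in> down (act a p)"
    then obtain r' where "act a p \<simeq> a # v # r'" using act_facts(2)[OF p adj(1)] by (auto simp: down_def)
    then have "a # r \<simeq> a # v # r'" using ap sim_rep by (metis rtranclp_trans)
    then have "v # a # r \<simeq> v # a # v # r'" by (rule sim_Cons)
    then show False using red unfolding reduced_def by force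
  qed
  then have "act v (act a p) = rep (v # act a p)" by (rule act_up)
  also have "\<dots> = rep (v # a # r)" using ap rep_cong[OF sim_Cons[OF sim_rep]] by metis
  also have "\<dots> = act v (act b p)" using act_down[OF bp] by simp
  finally show ?thesis .
qed

text \<open>Together with the fact that a step can be undone, this says that steps act on normal paths
  compatibly with homotopies across squares.\<close>

lemma act_square:
  assumes p: "normal p" and s: "sq u a v b" and u: "hd p = u"
  shows "act v (act a p) = act v (act b p)"
proof -
  have s': "sq u b v a" using s sq_flip by blast
  consider "a \<in> down p" "b \<notin> down p" | "b \<in> down p" "a \<notin> down p"
    | "a \<in> down p" "b \<in> down p" | "a \<notin> down p" "b \<notin> down p" by blast
  then show ?thesis
  proof cases
    case 1
    then show ?thesis using act_square_aux[OF p s u] by blast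
  next
    case 2
    then show ?thesis using act_square_aux[OF p s' u] by simp
  next
    case 3
    obtain t where "sq u a t b" "act t (act a p) = act t (act b p)"
      using down_square[OF p 3] sq_sides(5)[OF s] u by blast
    moreover have "t = v"
      using calculation(1) s sq_unique sq_rotate by meson
    ultimately show ?thesis by simp
  next
    case 4
    have "act v (act a p) = rep (v # a # p)"
      using act_up[OF down_up[OF p s u 4]] act_up[OF 4(1)] rep_cong[OF sim_Cons[OF sim_rep]] by metis
    also have "\<dots> = rep (v # b # p)"
      using rep_cong[OF sim_corner[OF s, of "tl p"]] normalD(2)[OF p] u by simp
    also have "\<dots> = act v (act b p)"
      using act_up[OF down_up[OF p s' u 4(2,1)]] act_up[OF 4(2)] rep_cong[OF sim_Cons[OF sim_rep]] by metis
    finally show ?thesis .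
  qed
qed

text \<open>The path is followed in the universal cover from a given vertex; the result is the vertex
  reached.\<close>

fun develop :: "'v list \<Rightarrow> 'v list \<Rightarrow> 'v list" where
  "develop (v # u # p) s = act v (develop (u # p) s)"
| "develop _ s = s"

lemma develop_facts:
  assumes "walk p" "normal s" "hd s = last p"
  shows "normal (develop p s) \<and> hd (develop p s) = hd p \<and> last (develop p s) = last s"
  using assms(1,3)
proof (induction p rule: induct_list012)
  case (3 v u p)
  then have IH: "normal (develop (u # p) s) \<and> hd (develop (u # p) s) = u \<and> last (develop (u # p) s) = last s" by auto
  have "adj (hd (develop (u # p) s)) v" using IH 3 adj_sym by auto
  then show ?case using act_facts[OF conjunct1[OF IH]] IH by auto
qed (use assms in auto)

lemma develop_append:
  assumes "p \<noteq> []" "q \<noteq> []" "last q = hd p"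
  shows "develop (q @ tl p) s = develop q (develop p s)"
  using assms
proof (induction q rule: induct_list012)
  case (2 v)
  then show ?case by (cases p) auto
next
  case (3 v u q)
  then show ?case by simp
qed auto

lemma rep_singleton: "rep [v] = [v]"
  using sim_invariants(1,2)[OF sim_rep[of "[v]"]] by (cases "rep [v]") auto

text \<open>So every vertex of the universal cover is reached from the base vertex along a walk.\<close>

lemma develop_normal:
  assumes "normal p"
  shows "develop p [last p] = p"
proof -
  have "walk q \<Longrightarrow> reduced q \<Longrightarrow> develop q [last q] = rep q" for q
  proof (induction q rule: induct_list012)
    case (2 v)
    show ?case by simp (metis rep_singleton)
  next
    case (3 v u q)
    have IH: "develop (u # q) [last (u # q)] = rep (u # q)" 
      using 3 reduced_Cons by auto
    have "v \<notin> down (rep (u # q))"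
    proof
      assume "v \<in> down (rep (u # q))"
      then obtain r where "rep (u # q) \<simeq> u # v # r"
        using sim_invariants(2)[OF sim_rep[of "u # q"]] by (auto simp: down_def)
      then have "u # q \<simeq> u # v # r" using sim_rep by (metis rtranclp_trans)
      then have "v # u # q \<simeq> v # u # v # r" by (rule sim_Cons)
      then show False using 3(4) unfolding reduced_def by force
    qed
    then have "act v (rep (u # q)) = rep (v # u # q)"
      using act_up rep_cong[OF sim_Cons[OF sim_rep]] by metis
    then show ?case using IH by simp
  qed auto
  then show ?thesis using assms by (simp add: normal_def)
qed

lemma normal_singleton: "normal [v]"
  by (simp add: normal_def reduced_singleton rep_singleton)

lemma walk_join:
  assumes "walk p" "walk q" "last q = hd p"
  shows "walk (q @ tl p)" "hd (q @ tl p) = hd q" "last (q @ tl p) = last p"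
proof -
  obtain v r where p: "p = v # r" using assms(1) by (cases p) auto
  obtain r' where q: "q = r' @ [v]" using assms p by (cases q rule: rev_cases) auto
  show "walk (q @ tl p)" using assms p q by (cases r) (auto simp: walk_def successively_append_iff)
  show "hd (q @ tl p) = hd q" using q by (cases r') simp_all
  show "last (q @ tl p) = last p" using p q by (cases r) auto
qed

text \<open>Combinatorial homotopy of edge paths: squares may be crossed and backtracks inserted or
  removed.\<close>

inductive homot :: "'v list \<Rightarrow> 'v list \<Rightarrow> bool" where
  stay: "homot p p"
| compose: "homot p q \<Longrightarrow> homot q r \<Longrightarrow> homot p r"
| square: "walk (x @ [v, a, u] @ y) \<Longrightarrow> sq u a v b \<Longrightarrow> homot (x @ [v, a, u] @ y) (x @ [v, b, u] @ y)"
| remove: "walk (x @ [v, u, v] @ y) \<Longrightarrow> homot (x @ [v, u, v] @ y) (x @ [v] @ y)"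
| insert: "walk (x @ [v, u, v] @ y) \<Longrightarrow> homot (x @ [v] @ y) (x @ [v, u, v] @ y)"

lemma homot_Cons:
  assumes "homot p q" "walk (x # p)" "p \<noteq> []"
  shows "homot (x # p) (x # q) \<and> walk (x # q) \<and> hd p = hd q \<and> q \<noteq> []"
  using assms
proof (induction)
  case (stay p)
  then show ?case by (auto intro: homot.stay)
next
  case (compose p q r)
  then show ?case by (metis homot.compose)
next
  case (square z v a u y b)
  have "walk (x # z @ [v, b, u] @ y)"
    using square sq_sides[OF square(2)] adj_sym 
    by (cases z) (auto simp: walk_def successively_append_iff successively_Cons hd_append split: if_splits)
  then show ?case using homot.square[of "x # z" v a u y b] square by (cases z) auto
next
  case (remove z v u y)
  then show ?case using homot.remove[of "x # z" v u y] 
    by (cases z) (auto simp: walk_def successively_append_iff successively_Cons hd_append split: if_splits)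
next
  case (insert z v u y)
  then show ?case using homot.insert[of "x # z" v u y] adj_sym
    by (cases z) (auto simp: walk_def successively_append_iff successively_Cons hd_append split: if_splits)
qed

lemma homot_flip:
  assumes "flip p q" "walk p"
  shows "homot p q"
  using assms
proof (induction)
  case (corner u a v b r)
  then show ?case using homot.square[of "[]" v a u r b] by simp
next
  case (step p q x)
  then have "p \<noteq> []" using flip_invariants by blast
  moreover have "walk p" using step(3) \<open>p \<noteq> []\<close> by (cases p) auto
  ultimately show ?case using step homot_Cons by blast
qed

lemma homot_sim: "p \<simeq> q \<Longrightarrow> walk p \<Longrightarrow> homot p q \<and> walk q"
  by (induction rule: rtranclp_induct) (auto intro: homot.stay dest: flip_invariants homot_flip homot.compose)

text \<open>Along the walk, a step up extends the normal form, and a step down cancels a backtrack that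
  flips bring to the end of the path. Hence walks with the same normal form are homotopic.\<close>

lemma homot_develop:
  assumes "walk p"
  shows "homot p (develop p [last p])"
  using assms
proof (induction p rule: induct_list012)
  case (2 v)
  then show ?case by (simp add: homot.stay)
next
  case (3 v u p)
  define s where "s = develop (u # p) [last (u # p)]"
  have w: "walk (u # p)" "adj v u" using 3 by auto
  then have IH: "homot (u # p) s" using 3 s_def by simp
  have s: "normal s" "hd s = u" using develop_facts[OF w(1) normal_singleton] s_def by auto
  have 1: "homot (v # u # p) (v # s)" "walk (v # s)" using homot_Cons[OF IH 3(3)] by auto
  have "homot (v # s) (act v s)"
  proof (cases "v \<in> down s")
    case True
    then obtain r where r: "s \<simeq> u # v # r" using s by (auto simp: down_def)
    have "homot (v # s) (v # u # v # r)" "walk (v # u # v # r)"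
      using homot_sim[OF sim_Cons[OF r, of v] 1(2)] by auto
    moreover have "homot (v # u # v # r) (v # r)"
      using homot.remove[of "[]" v u r] calculation(2) by simp
    moreover have "homot (v # r) (rep (v # r))" 
      using homot_sim[OF sim_rep[of "v # r"]] calculation(2) by simp
    ultimately show ?thesis using act_down[OF r] homot.compose by metis
  next
    case False
    then show ?thesis using act_up homot_sim[OF sim_rep 1(2)] by simp
  qed
  then have "homot (v # u # p) (act v s)" by (rule homot.compose[OF 1(1)])
  then show ?case using s_def by simp
qed auto

lemma homot_sym:
  assumes "homot p q"
  shows "homot q p"
  using assms
proof (induction)
  case (square x v a u y b)
  have "walk (x @ [v, b, u] @ y)"
    using square sq_sides[OF square(2)] adj_sym
    by (cases x) (auto simp: walk_def successively_append_iff successively_Cons hd_append split: if_splits)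
  then show ?case using homot.square[of x v b u y a] sq_flip[OF square(2)] by simp
next
  case (remove x v u y)
  then show ?case using homot.insert[of x v u y] by simp
next
  case (insert x v u y)
  then show ?case using homot.remove[of x v u y] by simp
qed (auto intro: homot.stay homot.compose)

end

section \<open>Pushing paths away from the base point\<close>

text \<open>For a set \<open>D\<close> of neighbours of \<open>v\<close> that pairwise span squares with
  \<open>v\<close>, i.e. a simplex of the link or the empty set, the part of the link outside
  of \<open>D\<close> is connected. The relation under the transitive closure is adjacency in
  the link.\<close>

locale ascending_links = squared_graph +
  assumes locally_finite: "finite {w. adj v w}"
    and link_connected: "\<And>v D a b. D \<subseteq> {w. adj v w} \<Longrightarrow>
        (\<And>c d. c \<in> D \<Longrightarrow> d \<in> D \<Longrightarrow> c \<noteq> d \<Longrightarrow> \<exists>q. sq v c q d) \<Longrightarrow>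
        adj v a \<Longrightarrow> adj v b \<Longrightarrow> a \<notin> D \<Longrightarrow> b \<notin> D \<Longrightarrow>
        (\<lambda>c d. c \<notin> D \<and> d \<notin> D \<and> (\<exists>q. sq v c q d))\<^sup>*\<^sup>* a b"
begin

text \<open>Edges of the universal cover that stay at distance at least \<open>n - 1\<close> from the
  base point: a normal path of length \<open>n\<close>, as a list, has \<open>n - 1\<close>
  edges.\<close>

definition far :: "nat \<Rightarrow> 'a list \<Rightarrow> 'a list \<Rightarrow> bool" where
  "far n s t \<longleftrightarrow> normal s \<and> n \<le> length s \<and> n \<le> length t \<and> (\<exists>w. adj (hd s) w \<and> t = act w s)"

lemma far_facts:
  assumes "far n s t"
  shows "normal t" "far n t s" "last t = last s"
proof -
  obtain w where w: "normal s" "n \<le> length s" "n \<le> length t" "adj (hd s) w" "t = act w s"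
    using assms by (auto simp: far_def)
  note t = act_facts[OF w(1,4), folded w(5)]
  show "normal t" "last t = last s" using t by auto
  have "adj (hd t) (hd s)" "s = act (hd s) t" using t w(4) adj_sym by auto
  then show "far n t s" using w t(1) unfolding far_def by blast
qed

lemma far_star_facts:
  assumes "(far n)\<^sup>*\<^sup>* s t" "normal s"
  shows "normal t \<and> (far n)\<^sup>*\<^sup>* t s"
  using assms
  by (induction) (auto dest: far_facts intro: converse_rtranclp_into_rtranclp)

lemma far_develop:
  assumes "walk p" "normal s" "hd s = last p"
  shows "(far 0)\<^sup>*\<^sup>* s (develop p s)"
  using assms(1,3)
proof (induction p rule: induct_list012)
  case (3 v u p)
  then have "(far 0)\<^sup>*\<^sup>* s (develop (u # p) s)" by auto
  moreover have "normal (develop (u # p) s)" "hd (develop (u # p) s) = u"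
    using develop_facts[of "u # p" s] 3 assms(2) by auto
  then have "far 0 (develop (u # p) s) (develop (v # u # p) s)"
    using 3 adj_sym by (auto simp: far_def)
  ultimately show ?case by (rule rtranclp.rtrancl_into_rtrancl)
qed auto

text \<open>The way from one ascending neighbour of \<open>t\<close> to another one around
  \<open>t\<close>. The ascending neighbours are the vertices of the link outside of the
  simplex of descending ones, so they are connected in the link; each edge of the link used on
  the way is a square at \<open>t\<close>, and the vertex of this square opposite to
  \<open>t\<close> is two steps farther from the base point than \<open>t\<close>.\<close>

lemma far_around:
  assumes t: "normal t" "length t = n" and a: "adj (hd t) a" "a \<notin> down t" and b: "adj (hd t) b" "b \<notin> down t"
  shows "(far (Suc n))\<^sup>*\<^sup>* (act a t) (act b t)"
proof -
  have D: "down t \<subseteq> {w. adj (hd t) w}"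
    using t(1) adj_sym sim_invariants(5) unfolding down_def normal_def by fastforce
  have sqD: "\<exists>q. sq (hd t) c q d" if "c \<in> down t" "d \<in> down t" "c \<noteq> d" for c d
    using down_square[OF t(1) that] by blast
  have "(\<lambda>c d. c \<notin> down t \<and> d \<notin> down t \<and> (\<exists>q. sq (hd t) c q d))\<^sup>*\<^sup>* a b"
    by (rule link_connected[OF D sqD a(1) b(1) a(2) b(2)])
  then show ?thesis
  proof induction
    case base
    then show ?case by simp
  next
    case (step c d)
    then obtain q where cd: "c \<notin> down t" "d \<notin> down t" and q: "sq (hd t) c q d" by blast
    have adj: "adj (hd t) c" "adj (hd t) d" "adj c q" "adj d q"
      using sq_sides[OF q] adj_sym by blast+
    have q': "sq (hd t) d q c" using q sq_flip by blast
    note c = act_facts[OF t(1) adj(1)] and d = act_facts[OF t(1) adj(2)]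
    have cq: "adj (hd (act c t)) q" and dq: "adj (hd (act d t)) q" using c d adj by auto
    note c' = act_facts[OF c(1) cq] and d' = act_facts[OF d(1) dq]
    have eq: "act q (act c t) = act q (act d t)" by (rule act_square[OF t(1) q refl])
    have "q \<notin> down (act c t)" using down_up[OF t(1) q refl cd] .
    then have 1: "far (Suc n) (act c t) (act q (act c t))" 
      using c(1,5) cq cd t c'(5) unfolding far_def by auto
    have "q \<notin> down (act d t)" using down_up[OF t(1) q' refl cd(2,1)] .
    then have "far (Suc n) (act d t) (act q (act d t))" 
      using d(1,5) dq cd t d'(5) unfolding far_def by auto
    then have "far (Suc n) (act q (act c t)) (act d t)" using far_facts(2) eq by metis
    then show ?case using 1 step(3) by (meson rtranclp.rtrancl_into_rtrancl)
  qed
qed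

text \<open>Pushing a path off the sphere of its lowest vertices. When the path reaches a vertex of
  minimal distance, the record kept is an ascending neighbour of it, so that the path can be
  continued around this vertex once it leaves upwards again.\<close>

lemma far_push:
  assumes "(far n)\<^sup>*\<^sup>* s t" "normal s" "n < length s"
  shows "normal t \<and> n \<le> length t \<and> (n < length t \<longrightarrow> (far (Suc n))\<^sup>*\<^sup>* s t) \<and>
     (length t = n \<longrightarrow> (\<exists>a. adj (hd t) a \<and> a \<notin> down t \<and> (far (Suc n))\<^sup>*\<^sup>* s (act a t)))"
  using assms
proof (induction)
  case base
  then show ?case by auto
next
  case (step t t')
  then have IH: "normal t" "n \<le> length t" "n < length t \<longrightarrow> (far (Suc n))\<^sup>*\<^sup>* s t"
    "length t = n \<longrightarrow> (\<exists>a. adj (hd t) a \<and> a \<notin> down t \<and> (far (Suc n))\<^sup>*\<^sup>* s (act a t))" by auto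
  from step(2) obtain w where w: "adj (hd t) w" "t' = act w t" "n \<le> length t'"
    by (auto simp: far_def)
  note t' = act_facts[OF IH(1) w(1), folded w(2)]
  show ?case
  proof (cases "length t = n")
    case True
    then obtain a where a: "adj (hd t) a" "a \<notin> down t" "(far (Suc n))\<^sup>*\<^sup>* s (act a t)"
      using IH by blast
    have up: "w \<notin> down t" using t'(4) True w(3) by linarith
    then have "(far (Suc n))\<^sup>*\<^sup>* (act a t) t'"
      using far_around[OF IH(1) True a(1,2) w(1)] w(2) by simp
    then have "(far (Suc n))\<^sup>*\<^sup>* s t'" using a(3) by (meson rtranclp_trans)
    then show ?thesis using t'(1,5) up True by auto
  next
    case False
    then have star: "(far (Suc n))\<^sup>*\<^sup>* s t" and len: "n < length t" using IH by auto
    show ?thesis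
    proof (cases "length t' = n")
      case True
      have adj: "adj (hd t') (hd t)" using t'(2) w(1) adj_sym by simp
      have "hd t \<notin> down t'"
        using act_facts(4)[OF t'(1) adj] t'(6) True len by auto
      then show ?thesis using t'(1,6) True adj star by auto
    next
      case False
      then have "far (Suc n) t t'" using w IH(1) len by (auto simp: far_def)
      then show ?thesis using star t'(1) w(3) False by (meson nat_less_le rtranclp.rtrancl_into_rtrancl)
    qed
  qed
qed

theorem far_connected:
  assumes "normal s" "normal t" "last s = last t" "n \<le> length s" "n \<le> length t"
  shows "(far n)\<^sup>*\<^sup>* s t"
  using assms(4,5)
proof (induction n)
  case 0
  have from_base: "(far 0)\<^sup>*\<^sup>* [last p] p" if "normal p" for p
    using far_develop[of p "[last p]"] develop_normal[OF that] that normal_singleton 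
    by (simp add: normal_def)
  show ?case
    using from_base[OF assms(2)] far_star_facts[OF from_base[OF assms(1)] normal_singleton] assms(3)
    by (metis rtranclp_trans)
next
  case (Suc n)
  then have "(far n)\<^sup>*\<^sup>* s t" by simp
  then show ?case using far_push[OF _ assms(1)] Suc by simp
qed

end

section \<open>Polyhedra and polygonal paths\<close>

text \<open>Polyhedra live in the normed space of bounded sequences, with the vertices at the unit
  vectors. This space contains simplices of every dimension and every countable number of
  vertices, and convexity arguments apply in it.\<close>

definition delta :: "nat \<Rightarrow> nat \<Rightarrow>\<^sub>C real" where
  "delta n = Bcontfun (\<lambda>m. if m = n then 1 else 0)"

definition bsimplex :: "nat set \<Rightarrow> (nat \<Rightarrow>\<^sub>C real) set" where
  "bsimplex c = {z. (\<forall>n. 0 \<le> apply_bcontfun z n) \<and> (\<forall>n. n \<notin> c \<longrightarrow> apply_bcontfun z n = 0) \<and>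
     sum (apply_bcontfun z) c = 1}"

definition polyhedron :: "nat set set \<Rightarrow> (nat \<Rightarrow>\<^sub>C real) set" where
  "polyhedron CC = (\<Union>c\<in>CC. bsimplex c)"

lemma apply_Bcontfun_nat:
  fixes f :: "nat \<Rightarrow> real"
  assumes "bounded (range f)"
  shows "apply_bcontfun (Bcontfun f) = f"
  using assms by (intro Bcontfun_inverse) (simp add: bcontfun_def)

lemma apply_delta: "apply_bcontfun (delta n) m = (if m = n then 1 else 0)"
proof -
  have "bounded (range (\<lambda>m. if m = n then 1 else 0::real))"
    by (rule finite_imp_bounded, rule finite_subset[of _ "{0,1}"]) auto
  then show ?thesis by (simp add: delta_def apply_Bcontfun_nat)
qed

lemma delta_in_simplex: "finite c \<Longrightarrow> delta n \<in> bsimplex c \<longleftrightarrow> n \<in> c"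
  by (auto simp: bsimplex_def apply_delta)

lemma simplexD:
  assumes "z \<in> bsimplex c"
  shows "0 \<le> apply_bcontfun z n" "apply_bcontfun z n \<noteq> 0 \<Longrightarrow> n \<in> c"
    "\<exists>n\<in>c. 0 < apply_bcontfun z n" "sum (apply_bcontfun z) c = 1"
proof -
  show 1: "0 \<le> apply_bcontfun z n" "apply_bcontfun z n \<noteq> 0 \<Longrightarrow> n \<in> c" 
    "sum (apply_bcontfun z) c = 1" for n
    using assms by (auto simp: bsimplex_def)
  show "\<exists>n\<in>c. 0 < apply_bcontfun z n"
  proof (rule ccontr)
    assume "\<not> ?thesis"
    then have "\<forall>n\<in>c. apply_bcontfun z n = 0" using 1(1) by (metis less_le)
    then show False using 1(3) by simp
  qed
qed

lemma convex_simplex: "convex (bsimplex c)"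
proof (rule convexI)
  fix x y :: "nat \<Rightarrow>\<^sub>C real" and u v :: real
  assume *: "x \<in> bsimplex c" "y \<in> bsimplex c" "0 \<le> u" "0 \<le> v" "u + v = 1"
  have "(\<Sum>n\<in>c. u * apply_bcontfun x n + v * apply_bcontfun y n) = u * 1 + v * 1"
    using * by (simp add: sum.distrib bsimplex_def flip: sum_distrib_left)
  then show "u *\<^sub>R x + v *\<^sub>R y \<in> bsimplex c"
    using * by (auto simp: bsimplex_def)
qed

lemma segment_in_simplex:
  "x \<in> bsimplex c \<Longrightarrow> y \<in> bsimplex c \<Longrightarrow> closed_segment x y \<subseteq> bsimplex c"
  using convex_simplex by (simp add: closed_segment_subset)

lemma continuous_apply_bcontfun:
  "continuous_on S f \<Longrightarrow> continuous_on S (\<lambda>x. apply_bcontfun (f x) (n::nat) :: real)"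
proof -
  have "continuous_on UNIV (\<lambda>f :: nat \<Rightarrow>\<^sub>C real. apply_bcontfun f n)"
    unfolding continuous_on_iff
    by (metis dist_fun_lt_imp_dist_val_lt)
  then show "continuous_on S f \<Longrightarrow> continuous_on S (\<lambda>x. apply_bcontfun (f x) n)"
    by (rule continuous_on_compose2) auto
qed

text \<open>Constant segments occur as degenerate polygonal paths and have to keep their form.\<close>

declare linepath_trivial [simp del]

text \<open>The polygonal path through a list of points, again in reverse order.\<close>

fun polyline :: "(nat \<Rightarrow>\<^sub>C real) list \<Rightarrow> real \<Rightarrow> nat \<Rightarrow>\<^sub>C real" where
  "polyline (y # z # r) = polyline (z # r) +++ linepath z y"
| "polyline [z] = linepath z z"
| "polyline [] = linepath (delta 0) (delta 0)"

lemma poly_path: "path (polyline zs)" "zs \<noteq> [] \<Longrightarrow> pathstart (polyline zs) = last zs \<and> pathfinish (polyline zs) = hd zs"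
proof -
  have "path (polyline zs) \<and> (zs \<noteq> [] \<longrightarrow> pathstart (polyline zs) = last zs \<and> pathfinish (polyline zs) = hd zs)"
    by (induction zs rule: polyline.induct) auto
  then show "path (polyline zs)" "zs \<noteq> [] \<Longrightarrow> pathstart (polyline zs) = last zs \<and> pathfinish (polyline zs) = hd zs"
    by auto
qed

locale simplicial =
  fixes CC :: "nat set set"
  assumes finite_CC: "c \<in> CC \<Longrightarrow> finite c"
begin

abbreviation K where "K \<equiv> polyhedron CC"

text \<open>Nearby points lie in a common simplex, so that the segment between them stays in the
  polyhedron.\<close>

definition near :: "(nat \<Rightarrow>\<^sub>C real) \<Rightarrow> (nat \<Rightarrow>\<^sub>C real) \<Rightarrow> bool" where
  "near y z \<longleftrightarrow> (\<exists>c\<in>CC. y \<in> bsimplex c \<and> z \<in> bsimplex c)"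

definition adm :: "(nat \<Rightarrow>\<^sub>C real) list \<Rightarrow> bool" where
  "adm zs \<longleftrightarrow> zs \<noteq> [] \<and> set zs \<subseteq> K \<and> successively near zs"

lemma adm_simps: "\<not> adm []" "adm [z] \<longleftrightarrow> z \<in> K"
   "adm (y # z # r) \<longleftrightarrow> near y z \<and> adm (z # r)"
  by (auto simp: adm_def near_def polyhedron_def)

lemma simplex_K: "c \<in> CC \<Longrightarrow> bsimplex c \<subseteq> K"
  by (auto simp: polyhedron_def)

lemma adm_Cons: "adm (y # r) \<Longrightarrow> r \<noteq> [] \<Longrightarrow> adm r"
  by (cases r) (auto simp: adm_simps near_def)

lemma poly_image: "adm zs \<Longrightarrow> path_image (polyline zs) \<subseteq> K"
proof (induction zs rule: polyline.induct)
  case (1 y z r)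
  then obtain c where c: "c \<in> CC" "y \<in> bsimplex c" "z \<in> bsimplex c" "adm (z # r)"
    by (auto simp: adm_simps near_def)
  then have "path_image (linepath z y) \<subseteq> K"
    using segment_in_simplex simplex_K by fastforce
  moreover have "path_image (polyline (z # r)) \<subseteq> K" using 1 c by blast
  ultimately have "path_image (polyline (z # r) +++ linepath z y) \<subseteq> K"
    by (intro subset_path_image_join)
  then show ?case by simp
qed (auto simp: adm_simps near_def)

text \<open>Homotopy of the polygonal paths through two lists of points. The heads have to agree so that
  the same points can be put in front of both lists.\<close>

definition poly_eq :: "(nat \<Rightarrow>\<^sub>C real) list \<Rightarrow> (nat \<Rightarrow>\<^sub>C real) list \<Rightarrow> bool" where
  "poly_eq zs ws \<longleftrightarrow> adm zs \<and> adm ws \<and> hd zs = hd ws \<and> homotopic_paths K (polyline zs) (polyline ws)"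

lemma poly_eq_refl: "adm zs \<Longrightarrow> poly_eq zs zs"
  by (simp add: poly_eq_def poly_path poly_image)

lemma poly_eq_sym: "poly_eq zs ws \<Longrightarrow> poly_eq ws zs"
  by (auto simp: poly_eq_def homotopic_paths_sym)

lemma poly_eq_trans [trans]: "poly_eq zs ws \<Longrightarrow> poly_eq ws us \<Longrightarrow> poly_eq zs us"
  by (auto simp: poly_eq_def intro: homotopic_paths_trans)

lemma poly_eq_Cons:
  assumes "poly_eq t t'" "adm (a # t)"
  shows "poly_eq (a # t) (a # t')"
proof -
  obtain b r r' where t: "t = b # r" "t' = b # r'"
    using assms(1) by (cases t; cases t') (auto simp: poly_eq_def adm_simps)
  obtain c where c: "c \<in> CC" "a \<in> bsimplex c" "b \<in> bsimplex c"
    using assms(2) t by (auto simp: adm_simps near_def)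
  have "homotopic_paths K (linepath b a) (linepath b a)"
    using segment_in_simplex[OF c(3,2)] simplex_K[OF c(1)] by auto
  then have "homotopic_paths K (polyline t +++ linepath b a) (polyline t' +++ linepath b a)"
    using assms(1) t poly_path(2)[of t] by (intro homotopic_paths_join) (auto simp: poly_eq_def)
  then show ?thesis using assms t by (auto simp: poly_eq_def adm_simps)
qed

lemma poly_eq_append:
  assumes "poly_eq t t'" "adm (xs @ t)"
  shows "poly_eq (xs @ t) (xs @ t')"
  using assms(2)
proof (induction xs)
  case (Cons a xs)
  moreover have "t \<noteq> []" using assms(1) by (auto simp: poly_eq_def adm_simps)
  ultimately show ?case using adm_Cons[of a "xs @ t"] by (auto intro: poly_eq_Cons)
qed (use assms in auto)

lemma poly_drop_middle:
  assumes "c \<in> CC" "x \<in> bsimplex c" "y \<in> bsimplex c" "z \<in> bsimplex c" "adm (z # r)"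
  shows "poly_eq (x # y # z # r) (x # z # r)"
proof -
  have adm: "adm (x # y # z # r)" "adm (x # z # r)" using assms by (auto simp: adm_simps near_def)
  have lin: "path_image (linepath p q) \<subseteq> bsimplex c" "path_image (linepath p q) \<subseteq> K"
    if "p \<in> bsimplex c" "q \<in> bsimplex c" for p q
    using segment_in_simplex[OF that] simplex_K[OF assms(1)] by auto
  have "path_image (linepath z y +++ linepath y x) \<subseteq> bsimplex c"
    using lin assms by (intro subset_path_image_join) auto
  then have "closed_segment ((linepath z y +++ linepath y x) t) (linepath z x t) \<subseteq> K" if "t \<in> {0..1}" for t
    using segment_in_simplex lin(1)[OF assms(4,2)] that simplex_K[OF assms(1)] 
    unfolding path_image_def by (meson dual_order.trans image_subset_iff)
  then have 1: "homotopic_paths K (linepath z y +++ linepath y x) (linepath z x)"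
    by (intro homotopic_paths_linear) auto
  have 2: "homotopic_paths K (polyline (z # r) +++ (linepath z y +++ linepath y x)) (polyline (z # r) +++ linepath z x)"
    using 1 poly_path[of "z # r"] poly_image[OF assms(5)] by (intro homotopic_paths_join) auto
  have 3: "homotopic_paths K (polyline (z # r) +++ (linepath z y +++ linepath y x)) 
      ((polyline (z # r) +++ linepath z y) +++ linepath y x)"
    using poly_path[of "z # r"] poly_image[OF assms(5)] lin(2) assms
    by (intro homotopic_paths_assoc) auto
  have "homotopic_paths K (polyline (x # y # z # r)) (polyline (x # z # r))"
    using homotopic_paths_trans[OF homotopic_paths_sym[OF 3] 2] by (simp only: polyline.simps)
  then show ?thesis using adm by (simp add: poly_eq_def)
qed

lemma poly_drop_duplicate:
  assumes "adm (x # r)"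
  shows "poly_eq (x # x # r) (x # r)"
proof -
  have "homotopic_paths K (polyline (x # x # r)) (polyline (x # r))"
    using poly_path[of "x # r"] poly_image[OF assms] by (auto intro!: homotopic_paths_rid')
  moreover have "x \<in> K" using assms by (simp add: adm_def)
  then have "near x x" by (auto simp: near_def polyhedron_def)
  ultimately show ?thesis using assms by (simp add: poly_eq_def adm_simps(3))
qed

lemma adm_append: "adm (ys @ x # xs) \<longleftrightarrow> adm (ys @ [x]) \<and> adm (x # xs)"
proof (induction ys rule: induct_list012)
  case 1
  have "adm (x # xs) \<Longrightarrow> adm [x]" by (simp add: adm_def)
  then show ?case by auto
next
  case (2 a)
  have "adm (x # xs) \<Longrightarrow> adm [x]" by (simp add: adm_def)
  then show ?case by (auto simp: adm_simps(3))
next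
  case (3 a b ys)
  then show ?case by (simp add: adm_simps(3))
qed

text \<open>Concatenation of lists is concatenation of paths up to reparametrization.\<close>

lemma poly_append:
  assumes "adm (ys @ x # xs)"
  shows "homotopic_paths K (polyline (ys @ x # xs)) (polyline (x # xs) +++ polyline (ys @ [x]))"
  using assms
proof (induction ys)
  case Nil
  then have "homotopic_paths K (polyline (x # xs) +++ linepath x x) (polyline (x # xs))"
    using poly_path[of "x # xs"] poly_image[OF Nil[simplified]] by (auto intro!: homotopic_paths_rid')
  then show ?case by (simp add: homotopic_paths_sym)
next
  case (Cons a ys)
  obtain b t where b: "ys @ [x] = b # t" "ys @ x # xs = b # t @ xs" by (cases ys) auto
  have adm: "adm (ys @ x # xs)" using Cons adm_Cons[of a] by auto
  then have adm2: "adm (ys @ [x])" "adm (x # xs)" using adm_append[of ys x xs] by blast+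
  obtain c where c: "c \<in> CC" "a \<in> bsimplex c" "b \<in> bsimplex c" using Cons(2) b by (auto simp: adm_simps near_def)
  have lin: "path_image (linepath b a) \<subseteq> K" using segment_in_simplex[OF c(3,2)] simplex_K[OF c(1)] by auto
  have 1: "polyline (a # ys @ x # xs) = polyline (ys @ x # xs) +++ linepath b a" by (simp only: b polyline.simps)
  have 2: "polyline (a # ys @ [x]) = polyline (ys @ [x]) +++ linepath b a" by (simp only: b polyline.simps)
  have heads: "hd (ys @ [x]) = b" "hd (ys @ x # xs) = b" by (simp_all only: b list.sel)
  have ends: "pathfinish (polyline (x # xs)) = x" "pathstart (polyline (ys @ [x])) = x"
    "pathfinish (polyline (ys @ [x])) = b" "pathfinish (polyline (ys @ x # xs)) = b"
    using poly_path(2)[of "x # xs"] poly_path(2)[of "ys @ [x]"] poly_path(2)[of "ys @ x # xs"] heads by simp_all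
  have "homotopic_paths K (polyline (ys @ x # xs) +++ linepath b a) 
     ((polyline (x # xs) +++ polyline (ys @ [x])) +++ linepath b a)"
    using Cons.IH[OF adm] lin ends by (intro homotopic_paths_join) auto
  moreover have "homotopic_paths K (polyline (x # xs) +++ (polyline (ys @ [x]) +++ linepath b a)) 
     ((polyline (x # xs) +++ polyline (ys @ [x])) +++ linepath b a)"
    using ends lin poly_path(1) poly_image[OF adm2(1)] poly_image[OF adm2(2)]
    by (intro homotopic_paths_assoc) auto
  ultimately have "homotopic_paths K (polyline (a # ys @ x # xs)) (polyline (x # xs) +++ polyline (a # ys @ [x]))"
    unfolding 1 2 by (rule homotopic_paths_trans[OF _ homotopic_paths_sym])
  then show ?case by (simp only: append_Cons)
qed

text \<open>A path inside of the open star of a vertex \<open>v\<close> can be contracted towards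
  \<open>v\<close>: the contraction maps a square to the polyhedron, and one side of this
  square is homotopic, within the square, to the union of the other three.\<close>

lemma star_path:
  assumes \<sigma>: "path \<sigma>" "path_image \<sigma> \<subseteq> K" and pos: "\<And>t. t \<in> {0..1} \<Longrightarrow> 0 < apply_bcontfun (\<sigma> t) v"
  shows "adm [\<sigma> 1, delta v, \<sigma> 0] \<and> homotopic_paths K \<sigma> (polyline [\<sigma> 1, delta v, \<sigma> 0])"
proof -
  have cone: "\<exists>c\<in>CC. \<sigma> t \<in> bsimplex c \<and> delta v \<in> bsimplex c" if "t \<in> {0..1}" for t
  proof -
    have "\<sigma> t \<in> K" using \<sigma>(2) that by (auto simp: path_image_def)
    then obtain c where c: "c \<in> CC" "\<sigma> t \<in> bsimplex c" 
      by (auto simp: polyhedron_def)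
    then have "v \<in> c" using simplexD(2)[OF c(2)] pos[OF that] by force
    then show ?thesis using c delta_in_simplex finite_CC by blast
  qed
  have adm: "adm [\<sigma> 1, delta v, \<sigma> 0]"
    using cone[of 0] cone[of 1] unfolding adm_simps near_def polyhedron_def by auto
  \<comment> \<open>The cone over \<open>\<sigma>\<close> with apex \<open>v\<close>; the second coordinate is the distance moved towards \<open>v\<close>.\<close>
  define \<Psi> where "\<Psi> = (\<lambda>(t, m). (1 - m) *\<^sub>R \<sigma> t + m *\<^sub>R delta v)"
  let ?Q = "{0..1::real} \<times> {0..1::real}"
  have cont: "continuous_on ?Q \<Psi>"
  proof -
    have "continuous_on ?Q (\<lambda>p. \<sigma> (fst p))"
      by (rule continuous_on_compose2[of "{0..1}" \<sigma>])
        (use \<sigma>(1) in \<open>auto simp: path_def intro: continuous_on_fst continuous_on_id\<close>)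
    then show ?thesis unfolding \<Psi>_def split_beta by (intro continuous_intros)
  qed
  have maps: "\<Psi> \<in> ?Q \<rightarrow> K"
  proof
    fix p assume p: "p \<in> ?Q"
    obtain t m where tm: "p = (t, m)" "t \<in> {0..1}" "m \<in> {0..1}" using p by auto
    obtain c where c: "c \<in> CC" "\<sigma> t \<in> bsimplex c" "delta v \<in> bsimplex c" using cone tm by blast
    have "\<Psi> p \<in> closed_segment (\<sigma> t) (delta v)"
      using tm by (auto simp: \<Psi>_def closed_segment_def)
    then show "\<Psi> p \<in> K" using segment_in_simplex[OF c(2,3)] simplex_K[OF c(1)] by auto
  qed
  let ?g = "linepath (0,0) (1,0) :: real \<Rightarrow> real \<times> real"
  let ?h = "(linepath (0,0) (0,1) +++ linepath (0,1) (1,1)) +++ linepath (1,1) (1,0) :: real \<Rightarrow> real \<times> real"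
  have cv: "convex ?Q" by (simp add: convex_Times)
  have seg: "path_image (linepath p q) \<subseteq> ?Q" if "p \<in> ?Q" "q \<in> ?Q" for p q :: "real \<times> real"
    using closed_segment_subset[OF that cv] by simp
  have "path_image ?h \<subseteq> ?Q" by (intro subset_path_image_join seg) auto
  moreover have "path_image ?g \<subseteq> ?Q" by (intro seg) auto
  ultimately have "closed_segment (?g t) (?h t) \<subseteq> ?Q" if "t \<in> {0..1}" for t
    using that cv unfolding path_image_def by (intro closed_segment_subset) auto
  then have "homotopic_paths ?Q ?g ?h" by (intro homotopic_paths_linear) auto
  then have 1: "homotopic_paths K (\<Psi> \<circ> ?g) (\<Psi> \<circ> ?h)"
    by (rule homotopic_paths_continuous_image[OF _ cont maps])
  have "homotopic_paths K \<sigma> (\<Psi> \<circ> ?g)"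
    by (rule homotopic_paths_eq[OF \<sigma>]) (auto simp: \<Psi>_def linepath_def)
  moreover have eq: "\<Psi> \<circ> ?h = (linepath (\<sigma> 0) (delta v) +++ linepath (delta v) (delta v)) +++ linepath (delta v) (\<sigma> 1)"
    by (auto simp: fun_eq_iff joinpaths_def \<Psi>_def linepath_def algebra_simps scaleR_2)
  moreover have "homotopic_paths K (polyline [\<sigma> 1, delta v, \<sigma> 0]) (\<Psi> \<circ> ?h)"
  proof -
    have a: "adm [delta v, \<sigma> 0]" using adm by (auto simp: adm_simps near_def)
    have b: "path_image (linepath (\<sigma> 0) (delta v)) \<subseteq> K" 
      using cone[of 0] segment_in_simplex simplex_K by fastforce
    have d: "path_image (linepath (delta v) (\<sigma> 1)) \<subseteq> K" 
      using cone[of 1] segment_in_simplex simplex_K by fastforce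
    have "homotopic_paths K (linepath (\<sigma> 0) (\<sigma> 0) +++ linepath (\<sigma> 0) (delta v)) (linepath (\<sigma> 0) (delta v))"
      using b by (auto intro!: homotopic_paths_lid')
    moreover have "homotopic_paths K (linepath (\<sigma> 0) (delta v) +++ linepath (delta v) (delta v)) (linepath (\<sigma> 0) (delta v))"
      using b by (auto intro!: homotopic_paths_rid')
    ultimately have "homotopic_paths K (linepath (\<sigma> 0) (\<sigma> 0) +++ linepath (\<sigma> 0) (delta v)) 
       (linepath (\<sigma> 0) (delta v) +++ linepath (delta v) (delta v))"
      by (rule homotopic_paths_trans[OF _ homotopic_paths_sym])
    then show ?thesis unfolding eq using d by (auto intro!: homotopic_paths_join)
  qed
  ultimately have "homotopic_paths K \<sigma> (polyline [\<sigma> 1, delta v, \<sigma> 0])"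
    using homotopic_paths_trans[OF homotopic_paths_trans[OF _ 1] homotopic_paths_sym] by blast
  then show ?thesis using adm by blast
qed

text \<open>Homotopic to a polygonal path through vertices, where the first and the last of them belong
  to the supports of the end points. The latter condition makes the property pass to
  concatenations.\<close>

definition approximable :: "(real \<Rightarrow> nat \<Rightarrow>\<^sub>C real) \<Rightarrow> bool" where
  "approximable \<sigma> \<longleftrightarrow> (\<exists>vs. vs \<noteq> [] \<and> adm (\<sigma> 1 # map delta vs @ [\<sigma> 0]) \<and> 
     0 < apply_bcontfun (\<sigma> 1) (hd vs) \<and> 0 < apply_bcontfun (\<sigma> 0) (last vs) \<and>
     homotopic_paths K \<sigma> (polyline (\<sigma> 1 # map delta vs @ [\<sigma> 0])))"

lemma approximable_join:
  assumes "approximable \<sigma>" "approximable \<tau>" "\<sigma> 1 = \<tau> 0" 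
    and \<rho>: "homotopic_paths K (\<sigma> +++ \<tau>) \<rho>" 
  shows "approximable \<rho>"
proof -
  define z where "z = \<tau> 0"
  obtain vs where vs: "vs \<noteq> []" "adm (z # map delta vs @ [\<sigma> 0])"
    "0 < apply_bcontfun z (hd vs)" "0 < apply_bcontfun (\<sigma> 0) (last vs)" 
    "homotopic_paths K \<sigma> (polyline (z # map delta vs @ [\<sigma> 0]))"
    using assms(1,3) unfolding approximable_def z_def by auto
  obtain ws where ws: "ws \<noteq> []" "adm (\<tau> 1 # map delta ws @ [z])"
    "0 < apply_bcontfun (\<tau> 1) (hd ws)" "0 < apply_bcontfun z (last ws)" 
    "homotopic_paths K \<tau> (polyline (\<tau> 1 # map delta ws @ [z]))"
    using assms(2) unfolding approximable_def z_def by auto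
  have \<rho>01: "\<rho> 0 = \<sigma> 0" "\<rho> 1 = \<tau> 1"
    using homotopic_paths_imp_pathstart[OF \<rho>] homotopic_paths_imp_pathfinish[OF \<rho>] 
    by (auto simp: pathstart_def pathfinish_def joinpaths_def)
  obtain v vs' where v: "vs = v # vs'" using vs(1) by (cases vs) auto
  obtain w ws' where w: "ws = ws' @ [w]" using ws(1) by (cases ws rule: rev_cases) auto
  define L where "L = (\<tau> 1 # map delta ws) @ z # map delta vs @ [\<sigma> 0]"
  have admL: "adm L" unfolding L_def by (subst adm_append) (use ws(2) vs(2) in simp)
  have "homotopic_paths K (polyline L) (polyline (z # map delta vs @ [\<sigma> 0]) +++ polyline ((\<tau> 1 # map delta ws) @ [z]))"
    unfolding L_def by (rule poly_append) (use admL L_def in simp)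
  moreover have "homotopic_paths K (\<sigma> +++ \<tau>) (polyline (z # map delta vs @ [\<sigma> 0]) +++ polyline ((\<tau> 1 # map delta ws) @ [z]))"
    using vs(5) ws(5) assms(3) by (intro homotopic_paths_join) (auto simp: pathstart_def pathfinish_def)
  ultimately have "homotopic_paths K (\<sigma> +++ \<tau>) (polyline L)"
    by (rule homotopic_paths_trans[OF _ homotopic_paths_sym, rotated])
  then have 1: "homotopic_paths K \<rho> (polyline L)"
    by (rule homotopic_paths_trans[OF homotopic_paths_sym[OF \<rho>]])
  have "z \<in> K" using vs(2) by (auto simp: adm_def)
  then obtain c where c: "c \<in> CC" "z \<in> bsimplex c" by (auto simp: polyhedron_def)
  have "v \<in> c" "w \<in> c" using simplexD(2)[OF c(2)] vs(3) ws(4) v w by force+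
  then have "delta v \<in> bsimplex c" "delta w \<in> bsimplex c" using delta_in_simplex finite_CC c(1) by auto
  moreover have "adm (delta v # map delta vs' @ [\<sigma> 0])" using vs(2) v by (auto simp: adm_simps near_def)
  ultimately have "poly_eq (delta w # z # delta v # map delta vs' @ [\<sigma> 0]) (delta w # delta v # map delta vs' @ [\<sigma> 0])"
    using poly_drop_middle[OF c(1) _ c(2)] by blast
  then have "poly_eq ((\<tau> 1 # map delta ws') @ delta w # z # delta v # map delta vs' @ [\<sigma> 0]) 
     ((\<tau> 1 # map delta ws') @ delta w # delta v # map delta vs' @ [\<sigma> 0])"
    by (rule poly_eq_append) (use admL L_def v w in simp)
  then have 2: "poly_eq L (\<tau> 1 # map delta (ws @ vs) @ [\<sigma> 0])"
    by (simp add: L_def v w)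
  show ?thesis unfolding approximable_def \<rho>01
  proof (intro exI[of _ "ws @ vs"] conjI)
    show "homotopic_paths K \<rho> (polyline (\<tau> 1 # map delta (ws @ vs) @ [\<sigma> 0]))"
      using 1 2 homotopic_paths_trans unfolding poly_eq_def by blast
    show "adm (\<tau> 1 # map delta (ws @ vs) @ [\<sigma> 0])" using 2 unfolding poly_eq_def by blast
  qed (use vs ws in auto)
qed

text \<open>The property holds for short pieces of the path, as these lie in the star of a vertex, and
  it passes to concatenations; the Bolzano principle does the rest.\<close>

theorem path_approximable:
  assumes \<gamma>: "path \<gamma>" "path_image \<gamma> \<subseteq> K"
  shows "approximable \<gamma>"
proof -
  have "(0::real) \<le> 1" by simp
  then have "0 \<le> (0::real) \<and> (1::real) \<le> 1 \<and> (0::real) \<le> 1 \<longrightarrow> approximable (subpath 0 1 \<gamma>)"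
  proof (induction rule: Bolzano[where P = "\<lambda>a b. 0 \<le> a \<and> b \<le> 1 \<and> a \<le> b \<longrightarrow> approximable (subpath a b \<gamma>)"])
    case (trans a b c)
    show ?case
    proof
      assume *: "0 \<le> a \<and> c \<le> 1 \<and> a \<le> c"
      have "homotopic_paths K (subpath a b \<gamma> +++ subpath b c \<gamma>) (subpath a c \<gamma>)"
        using * trans \<gamma> by (intro homotopic_join_subpaths) auto
      moreover have "subpath a b \<gamma> 1 = subpath b c \<gamma> 0" by (simp add: subpath_def)
      ultimately show "approximable (subpath a c \<gamma>)"
        using approximable_join[of "subpath a b \<gamma>" "subpath b c \<gamma>"] * trans by force
    qed
  next
    case (local x)
    then have "\<gamma> x \<in> K" using \<gamma> by (auto simp: path_image_def)
    then obtain v where v: "0 < apply_bcontfun (\<gamma> x) v" 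
      using simplexD(3) by (auto simp: polyhedron_def)
    have "continuous_on {0..1} (\<lambda>t. apply_bcontfun (\<gamma> t) v)"
      using \<gamma>(1) by (simp add: path_def continuous_apply_bcontfun)
    then obtain d where d: "d > 0" "\<And>t. t \<in> {0..1} \<Longrightarrow> dist t x < d \<Longrightarrow> 
         dist (apply_bcontfun (\<gamma> t) v) (apply_bcontfun (\<gamma> x) v) < apply_bcontfun (\<gamma> x) v"
      using local v unfolding continuous_on_iff by (meson atLeastAtMost_iff)
    have pos: "0 < apply_bcontfun (\<gamma> t) v" if "t \<in> {0..1}" "dist t x < d" for t
      using d(2)[OF that] by (auto simp: dist_real_def)
    show ?case
    proof (intro exI[of _ d] conjI allI impI d(1))
      fix a b assume ab: "a \<le> x \<and> x \<le> b \<and> b - a < d" "0 \<le> a \<and> b \<le> 1 \<and> a \<le> b"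
      let ?\<sigma> = "subpath a b \<gamma>"
      have p: "path ?\<sigma>" "path_image ?\<sigma> \<subseteq> K"
        using ab \<gamma> path_image_subpath_subset[of a b \<gamma>] by (auto intro: path_subpath)
      have "0 < apply_bcontfun (?\<sigma> t) v" if "t \<in> {0..1}" for t
      proof -
        have "a \<le> (b - a) * t + a" "(b - a) * t \<le> b - a" using ab that by (auto simp: mult_left_le)
        then show ?thesis using ab pos[of "(b - a) * t + a"] by (auto simp: subpath_def dist_real_def)
      qed
      note pos' = this
      show "approximable ?\<sigma>" unfolding approximable_def
        using star_path[OF p pos'] pos'[of 0] pos'[of 1] by (intro exI[of _ "[v]"]) auto
    qed
  qed
  then show ?thesis by simp
qed

end

section \<open>Coverings defined by local systems\<close>

text \<open>A local system on the polyhedron: \<open>E\<close> is the disjoint union of the fibres over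
  the vertices, \<open>en\<close> gives the vertex below a point of \<open>E\<close>, and
  \<open>mv w k\<close> is the point over \<open>w\<close> to which \<open>k\<close> is
  transported inside of a simplex. The last axiom says that the transport within a simplex has
  no monodromy.\<close>

locale local_system = simplicial +
  fixes E :: "nat set" and en :: "nat \<Rightarrow> nat" and mv :: "nat \<Rightarrow> nat \<Rightarrow> nat"
  assumes en_surj: "c \<in> CC \<Longrightarrow> v \<in> c \<Longrightarrow> \<exists>k\<in>E. en k = v"
    and mv_in: "k \<in> E \<Longrightarrow> c \<in> CC \<Longrightarrow> en k \<in> c \<Longrightarrow> w \<in> c \<Longrightarrow> mv w k \<in> E"
    and en_mv: "k \<in> E \<Longrightarrow> c \<in> CC \<Longrightarrow> en k \<in> c \<Longrightarrow> w \<in> c \<Longrightarrow> en (mv w k) = w"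
    and mv_self: "k \<in> E \<Longrightarrow> mv (en k) k = k"
    and mv_mv: "k \<in> E \<Longrightarrow> c \<in> CC \<Longrightarrow> en k \<in> c \<Longrightarrow> v \<in> c \<Longrightarrow> w \<in> c \<Longrightarrow> mv w (mv v k) = mv w k"
begin

text \<open>The covering space is again a polyhedron, with vertex set \<open>E\<close>. This is the lift
  of the point \<open>z\<close> to the simplex through \<open>k\<close>: the weight of each
  vertex of \<open>z\<close> is put on the transport of \<open>k\<close> to that vertex. The
  formula makes sense for all sequences \<open>z\<close>, and \<open>lift k\<close> is linear
  and does not increase distances.\<close>

definition lift :: "nat \<Rightarrow> (nat \<Rightarrow>\<^sub>C real) \<Rightarrow> nat \<Rightarrow>\<^sub>C real" where
  "lift k z = Bcontfun (\<lambda>j. if j \<in> E \<and> j = mv (en j) k then apply_bcontfun z (en j) else 0)"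

lemma apply_lift: "apply_bcontfun (lift k z) j =
    (if j \<in> E \<and> j = mv (en j) k then apply_bcontfun z (en j) else 0)"
proof -
  have "range (\<lambda>j. if j \<in> E \<and> j = mv (en j) k then apply_bcontfun z (en j) else 0)
     \<subseteq> insert 0 (range (apply_bcontfun z))" by auto
  then have "bounded (range (\<lambda>j. if j \<in> E \<and> j = mv (en j) k then apply_bcontfun z (en j) else 0))"
    by (rule bounded_subset[rotated]) simp
  then show ?thesis by (simp add: lift_def apply_Bcontfun_nat)
qed

lemma lift_lipschitz: "dist (lift k z) (lift k z') \<le> dist z z'"
  by (rule dist_bound) (auto simp: apply_lift dist_bounded)

lemma continuous_lift: "continuous_on S (lift k)"
  unfolding continuous_on_iff by (meson lift_lipschitz le_less_trans)

lemma lift_linepath: "lift k (linepath x y t) = linepath (lift k x) (lift k y) t"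
  by (rule bcontfun_eqI) (auto simp: apply_lift linepath_def)

text \<open>A lift may be described from any vertex of the simplex above it.\<close>

lemma lift_change:
  assumes "k \<in> E" "c \<in> CC" "en k \<in> c" "z \<in> bsimplex c" "w \<in> c"
  shows "lift (mv w k) z = lift k z"
proof (rule bcontfun_eqI)
  fix j
  show "apply_bcontfun (lift (mv w k) z) j = apply_bcontfun (lift k z) j"
  proof (cases "apply_bcontfun z (en j) = 0")
    case False
    then have "en j \<in> c" using simplexD(2)[OF assms(4)] by blast
    then show ?thesis using mv_mv[OF assms(1,2,3,5)] by (simp add: apply_lift)
  qed (simp add: apply_lift)
qed

lemma lift_at:
  assumes "k \<in> E" "c \<in> CC" "en k \<in> c" "w \<in> c"
  shows "apply_bcontfun (lift k z) (mv w k) = apply_bcontfun z w"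
  using assms by (simp add: apply_lift en_mv mv_in)

definition total_space :: "(nat \<Rightarrow>\<^sub>C real) set" where
  "total_space = {lift k z | k z. k \<in> E \<and> (\<exists>c\<in>CC. en k \<in> c \<and> z \<in> bsimplex c)}"

text \<open>The projection adds up the weights in each fibre.\<close>

definition proj :: "(nat \<Rightarrow>\<^sub>C real) \<Rightarrow> nat \<Rightarrow>\<^sub>C real" where
  "proj f = Bcontfun (\<lambda>w. \<Sum>j | j \<in> E \<and> en j = w \<and> apply_bcontfun f j \<noteq> 0. apply_bcontfun f j)"

lemma proj_lift:
  assumes k: "k \<in> E" "c \<in> CC" "en k \<in> c" and z: "z \<in> bsimplex c"
  shows "proj (lift k z) = z"
proof -
  have "(\<Sum>j | j \<in> E \<and> en j = w \<and> apply_bcontfun (lift k z) j \<noteq> 0. apply_bcontfun (lift k z) j) 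
     = apply_bcontfun z w" for w
  proof (cases "apply_bcontfun z w = 0")
    case True
    then have "{j. j \<in> E \<and> en j = w \<and> apply_bcontfun (lift k z) j \<noteq> 0} = {}" by (auto simp: apply_lift)
    then show ?thesis using True by simp
  next
    case False
    then have w: "w \<in> c" using simplexD(2)[OF z] by blast
    have "{j. j \<in> E \<and> en j = w \<and> apply_bcontfun (lift k z) j \<noteq> 0} = {mv w k}"
      using False en_mv[OF k w] mv_in[OF k w] by (auto simp: apply_lift)
    then show ?thesis using lift_at[OF k w] by simp
  qed
  then show ?thesis by (simp add: proj_def apply_bcontfun_inverse)
qed

lemma proj_total: "f \<in> total_space \<Longrightarrow> proj f \<in> K"
  unfolding total_space_def polyhedron_def using proj_lift by auto

text \<open>The open star of the vertex \<open>k\<close> of the covering space.\<close>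

definition sheet :: "nat \<Rightarrow> (nat \<Rightarrow>\<^sub>C real) set" where
  "sheet k = {f \<in> total_space. 0 < apply_bcontfun f k}"

definition star :: "nat \<Rightarrow> (nat \<Rightarrow>\<^sub>C real) set" where
  "star v = {z \<in> K. 0 < apply_bcontfun z v}"

lemma star_simplex: 
  assumes "z \<in> star v"
  obtains c where "c \<in> CC" "v \<in> c" "z \<in> bsimplex c"
proof -
  obtain c where "c \<in> CC" "z \<in> bsimplex c" using assms by (auto simp: star_def polyhedron_def)
  moreover from this have "v \<in> c" using assms simplexD(2)[of z c v] by (auto simp: star_def)
  ultimately show thesis using that by blast
qed

lemma lift_in_sheet:
  assumes "k \<in> E" "z \<in> star (en k)"
  shows "lift k z \<in> sheet k" "proj (lift k z) = z"
proof -
  obtain c where c: "c \<in> CC" "en k \<in> c" "z \<in> bsimplex c" using star_simplex[OF assms(2)] by blast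
  then have "lift k z \<in> total_space" using assms by (auto simp: total_space_def)
  moreover have "apply_bcontfun (lift k z) k = apply_bcontfun z (en k)"
    using mv_self[OF assms(1)] assms(1) by (simp add: apply_lift)
  ultimately show "lift k z \<in> sheet k" using assms by (simp add: sheet_def star_def)
  show "proj (lift k z) = z" using proj_lift[OF assms(1) c] .
qed

lemma sheet_lift:
  assumes "f \<in> sheet k"
  shows "k \<in> E" "f = lift k (proj f)" "proj f \<in> star (en k)"
proof -
  have f: "f \<in> total_space" "0 < apply_bcontfun f k" using assms by (auto simp: sheet_def)
  then obtain j z c where j: "j \<in> E" "c \<in> CC" "en j \<in> c" "z \<in> bsimplex c" "f = lift j z"
    by (auto simp: total_space_def)
  have p: "proj f = z" using proj_lift j by blast
  have k: "k \<in> E" "k = mv (en k) j" "0 < apply_bcontfun z (en k)" 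
    using f(2) unfolding j(5) apply_lift by (auto split: if_splits)
  then have "en k \<in> c" using simplexD(2)[OF j(4)] by force
  then have "lift k z = lift j z" using lift_change[OF j(1-4)] k(2) by metis
  then show "k \<in> E" "f = lift k (proj f)" "proj f \<in> star (en k)"
    using k p j by (auto simp: star_def polyhedron_def)
qed

text \<open>On a sheet, at most one point of each fibre has positive weight, and it is the same one for
  all points of the sheet. Hence coordinates downstairs are coordinates upstairs.\<close>

lemma sheet_dist:
  assumes "f \<in> sheet k" "g \<in> sheet k"
  shows "dist (proj f) (proj g) \<le> dist f g"
proof (rule dist_bound)
  fix w
  define y z where "y = proj f" and "z = proj g"
  have f: "f = lift k y" "y \<in> star (en k)" and g: "g = lift k z" "z \<in> star (en k)" and k: "k \<in> E"
    using sheet_lift[OF assms(1)] sheet_lift[OF assms(2)] by (auto simp: y_def z_def)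
  show "dist (apply_bcontfun (proj f) w) (apply_bcontfun (proj g) w) \<le> dist f g"
  proof (cases "apply_bcontfun y w = 0 \<and> apply_bcontfun z w = 0")
    case True
    then show ?thesis by (simp flip: y_def z_def)
  next
    case False
    then obtain x where x: "x \<in> star (en k)" "apply_bcontfun x w \<noteq> 0" using f g by blast
    obtain c where c: "c \<in> CC" "en k \<in> c" "x \<in> bsimplex c" using star_simplex[OF x(1)] by blast
    then have "w \<in> c" using simplexD(2) x(2) by blast
    note at = lift_at[OF k c(1,2) this]
    have "dist (apply_bcontfun (proj f) w) (apply_bcontfun (proj g) w) = 
        dist (apply_bcontfun f (mv w k)) (apply_bcontfun g (mv w k))"
    proof -
      have "apply_bcontfun f (mv w k) = apply_bcontfun y w" by (subst f(1)) (rule at)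
      moreover have "apply_bcontfun g (mv w k) = apply_bcontfun z w" by (subst g(1)) (rule at)
      ultimately show ?thesis by (simp add: y_def z_def)
    qed
    also have "\<dots> \<le> dist f g" by (rule dist_bounded)
    finally show ?thesis .
  qed
qed

lemma openin_positive: "openin (top_of_set S) {f \<in> S. (0::real) < apply_bcontfun f (n::nat)}"
proof -
  have "open {f :: nat \<Rightarrow>\<^sub>C real. 0 < apply_bcontfun f n}"
    by (intro open_Collect_less continuous_on_const continuous_apply_bcontfun continuous_on_id)
  then have "openin (top_of_set S) (S \<inter> {f. 0 < apply_bcontfun f n})" by (rule openin_open_Int)
  moreover have "S \<inter> {f. 0 < apply_bcontfun f n} = {f \<in> S. 0 < apply_bcontfun f n}" by blast
  ultimately show ?thesis by simp
qed

lemma sheet_homeomorphism: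
  assumes "k \<in> E"
  shows "homeomorphism (sheet k) (star (en k)) proj (lift k)"
proof (rule homeomorphismI)
  show "continuous_on (sheet k) proj"
    unfolding continuous_on_iff using sheet_dist by (meson le_less_trans)
  show "continuous_on (star (en k)) (lift k)" by (rule continuous_lift)
qed (use assms sheet_lift lift_in_sheet in \<open>auto simp: image_subset_iff\<close>)

lemma total_sheet:
  assumes "f \<in> total_space" "0 < apply_bcontfun (proj f) v"
  shows "\<exists>k\<in>E. en k = v \<and> f \<in> sheet k"
proof -
  obtain j z c where j: "j \<in> E" "c \<in> CC" "en j \<in> c" "z \<in> bsimplex c" "f = lift j z"
    using assms by (auto simp: total_space_def)
  have "proj f = z" using proj_lift j by blast
  then have "v \<in> c" using simplexD(2)[OF j(4), of v] assms by auto
  then show ?thesis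
    using lift_at[OF j(1-3), of v z] mv_in[OF j(1-3)] en_mv[OF j(1-3)] assms \<open>proj f = z\<close> j(5)
    by (intro bexI[of _ "mv v j"]) (auto simp: sheet_def)
qed

text \<open>Over the open star of a vertex \<open>v\<close> the sheets are the open stars of the points
  over \<open>v\<close>, and \<open>lift k\<close> is the inverse of the projection on the
  sheet of \<open>k\<close>.\<close>

theorem covering_total: "covering_space total_space proj K"
proof
  show "continuous_on total_space proj"
    unfolding continuous_on_eq_continuous_within
  proof
    fix f assume f: "f \<in> total_space"
    then have "proj f \<in> K" by (rule proj_total)
    then obtain c where "proj f \<in> bsimplex c" by (auto simp: polyhedron_def)
    then obtain v where "0 < apply_bcontfun (proj f) v" using simplexD(3) by blast
    then obtain k where k: "k \<in> E" "f \<in> sheet k" using total_sheet f by blast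
    have "continuous_on (sheet k) proj" using sheet_homeomorphism[OF k(1)] by (auto simp: homeomorphism_def)
    then have "continuous (at f within sheet k) proj" using k(2) by (simp add: continuous_on_eq_continuous_within)
    moreover have "at f within sheet k = at f within total_space"
    proof -
      have "openin (top_of_set total_space) (sheet k)" using openin_positive unfolding sheet_def .
      then obtain T where T: "open T" "sheet k = total_space \<inter> T" by (auto simp: openin_open)
      show ?thesis by (rule at_within_nhd[of f T]) (use k(2) T in auto)
    qed
    ultimately show "continuous (at f within total_space) proj" by (simp add: continuous_within)
  qed
  show "proj ` total_space = K"
  proof
    show "proj ` total_space \<subseteq> K" using proj_total by auto
    show "K \<subseteq> proj ` total_space"
    proof
      fix z assume "z \<in> K"
      then obtain c where c: "c \<in> CC" "z \<in> bsimplex c" by (auto simp: polyhedron_def)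
      obtain v where v: "v \<in> c" using simplexD(3)[OF c(2)] by blast
      then obtain k where "k \<in> E" "en k = v" using en_surj[OF c(1)] by blast
      with v show "z \<in> proj ` total_space" using c proj_lift[of k c z] unfolding total_space_def by force
    qed
  qed
  fix z assume z: "z \<in> K"
  then obtain v where v: "0 < apply_bcontfun z v" using simplexD(3) by (auto simp: polyhedron_def)
  let ?V = "{sheet k | k. k \<in> E \<and> en k = v}"
  show "\<exists>T. z \<in> T \<and> openin (top_of_set K) T \<and> (\<exists>V. \<Union> V = total_space \<inter> proj -` T \<and> 
      (\<forall>u\<in>V. openin (top_of_set total_space) u) \<and> pairwise disjnt V \<and> (\<forall>u\<in>V. \<exists>q. homeomorphism u T proj q))"
  proof (intro exI[of _ "star v"] exI[of _ ?V] conjI)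
    show "z \<in> star v" using z v by (simp add: star_def)
    show "openin (top_of_set K) (star v)" using openin_positive unfolding star_def .
    show "\<Union> ?V = total_space \<inter> proj -` star v"
    proof
      show "\<Union> ?V \<subseteq> total_space \<inter> proj -` star v" using sheet_lift(3) by (auto simp: sheet_def)
      show "total_space \<inter> proj -` star v \<subseteq> \<Union> ?V" using total_sheet by (force simp: star_def)
    qed
    show "\<forall>u\<in>?V. openin (top_of_set total_space) u" using openin_positive unfolding sheet_def by auto
    show "\<forall>u\<in>?V. \<exists>q. homeomorphism u (star v) proj q" using sheet_homeomorphism by blast
    show "pairwise disjnt ?V"
    proof -
      have "k = j" if "k \<in> E" "j \<in> E" "en k = v" "en j = v" "f \<in> sheet k" "f \<in> sheet j" for k j f
      proof -
        have "f = lift k (proj f)" using sheet_lift that by blast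
        moreover have "0 < apply_bcontfun f j" using that by (simp add: sheet_def)
        ultimately have "j = mv (en j) k" by (metis apply_lift less_irrefl)
        then show ?thesis using mv_self that by metis
      qed
      then show ?thesis unfolding pairwise_def disjnt_def by blast
    qed
  qed
qed

fun transport :: "nat list \<Rightarrow> nat \<Rightarrow> nat" where
  "transport (w # v # p) k = mv w (transport (v # p) k)"
| "transport _ k = k"

lemma total_segment:
  assumes "k \<in> E" "c \<in> CC" "en k \<in> c" "x \<in> bsimplex c" "y \<in> bsimplex c"
  shows "path_image (linepath (lift k x) (lift k y)) \<subseteq> total_space"
    and "t \<in> {0..1} \<Longrightarrow> proj (linepath (lift k x) (lift k y) t) = linepath x y t"
proof -
  have *: "linepath x y t \<in> bsimplex c" if "t \<in> {0..1}" for t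
    using segment_in_simplex[OF assms(4,5)] that linepath_in_path path_image_linepath by blast
  show "path_image (linepath (lift k x) (lift k y)) \<subseteq> total_space"
  proof -
    have "lift k (linepath x y t) \<in> total_space" if "t \<in> {0..1}" for t
      using *[OF that] assms(1-3) unfolding total_space_def by blast
    then show ?thesis by (auto simp: path_image_def simp flip: lift_linepath simp del: path_image_linepath)
  qed
  show "t \<in> {0..1} \<Longrightarrow> proj (linepath (lift k x) (lift k y) t) = linepath x y t"
    using proj_lift[OF assms(1-3) *] by (simp flip: lift_linepath)
qed

definition is_lift :: "(real \<Rightarrow> nat \<Rightarrow>\<^sub>C real) \<Rightarrow> (real \<Rightarrow> nat \<Rightarrow>\<^sub>C real) \<Rightarrow> bool" where
  "is_lift h g \<longleftrightarrow> path h \<and> path_image h \<subseteq> total_space \<and> (\<forall>t\<in>{0..1}. proj (h t) = g t)"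

lemma is_lift_join: "is_lift h g \<Longrightarrow> is_lift h' g' \<Longrightarrow> pathfinish h = pathstart h' \<Longrightarrow> is_lift (h +++ h') (g +++ g')"
  unfolding is_lift_def by (auto simp: subset_path_image_join) (auto simp: joinpaths_def)

lemma is_lift_segment:
  assumes "k \<in> E" "c \<in> CC" "en k \<in> c" "x \<in> bsimplex c" "y \<in> bsimplex c"
  shows "is_lift (linepath (lift k x) (lift k y)) (linepath x y)"
  using total_segment[OF assms] by (simp add: is_lift_def)

definition chain :: "nat list \<Rightarrow> bool" where
  "chain p \<longleftrightarrow> p \<noteq> [] \<and> set p \<subseteq> \<Union>CC \<and> successively (\<lambda>v w. \<exists>c\<in>CC. v \<in> c \<and> w \<in> c) p"

lemma lift_delta:
  assumes "k \<in> E"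
  shows "lift k (delta (en k)) = delta k"
  using assms mv_self by (intro bcontfun_eqI) (auto simp: apply_lift apply_delta)

lemma polyline_lift:
  assumes z: "z \<in> bsimplex c" "c \<in> CC" "en k \<in> c" and k: "k \<in> E" and p: "chain p" "last p = en k"
  shows "transport p k \<in> E \<and> en (transport p k) = hd p \<and> (\<exists>h. is_lift h (polyline (map delta p @ [z])) \<and>
     pathstart h = lift k z \<and> pathfinish h = delta (transport p k))"
  using p
proof (induction p rule: induct_list012)
  case 1
  then show ?case by (simp add: chain_def)
next
  case (2 v)
  then have v: "v = en k" "delta v \<in> bsimplex c" using z finite_CC by (auto simp: delta_in_simplex)
  have "is_lift (linepath (lift k z) (lift k z) +++ linepath (lift k z) (lift k (delta v))) 
      (linepath z z +++ linepath z (delta v))"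
    using z k v by (intro is_lift_join is_lift_segment[of _ c]) auto
  then show ?case using k v lift_delta[OF k]
    by (intro conjI exI[of _ "linepath (lift k z) (lift k z) +++ linepath (lift k z) (lift k (delta v))"]) auto
next
  case (3 w v p)
  then have "chain (v # p)" "last (v # p) = en k" by (auto simp: chain_def)
  then obtain h where IH: "transport (v # p) k \<in> E" "en (transport (v # p) k) = v" 
    "is_lift h (polyline (map delta (v # p) @ [z]))" "pathstart h = lift k z" 
    "pathfinish h = delta (transport (v # p) k)" using 3 by auto
  define j where "j = transport (v # p) k"
  obtain d where d: "d \<in> CC" "v \<in> d" "w \<in> d" using 3(3) by (auto simp: chain_def)
  have dd: "delta v \<in> bsimplex d" "delta w \<in> bsimplex d" using d finite_CC by (auto simp: delta_in_simplex)
  have j: "j \<in> E" "en j \<in> d" "en j = v" using IH d j_def by auto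
  have jw: "mv w j \<in> E" "en (mv w j) = w" using mv_in[OF j(1) d(1) j(2) d(3)] en_mv[OF j(1) d(1) j(2) d(3)] by auto
  have "is_lift (h +++ linepath (lift j (delta v)) (lift j (delta w))) 
     (polyline (map delta (v # p) @ [z]) +++ linepath (delta v) (delta w))"
    using IH j d dd lift_delta[OF j(1)] by (intro is_lift_join is_lift_segment[of _ d]) (auto simp flip: j_def)
  moreover have "lift j (delta w) = delta (mv w j)"
    using lift_change[OF j(1) d(1) j(2) dd(2) d(3)] lift_delta[OF jw(1)] jw(2) by simp
  ultimately show ?case using IH jw
    by (intro conjI exI[of _ "h +++ linepath (lift j (delta v)) (lift j (delta w))"]) (auto simp: j_def)
qed

text \<open>Both loops lift to the covering space, and by monodromy the lifts end at the same point.
  This point has its weight over \<open>v0\<close> at the transport of \<open>k\<close>.\<close>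

theorem homotopic_imp_transport_eq:
  assumes z: "z \<in> bsimplex c" "c \<in> CC" and v0: "v0 = en k" "0 < apply_bcontfun z v0" and k: "k \<in> E"
    and p: "chain p" "last p = v0" "hd p = v0" and q: "chain q" "last q = v0" "hd q = v0"
    and hom: "homotopic_paths K (polyline (z # map delta p @ [z])) (polyline (z # map delta q @ [z]))"
  shows "transport p k = transport q k"
proof -
  have v0c: "v0 \<in> c" using simplexD(2)[OF z(1)] v0 by force
  have dv0: "delta v0 \<in> bsimplex c" using v0c z finite_CC by (auto simp: delta_in_simplex)
  have lift: "\<exists>h. is_lift h (polyline (z # map delta p @ [z])) \<and> pathstart h = lift k z \<and> 
       pathfinish h = lift (transport p k) z \<and> transport p k \<in> E \<and> en (transport p k) = v0" 
    if p: "chain p" "last p = v0" "hd p = v0" for p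
  proof -
    obtain h where h: "transport p k \<in> E" "en (transport p k) = v0" 
      "is_lift h (polyline (map delta p @ [z]))" "pathstart h = lift k z" 
      "pathfinish h = delta (transport p k)" 
      using polyline_lift[OF z _ k p(1)] p v0 v0c by auto
    define j where "j = transport p k"
    have "is_lift (h +++ linepath (lift j (delta v0)) (lift j z)) 
       (polyline (map delta p @ [z]) +++ linepath (delta v0) z)"
      using h z v0c dv0 lift_delta[OF h(1)] by (intro is_lift_join is_lift_segment[of _ c]) (auto simp: j_def)
    moreover have "polyline (map delta p @ [z]) +++ linepath (delta v0) z = polyline (z # map delta p @ [z])"
      using p by (cases p) (auto simp: chain_def)
    ultimately show ?thesis using h 
      by (intro exI[of _ "h +++ linepath (lift j (delta v0)) (lift j z)"]) (auto simp: j_def)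
  qed
  obtain h where h: "is_lift h (polyline (z # map delta p @ [z]))" "pathstart h = lift k z"
       "pathfinish h = lift (transport p k) z" "transport p k \<in> E" "en (transport p k) = v0" using lift[OF p] by blast
  obtain h' where h': "is_lift h' (polyline (z # map delta q @ [z]))" "pathstart h' = lift k z"
       "pathfinish h' = lift (transport q k) z" "transport q k \<in> E" "en (transport q k) = v0" using lift[OF q] by blast
  have "pathfinish h = pathfinish h'"
    using h h' hom homotopic_paths_imp_path[OF hom] homotopic_paths_imp_subset[OF hom] unfolding is_lift_def
    by (intro covering_space_monodromy[OF covering_total, where ?g1.0 = "polyline (z # map delta p @ [z])" 
        and ?g2.0 = "polyline (z # map delta q @ [z])"]) auto
  then have "lift (transport p k) z = lift (transport q k) z" using h h' by simp
  moreover have "apply_bcontfun (lift (transport p k) z) (transport p k) = apply_bcontfun z v0"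
    using h mv_self[OF h(4)] by (simp add: apply_lift)
  ultimately have "transport p k = mv v0 (transport q k)" using v0(2) h(5)
    by (metis apply_lift less_irrefl)
  then show ?thesis using mv_self[OF h'(4)] h'(5) by simp
qed

end

section \<open>Cubings\<close>

text \<open>The corners of an \<open>n\<close>-cube are the subsets of \<open>{..<n}\<close>, and
  \<open>A \<oplus> {i}\<close> is the neighbour of the corner \<open>A\<close> in direction
  \<open>i\<close>.\<close>

definition toggle :: "nat set \<Rightarrow> nat set \<Rightarrow> nat set" (infixl "\<oplus>" 65) where
  "A \<oplus> B = (A - B) \<union> (B - A)"

lemma toggle_simps [simp]: "A \<oplus> {} = A" "{} \<oplus> A = A" "A \<oplus> A = {}" "A \<oplus> (A \<oplus> B) = B"
  by (auto simp: toggle_def)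

lemma toggle_assoc: "A \<oplus> B \<oplus> C = A \<oplus> (B \<oplus> C)"
  by (auto simp: toggle_def)

lemma toggle_cancel [simp]: "A \<oplus> B = A \<oplus> C \<longleftrightarrow> B = C"
  by (metis toggle_simps(4))

lemma toggle_self [simp]: "A \<oplus> B = A \<longleftrightarrow> B = {}" "A = A \<oplus> B \<longleftrightarrow> B = {}"
  by (auto simp: toggle_def)

lemma toggle_subset: "A \<subseteq> U \<Longrightarrow> B \<subseteq> U \<Longrightarrow> A \<oplus> B \<subseteq> U"
  by (auto simp: toggle_def)

lemma toggle_pair: "i \<noteq> j \<Longrightarrow> {i} \<oplus> {j} = {i, j}"
  by (auto simp: toggle_def)

text \<open>What remains of a cube complex when only the vertices are kept: \<open>vm l A\<close> is the
  vertex at the corner \<open>A\<close> of the cube \<open>l\<close>. Cubes meet in common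
  faces, so distances between common vertices agree in both cubes, and the corners of one cube
  between two common vertices are common vertices, too.\<close>

locale cubing =
  fixes I :: "'i set" and dm :: "'i \<Rightarrow> nat" and vm :: "'i \<Rightarrow> nat set \<Rightarrow> nat"
  assumes vm_inj: "l \<in> I \<Longrightarrow> inj_on (vm l) (Pow {..<dm l})"
    and vm_dist: "l \<in> I \<Longrightarrow> m \<in> I \<Longrightarrow> A \<subseteq> {..<dm l} \<Longrightarrow> B \<subseteq> {..<dm l} \<Longrightarrow>
        A' \<subseteq> {..<dm m} \<Longrightarrow> B' \<subseteq> {..<dm m} \<Longrightarrow> vm l A = vm m A' \<Longrightarrow> vm l B = vm m B' \<Longrightarrow>
        card (A \<oplus> B) = card (A' \<oplus> B')"
    and vm_between: "l \<in> I \<Longrightarrow> m \<in> I \<Longrightarrow> A \<subseteq> {..<dm l} \<Longrightarrow> B \<subseteq> {..<dm l} \<Longrightarrow>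
        A' \<subseteq> {..<dm m} \<Longrightarrow> B' \<subseteq> {..<dm m} \<Longrightarrow> vm l A = vm m A' \<Longrightarrow> vm l B = vm m B' \<Longrightarrow>
        A \<inter> B \<subseteq> C \<Longrightarrow> C \<subseteq> A \<union> B \<Longrightarrow> \<exists>C'\<subseteq>{..<dm m}. vm l C = vm m C'"
begin

definition adj :: "nat \<Rightarrow> nat \<Rightarrow> bool" where
  "adj u v \<longleftrightarrow> (\<exists>l\<in>I. \<exists>A\<subseteq>{..<dm l}. \<exists>i<dm l. u = vm l A \<and> v = vm l (A \<oplus> {i}))"

definition sq :: "nat \<Rightarrow> nat \<Rightarrow> nat \<Rightarrow> nat \<Rightarrow> bool" where
  "sq u a v b \<longleftrightarrow> (\<exists>l\<in>I. \<exists>A\<subseteq>{..<dm l}. \<exists>i<dm l. \<exists>j<dm l. i \<noteq> j \<and> u = vm l A \<and>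
     a = vm l (A \<oplus> {i}) \<and> v = vm l (A \<oplus> {i, j}) \<and> b = vm l (A \<oplus> {j}))"

definition cell :: "'i \<Rightarrow> nat set" where
  "cell l = vm l ` Pow {..<dm l}"

definition cells :: "nat set set" where
  "cells = cell ` I"

lemma vm_eq_iff: 
  "l \<in> I \<Longrightarrow> A \<subseteq> {..<dm l} \<Longrightarrow> B \<subseteq> {..<dm l} \<Longrightarrow> vm l A = vm l B \<longleftrightarrow> A = B"
  using vm_inj[of l] by (auto simp: inj_on_def)

lemma sqI:
  assumes "l \<in> I" "A \<subseteq> {..<dm l}" "i < dm l" "j < dm l" "i \<noteq> j"
    and "B = A \<oplus> {i}" "C = A \<oplus> {i, j}" "D = A \<oplus> {j}"
  shows "sq (vm l A) (vm l B) (vm l C) (vm l D)"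
  unfolding sq_def using assms by blast

lemma single_subset: "i < (n::nat) \<Longrightarrow> {i} \<subseteq> {..<n}"
  by auto

lemma adj_sym: "adj u v \<Longrightarrow> adj v u"
  unfolding adj_def
proof (elim bexE exE conjE)
  fix l A i assume *: "l \<in> I" "A \<subseteq> {..<dm l}" "i < dm l" "u = vm l A" "v = vm l (A \<oplus> {i})"
  then show "\<exists>l\<in>I. \<exists>A\<subseteq>{..<dm l}. \<exists>i<dm l. v = vm l A \<and> u = vm l (A \<oplus> {i})"
    using toggle_subset[OF *(2) single_subset[OF *(3)]]
    by (intro bexI[of _ l] exI[of _ "A \<oplus> {i}"] exI[of _ i] conjI) (auto simp: toggle_assoc)
qed

lemma sq_rotate: "sq u a v b \<Longrightarrow> sq a v b u"
proof -
  assume "sq u a v b"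
  then obtain l A i j where *: "l \<in> I" "A \<subseteq> {..<dm l}" "i < dm l" "j < dm l" "i \<noteq> j" "u = vm l A" 
     "a = vm l (A \<oplus> {i})" "v = vm l (A \<oplus> {i, j})" "b = vm l (A \<oplus> {j})"
    unfolding sq_def by blast
  show ?thesis unfolding *(6-9)
    using * toggle_subset[OF *(2) single_subset[OF *(3)]] toggle_pair[of i j] toggle_pair[of j i]
    by (intro sqI[where i = j and j = i]) (auto simp: toggle_def)
qed

lemma sq_flip: "sq u a v b \<Longrightarrow> sq u b v a"
proof -
  assume "sq u a v b"
  then obtain l A i j where *: "l \<in> I" "A \<subseteq> {..<dm l}" "i < dm l" "j < dm l" "i \<noteq> j" "u = vm l A" 
     "a = vm l (A \<oplus> {i})" "v = vm l (A \<oplus> {i, j})" "b = vm l (A \<oplus> {j})"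
    unfolding sq_def by blast
  show ?thesis unfolding *(6-9)
    using * by (intro sqI[where i = j and j = i]) (auto simp: insert_commute)
qed

lemma sq_adj: "sq u a v b \<Longrightarrow> adj u a"
  unfolding sq_def adj_def by metis

lemma sq_diag: "sq u a v b \<Longrightarrow> u \<noteq> v"
proof -
  assume "sq u a v b"
  then obtain l A i j where *: "l \<in> I" "A \<subseteq> {..<dm l}" "i < dm l" "j < dm l" "u = vm l A" "v = vm l (A \<oplus> {i, j})"
    unfolding sq_def by blast
  then have "A \<oplus> {i, j} \<subseteq> {..<dm l}" by (intro toggle_subset) auto
  then have "vm l A = vm l (A \<oplus> {i, j}) \<longleftrightarrow> A = A \<oplus> {i, j}" using * by (intro vm_eq_iff)
  then show ?thesis unfolding *(5,6) by simp
qed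

lemma card_toggle_1: "card (A \<oplus> B) = 1 \<Longrightarrow> \<exists>x. B = A \<oplus> {x}"
  by (metis card_1_singletonE toggle_simps(4))

text \<open>The fourth vertex is a corner of the second cube, being between two common vertices, and it
  is pinned down by its distances.\<close>

lemma sq_unique:
  assumes "sq u a v b" "sq u a v b'"
  shows "b = b'"
proof -
  obtain l A i j where l: "l \<in> I" "A \<subseteq> {..<dm l}" "i < dm l" "j < dm l" "i \<noteq> j" "u = vm l A" 
     "a = vm l (A \<oplus> {i})" "v = vm l (A \<oplus> {i, j})" "b = vm l (A \<oplus> {j})"
    using assms(1) unfolding sq_def by blast
  obtain m A' i' j' where m: "m \<in> I" "A' \<subseteq> {..<dm m}" "i' < dm m" "j' < dm m" "i' \<noteq> j'" "u = vm m A'" 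
     "a = vm m (A' \<oplus> {i'})" "v = vm m (A' \<oplus> {i', j'})" "b' = vm m (A' \<oplus> {j'})"
    using assms(2) unfolding sq_def by blast
  have sub: "A \<oplus> {i, j} \<subseteq> {..<dm l}" "A \<oplus> {j} \<subseteq> {..<dm l}" "A \<oplus> {i} \<subseteq> {..<dm l}" 
    "A' \<oplus> {i', j'} \<subseteq> {..<dm m}" "A' \<oplus> {i'} \<subseteq> {..<dm m}"
    using l m by (auto simp: toggle_def)
  have "A \<inter> (A \<oplus> {i, j}) \<subseteq> A \<oplus> {j}" "A \<oplus> {j} \<subseteq> A \<union> (A \<oplus> {i, j})" by (auto simp: toggle_def)
  then obtain C where C: "C \<subseteq> {..<dm m}" "b = vm m C"
    using vm_between[OF l(1) m(1) l(2) sub(1) m(2) sub(4)] l m by metis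
  have "card (A \<oplus> (A \<oplus> {j})) = card (A' \<oplus> C)"
    using vm_dist[OF l(1) m(1) l(2) sub(2) m(2) C(1)] l m C by metis
  then obtain x where x: "C = A' \<oplus> {x}" using card_toggle_1[of A' C] by auto
  have "card ((A \<oplus> {i, j}) \<oplus> (A \<oplus> {j})) = card ((A' \<oplus> {i', j'}) \<oplus> C)"
    using vm_dist[OF l(1) m(1) sub(1) sub(2) sub(4) C(1)] l m C by metis
  moreover have "(A \<oplus> {i, j}) \<oplus> (A \<oplus> {j}) = {i}" using l(5) by (auto simp: toggle_def)
  moreover have "(A' \<oplus> {i', j'}) \<oplus> C = {i', j'} \<oplus> {x}" unfolding x by (auto simp: toggle_def)
  ultimately have "card ({i', j'} \<oplus> {x}) = 1" by simp
  moreover have "x \<notin> {i', j'} \<Longrightarrow> {i', j'} \<oplus> {x} = {i', j', x}" by (auto simp: toggle_def)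
  ultimately have "x = i' \<or> x = j'" using m(5) by (cases "x \<in> {i', j'}") auto
  moreover have "x \<noteq> i'"
  proof
    assume "x = i'"
    then have "vm l (A \<oplus> {i}) = vm l (A \<oplus> {j})" using l m C x by simp
    then show False using vm_eq_iff[OF l(1) sub(3,2)] l(5) by simp
  qed
  ultimately show ?thesis using C x m by simp
qed

end

text \<open>The flag condition says that neighbours of \<open>v\<close> which pairwise span squares with
  \<open>v\<close> are neighbours of \<open>v\<close> within one cube.\<close>

locale flag_cubing = cubing +
  assumes flag: "finite D \<Longrightarrow> D \<noteq> {} \<Longrightarrow> D \<subseteq> {w. adj v w} \<Longrightarrow>
      (\<And>c d. c \<in> D \<Longrightarrow> d \<in> D \<Longrightarrow> c \<noteq> d \<Longrightarrow> \<exists>q. sq v c q d) \<Longrightarrow>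
      \<exists>l\<in>I. \<exists>A\<subseteq>{..<dm l}. vm l A = v \<and> (\<forall>b\<in>D. \<exists>i<dm l. b = vm l (A \<oplus> {i}))"
    and finite_vertices: "finite (\<Union>cells)"
    and links: "\<And>v D a b. D \<subseteq> {w. adj v w} \<Longrightarrow>
        (\<And>c d. c \<in> D \<Longrightarrow> d \<in> D \<Longrightarrow> c \<noteq> d \<Longrightarrow> \<exists>q. sq v c q d) \<Longrightarrow>
        adj v a \<Longrightarrow> adj v b \<Longrightarrow> a \<notin> D \<Longrightarrow> b \<notin> D \<Longrightarrow>
        (\<lambda>c d. c \<notin> D \<and> d \<notin> D \<and> (\<exists>q. sq v c q d))\<^sup>*\<^sup>* a b"
begin

lemma sq_cube:
  assumes "sq u a v g" "sq u' g v b" "sq t u g u'"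
  shows "\<exists>s. sq s a v b \<and> sq t u a s \<and> sq t u' b s"
proof -
  have s1: "sq g u a v" "sq g v a u" "sq u g v a" using assms(1) sq_rotate sq_flip by metis+
  have s2: "sq g v b u'" "sq g u' b v" "sq u' g v b" using assms(2) sq_rotate sq_flip by metis+
  have s3: "sq g u' t u" "sq g u t u'" "sq u g u' t" using assms(3) sq_rotate sq_flip by metis+
  let ?D = "{v, u, u'}"
  have pairs: "\<exists>q. sq g c q d" if "c \<in> ?D" "d \<in> ?D" "c \<noteq> d" for c d using that s1 s2 s3 by blast
  have nbrs: "?D \<subseteq> {w. adj g w}" using s1 s2 s3 sq_adj by blast
  have "\<exists>l\<in>I. \<exists>A\<subseteq>{..<dm l}. vm l A = g \<and> (\<forall>b\<in>?D. \<exists>i<dm l. b = vm l (A \<oplus> {i}))"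
    by (rule flag[OF _ _ nbrs pairs]) auto
  then obtain l A i j k where l: "l \<in> I" "A \<subseteq> {..<dm l}" "vm l A = g" and
    ijk: "i < dm l" "v = vm l (A \<oplus> {i})" "j < dm l" "u = vm l (A \<oplus> {j})" "k < dm l" "u' = vm l (A \<oplus> {k})"
    by auto
  have "u \<noteq> v" "u' \<noteq> v" "u \<noteq> u'" using s1(3) s2(3) s3(3) sq_diag by blast+
  then have ne: "i \<noteq> j" "i \<noteq> k" "j \<noteq> k" using ijk by auto
  have sub: "B \<subseteq> {i, j, k} \<Longrightarrow> A \<oplus> B \<subseteq> {..<dm l}" for B
    using l ijk by (auto simp: toggle_def)
  have "sq u g v (vm l (A \<oplus> {i, j}))" 
    unfolding ijk l(3)[symmetric] 
    using l ijk ne sub by (intro sqI[where i = j and j = i]) (auto simp: toggle_def)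
  then have a: "a = vm l (A \<oplus> {i, j})" using s1(3) sq_unique by blast
  have "sq u' g v (vm l (A \<oplus> {i, k}))" 
    unfolding ijk l(3)[symmetric] 
    using l ijk ne sub by (intro sqI[where i = k and j = i]) (auto simp: toggle_def)
  then have b: "b = vm l (A \<oplus> {i, k})" using s2(3) sq_unique by blast
  have "sq u g u' (vm l (A \<oplus> {j, k}))" 
    unfolding ijk l(3)[symmetric] 
    using l ijk ne sub by (intro sqI[where i = j and j = k]) (auto simp: toggle_def)
  then have t: "t = vm l (A \<oplus> {j, k})" using s3(3) sq_unique by blast
  have "sq (vm l (A \<oplus> {i, j, k})) a v b" unfolding a b ijk
    using l ijk ne sub by (intro sqI[where i = k and j = j]) (auto simp: toggle_def)
  moreover have "sq t u a (vm l (A \<oplus> {i, j, k}))" unfolding t a ijk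
    using l ijk ne sub by (intro sqI[where i = k and j = i]) (auto simp: toggle_def)
  moreover have "sq t u' b (vm l (A \<oplus> {i, j, k}))" unfolding t b ijk
    using l ijk ne sub by (intro sqI[where i = j and j = i]) (auto simp: toggle_def)
  ultimately show ?thesis by blast
qed

lemma adj_vertices: "adj u v \<Longrightarrow> \<exists>c\<in>cells. u \<in> c \<and> v \<in> c"
proof -
  assume "adj u v"
  then obtain l A i where l: "l \<in> I" "A \<subseteq> {..<dm l}" "i < dm l" "u = vm l A" "v = vm l (A \<oplus> {i})"
    by (auto simp: adj_def)
  then have "A \<oplus> {i} \<subseteq> {..<dm l}" by (auto simp: toggle_def)
  then show ?thesis unfolding l(4,5) cells_def cell_def using l(1,2) by blast
qed

sublocale ascending_links adj sq
proof
  show "finite {w. adj v w}" for v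
    by (rule finite_subset[OF _ finite_vertices]) (use adj_vertices in blast)
  show "(\<lambda>c d. c \<notin> D \<and> d \<notin> D \<and> (\<exists>q. sq v c q d))\<^sup>*\<^sup>* a b"
    if "D \<subseteq> {w. adj v w}" "\<And>c d. c \<in> D \<Longrightarrow> d \<in> D \<Longrightarrow> c \<noteq> d \<Longrightarrow> \<exists>q. sq v c q d"
      "adj v a" "adj v b" "a \<notin> D" "b \<notin> D" for v D a b
    using links[OF that] .
qed (fact adj_sym sq_rotate sq_flip sq_adj sq_diag sq_unique sq_cube)+

definition position :: "'a \<Rightarrow> nat \<Rightarrow> nat set" where
  "position l v = (THE A. A \<subseteq> {..<dm l} \<and> vm l A = v)"

lemma position_vm: "l \<in> I \<Longrightarrow> A \<subseteq> {..<dm l} \<Longrightarrow> position l (vm l A) = A"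
  unfolding position_def by (rule the_equality) (auto simp: vm_eq_iff)

lemma position_cell: "l \<in> I \<Longrightarrow> v \<in> cell l \<Longrightarrow> position l v \<subseteq> {..<dm l} \<and> vm l (position l v) = v"
  using position_vm by (auto simp: cell_def)

text \<open>Crossing the cube \<open>l\<close> in direction \<open>i\<close>, for vertices of the
  universal cover above this cube. Extended by the identity, these maps form a family of
  commuting involutions, hence an action of the subsets of directions; this shows without
  further path chasing that the universal cover is trivial over each cube.\<close>

definition cross :: "'a \<Rightarrow> nat \<Rightarrow> nat list \<Rightarrow> nat list" where
  "cross l i s = (if normal s \<and> hd s \<in> cell l \<and> i < dm l then act (vm l (position l (hd s) \<oplus> {i})) s else s)"

lemma cross_eq:
  assumes "l \<in> I" "normal s" "A \<subseteq> {..<dm l}" "hd s = vm l A" "i < dm l"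
  shows "cross l i s = act (vm l (A \<oplus> {i})) s"
  using assms by (auto simp: cross_def cell_def position_vm)

lemma cross_facts:
  assumes "l \<in> I" "normal s" "A \<subseteq> {..<dm l}" "hd s = vm l A" "i < dm l"
  shows "normal (cross l i s) \<and> hd (cross l i s) = vm l (A \<oplus> {i}) \<and> last (cross l i s) = last s \<and> 
      cross l i (cross l i s) = s"
proof -
  have "adj (hd s) (vm l (A \<oplus> {i}))" using assms adj_def by blast
  note f = act_facts[OF assms(2) this]
  have e: "cross l i s = act (vm l (A \<oplus> {i})) s" using cross_eq[OF assms] .
  have "A \<oplus> {i} \<subseteq> {..<dm l}" using assms by (intro toggle_subset) auto
  then have "cross l i (cross l i s) = s"
    using cross_eq[OF assms(1) f(1) _ f(2) assms(5)] f(6) assms(4) e by (simp add: toggle_assoc)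
  then show ?thesis using e f by simp
qed

lemma cross_invol: "l \<in> I \<Longrightarrow> cross l i (cross l i s) = s"
proof (cases "normal s \<and> hd s \<in> cell l \<and> i < dm l")
  case True
  assume l: "l \<in> I"
  obtain A where "A \<subseteq> {..<dm l}" "hd s = vm l A" using True by (auto simp: cell_def)
  then show ?thesis using cross_facts[OF l] True by blast
next
  case False
  then have "cross l i s = s" by (auto simp: cross_def)
  then show ?thesis by simp
qed

lemma cross_commute:
  assumes "l \<in> I"
  shows "cross l i (cross l j s) = cross l j (cross l i s)"
proof (cases "normal s \<and> hd s \<in> cell l \<and> i < dm l \<and> j < dm l \<and> i \<noteq> j")
  case True
  then obtain A where A: "A \<subseteq> {..<dm l}" "hd s = vm l A" by (auto simp: cell_def)
  then have sub: "A \<oplus> {i} \<subseteq> {..<dm l}" "A \<oplus> {j} \<subseteq> {..<dm l}" using True by (auto simp: toggle_def)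
  have s: "sq (vm l A) (vm l (A \<oplus> {i})) (vm l (A \<oplus> {i, j})) (vm l (A \<oplus> {j}))"
    using True A assms by (intro sqI[where i = i and j = j]) auto
  have ij: "A \<oplus> {i} \<oplus> {j} = A \<oplus> {i, j}" "A \<oplus> {j} \<oplus> {i} = A \<oplus> {i, j}"
    using True by (auto simp: toggle_def)
  have f: "normal (cross l i s)" "hd (cross l i s) = vm l (A \<oplus> {i})" "normal (cross l j s)" "hd (cross l j s) = vm l (A \<oplus> {j})"
    using cross_facts[of l s A i] cross_facts[of l s A j] True A assms by auto
  have "cross l i (cross l j s) = act (vm l (A \<oplus> {i, j})) (act (vm l (A \<oplus> {j})) s)"
    using cross_eq[OF assms f(3) sub(2) f(4), of i] cross_eq[of l s A j] True A ij assms by simp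
  moreover have "cross l j (cross l i s) = act (vm l (A \<oplus> {i, j})) (act (vm l (A \<oplus> {i})) s)"
    using cross_eq[OF assms f(1) sub(1) f(2), of j] cross_eq[of l s A i] True A ij assms by simp
  ultimately show ?thesis using act_square[OF _ s] True A by simp
next
  case False
  then consider "i = j" | "\<And>k. cross l k s = s" | "\<And>x. cross l i x = x" | "\<And>x. cross l j x = x"
    by (auto simp: cross_def)
  then show ?thesis by cases simp_all
qed

definition move :: "'a \<Rightarrow> nat set \<Rightarrow> nat list \<Rightarrow> nat list" where
  "move l D s = Finite_Set.fold (cross l) s D"

lemma move_empty [simp]: "move l {} s = s"
  by (simp add: move_def)

lemma move_toggle:
  assumes "l \<in> I" "finite D"
  shows "move l (D \<oplus> {i}) s = cross l i (move l D s)"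
proof -
  interpret comp_fun_commute "cross l"
    by unfold_locales (auto simp: fun_eq_iff cross_commute[OF assms(1)])
  show ?thesis
  proof (cases "i \<in> D")
    case True
    then have "D = insert i (D - {i})" "D \<oplus> {i} = D - {i}" by (auto simp: toggle_def)
    moreover have "move l (insert i (D - {i})) s = cross l i (move l (D - {i}) s)"
      unfolding move_def using assms(2) by (intro fold_insert) auto
    ultimately show ?thesis using cross_invol[OF assms(1)] by metis
  next
    case False
    then have "D \<oplus> {i} = insert i D" by (auto simp: toggle_def)
    then show ?thesis unfolding move_def using False assms(2) by simp
  qed
qed

lemma insert_toggle: "i \<notin> D \<Longrightarrow> insert i D = D \<oplus> {i}"
  by (auto simp: toggle_def)

lemma move_move:
  assumes "l \<in> I" "finite D" "finite D'"
  shows "move l D (move l D' s) = move l (D' \<oplus> D) s"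
  using assms(2)
proof (induction)
  case (insert i D)
  have "finite (D' \<oplus> D)" using insert assms by (simp add: toggle_def)
  then show ?case
    unfolding insert_toggle[OF insert(2)] using insert assms by (simp add: move_toggle flip: toggle_assoc)
qed simp

lemma move_facts:
  assumes "l \<in> I" "normal s" "A \<subseteq> {..<dm l}" "hd s = vm l A" "D \<subseteq> {..<dm l}"
  shows "normal (move l D s) \<and> hd (move l D s) = vm l (A \<oplus> D) \<and> last (move l D s) = last s"
proof -
  have "finite D" using assms(5) finite_subset by blast
  then show ?thesis using assms(5)
  proof (induction)
    case (insert i D)
    then have "A \<oplus> D \<subseteq> {..<dm l}" using assms(3) by (intro toggle_subset) auto
    then show ?case unfolding insert_toggle[OF insert(2)] move_toggle[OF assms(1) insert(1)]
      using insert cross_facts[OF assms(1), of "move l D s" "A \<oplus> D" i] by (simp add: toggle_assoc)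
  qed (use assms in simp)
qed

text \<open>Directions are added one at a time; every intermediate corner lies between the two given
  ones, so it is a corner of the second cube, and each step is a step along an edge there as
  well.\<close>

lemma move_independent:
  assumes l: "l \<in> I" "A \<subseteq> {..<dm l}" "B \<subseteq> {..<dm l}" and m: "m \<in> I" "A' \<subseteq> {..<dm m}" "B' \<subseteq> {..<dm m}"
    and eq: "vm l A = vm m A'" "vm l B = vm m B'" and s: "normal s" "hd s = vm l A"
  shows "move l (A \<oplus> B) s = move m (A' \<oplus> B') s"
proof -
  have AB: "A \<oplus> B \<subseteq> {..<dm l}" using l by (intro toggle_subset) auto
  then have "finite (A \<oplus> B)" using finite_subset by blast
  then have "D \<subseteq> A \<oplus> B \<Longrightarrow> \<exists>D'\<subseteq>{..<dm m}. vm l (A \<oplus> D) = vm m (A' \<oplus> D') \<and> move l D s = move m D' s" for D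
  proof (induction D rule: infinite_finite_induct)
    case (infinite D)
    then show ?case using finite_subset by blast
  next
    case empty
    then show ?case using eq by (intro exI[of _ "{}"]) auto
  next
    case (insert i D)
    then obtain D' where D': "D' \<subseteq> {..<dm m}" "vm l (A \<oplus> D) = vm m (A' \<oplus> D')" "move l D s = move m D' s"
      by auto
    have sub: "A \<oplus> D \<subseteq> {..<dm l}" "A \<oplus> insert i D \<subseteq> {..<dm l}" "A' \<oplus> D' \<subseteq> {..<dm m}"
      using insert(4) AB l D' m by (intro toggle_subset; auto)+
    have "A \<inter> B \<subseteq> A \<oplus> insert i D" "A \<oplus> insert i D \<subseteq> A \<union> B" using insert(4) by (auto simp: toggle_def)
    then obtain C where C: "C \<subseteq> {..<dm m}" "vm l (A \<oplus> insert i D) = vm m C"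
      using vm_between[OF l(1) m(1) l(2,3) m(2,3) eq] by blast
    have "card (A \<oplus> D \<oplus> (A \<oplus> insert i D)) = card (A' \<oplus> D' \<oplus> C)"
      by (rule vm_dist[OF l(1) m(1) sub(1,2,3) C(1) D'(2) C(2)])
    moreover have "A \<oplus> D \<oplus> (A \<oplus> insert i D) = {i}" using insert(2) by (auto simp: toggle_def)
    ultimately obtain x where x: "C = A' \<oplus> D' \<oplus> {x}" using card_toggle_1 by force
    have "{x} = A' \<oplus> D' \<oplus> C" unfolding x by (simp only: toggle_simps(4))
    then have xm: "x < dm m" using toggle_subset[OF sub(3) C(1)] by blast
    have fin: "finite D" "finite D'" using insert D' finite_subset by blast+
    have DI: "D \<subseteq> {..<dm l}" "i < dm l" using insert(4) AB by auto
    note f = move_facts[OF l(1) s(1) l(2) s(2) DI(1)]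
    have "move l (insert i D) s = cross l i (move l D s)"
      unfolding insert_toggle[OF insert(2)] by (rule move_toggle[OF l(1) fin(1)])
    also have "\<dots> = act (vm l (A \<oplus> D \<oplus> {i})) (move l D s)"
      using cross_eq[OF l(1) _ sub(1) _ DI(2)] f by blast
    also have "\<dots> = act (vm m (A' \<oplus> D' \<oplus> {x})) (move m D' s)"
      using C(2) x D'(3) unfolding insert_toggle[OF insert(2)] by (simp add: toggle_assoc)
    also have "\<dots> = cross m x (move m D' s)"
      using cross_eq[OF m(1) _ sub(3) _ xm, of "move m D' s"] f D' by simp
    also have "\<dots> = move m (D' \<oplus> {x}) s" using move_toggle[OF m(1) fin(2)] by simp
    finally have "move l (insert i D) s = move m (D' \<oplus> {x}) s" .
    moreover have "D' \<oplus> {x} \<subseteq> {..<dm m}" using D'(1) xm by (auto simp: toggle_def)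
    moreover have "vm l (A \<oplus> insert i D) = vm m (A' \<oplus> (D' \<oplus> {x}))"
      using C(2) x by (simp add: toggle_assoc)
    ultimately show ?case by blast
  qed
  from this[of "A \<oplus> B"] obtain D' where D': "D' \<subseteq> {..<dm m}" "vm l B = vm m (A' \<oplus> D')" 
    "move l (A \<oplus> B) s = move m D' s" by auto
  then have "vm m B' = vm m (A' \<oplus> D')" using eq by simp
  then have "B' = A' \<oplus> D'" using vm_eq_iff[OF m(1,3) toggle_subset[OF m(2) D'(1)]] by blast
  then show ?thesis using D' by simp
qed

text \<open>Transport in the universal cover to a vertex \<open>w\<close> that shares a cube with the
  current one.\<close>

definition go :: "nat \<Rightarrow> nat list \<Rightarrow> nat list" where
  "go w s = (let l = (SOME l. l \<in> I \<and> hd s \<in> cell l \<and> w \<in> cell l) 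
     in move l (position l (hd s) \<oplus> position l w) s)"

lemma go_eq:
  assumes "l \<in> I" "normal s" "A \<subseteq> {..<dm l}" "hd s = vm l A" "B \<subseteq> {..<dm l}"
  shows "go (vm l B) s = move l (A \<oplus> B) s"
proof -
  define m where "m = (SOME m. m \<in> I \<and> hd s \<in> cell m \<and> vm l B \<in> cell m)"
  have "l \<in> I \<and> hd s \<in> cell l \<and> vm l B \<in> cell l" using assms by (auto simp: cell_def)
  then have m: "m \<in> I" "hd s \<in> cell m" "vm l B \<in> cell m" unfolding m_def
    using someI[of "\<lambda>m. m \<in> I \<and> hd s \<in> cell m \<and> vm l B \<in> cell m" l] by blast+
  have "go (vm l B) s = move m (position m (hd s) \<oplus> position m (vm l B)) s"
    by (simp add: go_def m_def Let_def)
  also have "\<dots> = move l (A \<oplus> B) s"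
    using position_cell[OF m(1,2)] position_cell[OF m(1,3)] assms
    by (intro move_independent) (auto simp: m)
  finally show ?thesis .
qed

lemma go_adj:
  assumes "normal s" "adj (hd s) w"
  shows "go w s = act w s"
proof -
  obtain l A i where l: "l \<in> I" "A \<subseteq> {..<dm l}" "i < dm l" "hd s = vm l A" "w = vm l (A \<oplus> {i})"
    using assms(2) by (auto simp: adj_def)
  have "A \<oplus> {i} \<subseteq> {..<dm l}" using l by (intro toggle_subset) auto
  then have "go w s = move l {i} s" using go_eq[OF l(1) assms(1) l(2,4)] l(5) by simp
  also have "\<dots> = cross l i s" using move_toggle[OF l(1), of "{}" i s] by simp
  also have "\<dots> = act w s" using cross_eq[OF l(1) assms(1) l(2,4,3)] l(5) by simp
  finally show ?thesis .
qed

lemma go_facts: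
  assumes "normal s" "c \<in> cells" "hd s \<in> c" "w \<in> c"
  shows "normal (go w s) \<and> hd (go w s) = w \<and> last (go w s) = last s \<and> go (hd s) s = s \<and>
    (\<forall>u\<in>c. go u (go w s) = go u s)"
proof -
  obtain l where l: "l \<in> I" "c = cell l" using assms by (auto simp: cells_def)
  then obtain A B where A: "A \<subseteq> {..<dm l}" "hd s = vm l A" and B: "B \<subseteq> {..<dm l}" "w = vm l B"
    using assms by (auto simp: cell_def)
  have AB: "A \<oplus> B \<subseteq> {..<dm l}" using A B by (intro toggle_subset) auto
  have e: "go w s = move l (A \<oplus> B) s" using go_eq[OF l(1) assms(1) A B(1)] B by simp
  have f: "normal (go w s)" "hd (go w s) = w" "last (go w s) = last s"
    using move_facts[OF l(1) assms(1) A AB] e B by auto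
  have "go (hd s) s = s" using go_eq[OF l(1) assms(1) A A(1)] A by simp
  moreover have "go u (go w s) = go u s" if "u \<in> c" for u
  proof -
    obtain C where C: "C \<subseteq> {..<dm l}" "u = vm l C" using \<open>u \<in> c\<close> l by (auto simp: cell_def)
    have BC: "finite (B \<oplus> C)" "finite (A \<oplus> B)" using toggle_subset[OF B(1) C(1)] AB finite_subset by blast+
    have "go u (go w s) = move l (B \<oplus> C) (move l (A \<oplus> B) s)"
      using go_eq[OF l(1) f(1) B(1) _ C(1)] f(2) B C e by simp
    also have "\<dots> = move l (A \<oplus> C) s" using move_move[OF l(1) BC] 
      by (simp add: toggle_assoc)
    finally show ?thesis using go_eq[OF l(1) assms(1) A C(1)] C by simp
  qed
  ultimately show ?thesis using f by blast
qed

text \<open>The directions in which the two corners differ are changed one at a time.\<close>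

lemma cell_walk:
  assumes "c \<in> cells" "u \<in> c" "w \<in> c"
  shows "\<exists>p. walk p \<and> hd p = u \<and> last p = w \<and> set p \<subseteq> c"
proof -
  obtain l A B where l: "l \<in> I" "c = cell l" "A \<subseteq> {..<dm l}" "u = vm l A" "B \<subseteq> {..<dm l}" "w = vm l B"
    using assms by (auto simp: cells_def cell_def)
  have "D \<subseteq> {..<dm l} \<Longrightarrow> \<exists>p. walk p \<and> hd p = vm l (B \<oplus> D) \<and> last p = w \<and> set p \<subseteq> c" if "finite D" for D
    using that
  proof (induction D)
    case empty
    then show ?case using l by (intro exI[of _ "[w]"]) (auto simp: cell_def)
  next
    case (insert i D)
    then obtain p where p: "walk p" "hd p = vm l (B \<oplus> D)" "last p = w" "set p \<subseteq> c" by auto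
    have BD: "B \<oplus> D \<subseteq> {..<dm l}" "B \<oplus> insert i D \<subseteq> {..<dm l}" using insert l by (auto simp: toggle_def)
    have e: "B \<oplus> insert i D = B \<oplus> D \<oplus> {i}" using insert_toggle[OF insert(2)] by (simp add: toggle_assoc)
    have "adj (vm l (B \<oplus> D)) (vm l (B \<oplus> insert i D))"
      unfolding adj_def using l BD insert e by (intro bexI[of _ l] exI[of _ "B \<oplus> D"] exI[of _ i]) auto
    then have "walk (vm l (B \<oplus> insert i D) # p)" using p adj_sym by (cases p) auto
    moreover have "vm l (B \<oplus> insert i D) \<in> c" using l BD by (auto simp: cell_def)
    ultimately show ?case using p by (intro exI[of _ "vm l (B \<oplus> insert i D) # p"]) (cases p; auto)
  qed
  from this[of "B \<oplus> A"] show ?thesis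
    using l toggle_subset[OF l(5,3)] finite_subset[OF toggle_subset[OF l(5,3)]] by simp
qed

end

section \<open>Homotopy of loops and normal forms of walks\<close>

context simplicial
begin

lemma poly_eq_insert:
  assumes "c \<in> CC" "x \<in> bsimplex c" "y \<in> bsimplex c" "z \<in> bsimplex c" "adm (pre @ x # z # post)"
  shows "poly_eq (pre @ x # z # post) (pre @ x # y # z # post)"
proof -
  have "adm (x # z # post)" using assms(5) adm_append[of pre x "z # post"] by blast
  then have "adm (z # post)" by (rule adm_Cons) simp
  then have "poly_eq (x # z # post) (x # y # z # post)"
    using poly_drop_middle[OF assms(1-4)] poly_eq_sym by blast
  then show ?thesis by (rule poly_eq_append) (rule assms(5))
qed

lemma poly_eq_drop:
  assumes "c \<in> CC" "x \<in> bsimplex c" "y \<in> bsimplex c" "z \<in> bsimplex c" "adm (pre @ x # y # z # post)"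
  shows "poly_eq (pre @ x # y # z # post) (pre @ x # z # post)"
proof -
  have "adm (x # y # z # post)" using assms(5) adm_append[of pre x "y # z # post"] by blast
  then have "adm (z # post)" using adm_Cons[of x "y # z # post"] adm_Cons[of y "z # post"] by simp
  then have "poly_eq (x # y # z # post) (x # z # post)"
    by (rule poly_drop_middle[OF assms(1-4)])
  then show ?thesis by (rule poly_eq_append) (rule assms(5))
qed

lemma poly_eq_double:
  assumes "adm (pre @ x # post)"
  shows "poly_eq (pre @ x # post) (pre @ x # x # post)"
proof -
  have "adm (x # post)" using assms adm_append[of pre x post] by blast
  then have "poly_eq (x # post) (x # x # post)" using poly_drop_duplicate poly_eq_sym by blast
  then show ?thesis by (rule poly_eq_append) (rule assms)
qed

lemma poly_eq_adm: "poly_eq zs ws \<Longrightarrow> adm ws"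
  by (simp add: poly_eq_def)

lemma poly_eq_fill:
  assumes "c \<in> CC" "m \<noteq> []" "set m \<subseteq> bsimplex c" "adm (pre @ hd m # last m # post)"
  shows "poly_eq (pre @ hd m # last m # post) (pre @ m @ post)"
  using assms(2-4)
proof (induction m arbitrary: pre rule: induct_list012)
  case (2 x)
  have "adm (pre @ x # post)"
  proof -
    have "adm (x # x # post)" using 2(3) adm_append[of pre x "x # post"] by simp
    moreover have "adm (pre @ [x])" using 2(3) adm_append[of pre x "x # post"] by simp
    ultimately show ?thesis using adm_append[of pre x post] adm_Cons[of x "x # post"] by blast
  qed
  then show ?case using poly_eq_double poly_eq_sym by simp
next
  case (3 x y m)
  define l where "l = last (y # m)"
  have l: "l \<in> bsimplex c" using 3(4) l_def by auto
  have 1: "poly_eq (pre @ x # l # post) (pre @ x # y # l # post)"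
    using 3 l by (intro poly_eq_insert[OF assms(1)]) (auto simp: l_def)
  have "poly_eq ((pre @ [x]) @ hd (y # m) # last (y # m) # post) ((pre @ [x]) @ (y # m) @ post)"
    using 3(4) poly_eq_adm[OF 1] by (intro 3(2)) (auto simp: l_def)
  then have "poly_eq (pre @ x # y # l # post) (pre @ (x # y # m) @ post)" by (simp add: l_def)
  then show ?case using poly_eq_trans[OF 1] by (simp add: l_def)
qed simp

end

locale based_cubing = flag_cubing +
  fixes v0 :: nat
  assumes base: "v0 \<in> \<Union>cells"
    and connected: "c \<in> cells \<Longrightarrow> v \<in> c \<Longrightarrow> \<exists>p. walk p \<and> last p = v0 \<and> hd p = v"
begin

definition states :: "nat list set" where
  "states = {s. normal s \<and> last s = v0}"

text \<open>Vertices of the universal cover are lists of numbers and are encoded as numbers, so that the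
  covering space is a polyhedron in the same sequence space as the base.\<close>

definition end_code :: "nat \<Rightarrow> nat" where
  "end_code k = hd (from_nat k :: nat list)"

definition go_code :: "nat \<Rightarrow> nat \<Rightarrow> nat" where
  "go_code w k = to_nat (go w (from_nat k))"

sublocale local_system cells "to_nat ` states" end_code go_code
proof
  show "finite c" if "c \<in> cells" for c
    using that by (auto simp: cells_def cell_def)
  show "\<exists>k\<in>to_nat ` states. end_code k = v" if cv: "c \<in> cells" "v \<in> c" for c v
  proof -
    obtain p where p: "walk p" "last p = v0" "hd p = v" using connected[OF cv] by blast
    then show ?thesis using develop_facts[OF p(1) normal_singleton[of v0]]
      by (intro bexI[of _ "to_nat (develop p [v0])"]) (auto simp: end_code_def states_def)
  qed
  fix k assume k: "k \<in> to_nat ` states"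
  then obtain s where s: "k = to_nat s" "normal s" "last s = v0" by (auto simp: states_def)
  have e: "end_code k = hd s" "go_code w k = to_nat (go w s)" for w
    by (auto simp: s end_code_def go_code_def)
  {
    fix c w assume c: "c \<in> cells" "end_code k \<in> c" "w \<in> c"
    note g = go_facts[OF s(2) c(1)]
    show "go_code w k \<in> to_nat ` states"
      unfolding e(2) states_def using g[of w] c e(1) s(3) by auto
    show "end_code (go_code w k) = w"
      unfolding e(2) using g[of w] c e(1) by (auto simp: end_code_def)
    fix u assume u: "u \<in> c"
    show "go_code u (go_code w k) = go_code u k"
      using g[of w] c u by (simp add: e) (simp add: go_code_def)
  }
  show "go_code (end_code k) k = k"
  proof -
    have "walk s" using s by (simp add: normal_def)
    moreover have "\<exists>c\<in>cells. hd s \<in> c"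
    proof (cases s)
      case (Cons v p)
      then show ?thesis using \<open>walk s\<close> s base adj_vertices[of v] by (cases p) auto
    qed (use s in \<open>auto simp: normal_def\<close>)
    ultimately show ?thesis using go_facts[OF s(2), of _ "hd s"] e s(1) by auto
  qed
qed

lemma walk_vertices: "walk p \<Longrightarrow> hd p \<in> \<Union>cells \<Longrightarrow> set p \<subseteq> \<Union>cells"
proof (induction p rule: induct_list012)
  case (3 v u p)
  then show ?case using adj_vertices[of v u] by auto
qed auto

lemma walk_chain:
  assumes "walk p" "hd p \<in> \<Union>cells"
  shows "chain p"
  unfolding chain_def
proof (intro conjI)
  show "p \<noteq> []" "set p \<subseteq> \<Union>cells" using assms walk_vertices by auto
  show "successively (\<lambda>v w. \<exists>c\<in>cells. v \<in> c \<and> w \<in> c) p"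
    using assms(1) adj_vertices unfolding walk_def by (auto elim: successively_mono)
qed

lemma transport_develop:
  assumes "walk p" "last p = hd s" "normal s"
  shows "transport p (to_nat s) = to_nat (develop p s)"
  using assms(1,2)
proof (induction p rule: induct_list012)
  case (3 w v p)
  then have IH: "transport (v # p) (to_nat s) = to_nat (develop (v # p) s)" by simp
  have f: "normal (develop (v # p) s)" "hd (develop (v # p) s) = v"
    using develop_facts[of "v # p" s] 3 assms(3) by auto
  then have "go w (develop (v # p) s) = act w (develop (v # p) s)"
    using 3(3) adj_sym by (intro go_adj) auto
  then show ?case 
    by (simp only: transport.simps develop.simps IH) (simp add: go_code_def)
qed auto

text \<open>Normal forms are invariant under homotopy, because the universal cover built from normal
  forms is a local system on the polyhedron.\<close>

theorem homotopic_imp_develop_eq: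
  assumes z: "z \<in> bsimplex c" "c \<in> cells" "0 < apply_bcontfun z v0"
    and p: "walk p" "hd p = v0" "last p = v0" and q: "walk q" "hd q = v0" "last q = v0"
    and hom: "homotopic_paths K (polyline (z # map delta p @ [z])) (polyline (z # map delta q @ [z]))"
  shows "develop p [v0] = develop q [v0]"
proof -
  have k: "to_nat [v0] \<in> to_nat ` states" "end_code (to_nat [v0]) = v0"
    by (auto simp: states_def normal_singleton end_code_def)
  have "transport p (to_nat [v0]) = transport q (to_nat [v0])"
    using homotopic_imp_transport_eq[OF z(1,2) k(2)[symmetric] z(3) k(1)] p q hom walk_chain base by auto
  then show ?thesis using transport_develop[of _ "[v0]"] normal_singleton p q by simp
qed

lemma cell_simplex: "c \<in> cells \<Longrightarrow> v \<in> c \<Longrightarrow> delta v \<in> bsimplex c"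
  using finite_CC delta_in_simplex by blast

lemma sq_cell: "sq u a v b \<Longrightarrow> \<exists>c\<in>cells. {u, a, v, b} \<subseteq> c"
proof -
  assume "sq u a v b"
  then obtain l A i j where *: "l \<in> I" "A \<subseteq> {..<dm l}" "i < dm l" "j < dm l" "u = vm l A" 
     "a = vm l (A \<oplus> {i})" "v = vm l (A \<oplus> {i, j})" "b = vm l (A \<oplus> {j})"
    unfolding sq_def by blast
  then have "A \<oplus> {i} \<subseteq> {..<dm l}" "A \<oplus> {i, j} \<subseteq> {..<dm l}" "A \<oplus> {j} \<subseteq> {..<dm l}"
    by (auto simp: toggle_def)
  then have "{u, a, v, b} \<subseteq> cell l" unfolding cell_def *(5-8) using *(2) by blast
  then show ?thesis using *(1) by (auto simp: cells_def)
qed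

text \<open>Combinatorial homotopies are homotopies. All vertices of a square, or of an edge, belong to
  one simplex of the polyhedron, where intermediate vertices may be dropped or inserted.\<close>

lemma homot_poly_eq:
  assumes "homot p q" "adm (pre @ map delta p @ post)"
  shows "poly_eq (pre @ map delta p @ post) (pre @ map delta q @ post)"
  using assms
proof (induction)
  case (stay p)
  then show ?case by (rule poly_eq_refl)
next
  case (compose p q r)
  then show ?case using poly_eq_adm poly_eq_trans by meson
next
  case (square x v a u y b)
  obtain c where c: "c \<in> cells" "{u, a, v, b} \<subseteq> c" using sq_cell square by blast
  then have d: "delta v \<in> bsimplex c" "delta a \<in> bsimplex c" "delta u \<in> bsimplex c" "delta b \<in> bsimplex c"
    using cell_simplex by auto
  have 1: "poly_eq ((pre @ map delta x) @ delta v # delta a # delta u # (map delta y @ post))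
     ((pre @ map delta x) @ delta v # delta u # (map delta y @ post))"
    by (rule poly_eq_drop[OF c(1) d(1-3)]) (use square in simp)
  have "poly_eq ((pre @ map delta x) @ delta v # delta u # (map delta y @ post))
     ((pre @ map delta x) @ delta v # delta b # delta u # (map delta y @ post))"
    by (rule poly_eq_insert[OF c(1) d(1,4,3) poly_eq_adm[OF 1]])
  from poly_eq_trans[OF 1 this] show ?case by simp
next
  case (remove x v u y)
  have "adj v u" using remove by (auto simp: walk_def successively_append_iff)
  then obtain c where c: "c \<in> cells" "v \<in> c" "u \<in> c" using adj_vertices by blast
  have 1: "poly_eq ((pre @ map delta x) @ delta v # delta u # delta v # (map delta y @ post))
     ((pre @ map delta x) @ delta v # delta v # (map delta y @ post))"
    by (rule poly_eq_drop[OF c(1)]) (use c cell_simplex remove in auto)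
  have "adm ((pre @ map delta x) @ delta v # (map delta y @ post))"
    using remove(2) adm_append[of "pre @ map delta x" "delta v" "delta u # delta v # map delta y @ post"] 
       adm_append[of "pre @ map delta x" "delta v" "map delta y @ post"]
       adm_Cons[of "delta v" "delta u # delta v # map delta y @ post"] 
       adm_Cons[of "delta u" "delta v # map delta y @ post"] by auto
  from poly_eq_trans[OF 1 poly_eq_sym[OF poly_eq_double[OF this]]] show ?case by simp
next
  case (insert x v u y)
  have "adj v u" using insert by (auto simp: walk_def successively_append_iff)
  then obtain c where c: "c \<in> cells" "v \<in> c" "u \<in> c" using adj_vertices by blast
  have 1: "poly_eq ((pre @ map delta x) @ delta v # (map delta y @ post))
     ((pre @ map delta x) @ delta v # delta v # (map delta y @ post))"
    by (rule poly_eq_double) (use insert in simp)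
  have "poly_eq ((pre @ map delta x) @ delta v # delta v # (map delta y @ post))
    ((pre @ map delta x) @ delta v # delta u # delta v # (map delta y @ post))"
    by (rule poly_eq_insert[OF c(1) _ _ _ poly_eq_adm[OF 1]]) (use c cell_simplex in auto)
  from poly_eq_trans[OF 1 this] show ?case by simp
qed

text \<open>Consecutive vertices of a common cube are joined by edges of this cube.\<close>

lemma chain_walk:
  assumes "vs \<noteq> []" "successively (\<lambda>v w. \<exists>c\<in>cells. v \<in> c \<and> w \<in> c) vs" "adm (pre @ map delta vs @ post)"
  shows "\<exists>p. walk p \<and> hd p = hd vs \<and> last p = last vs \<and> 
     poly_eq (pre @ map delta vs @ post) (pre @ map delta p @ post)"
  using assms
proof (induction vs arbitrary: pre rule: induct_list012)
  case (2 v)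
  then show ?case by (intro exI[of _ "[v]"]) (auto intro: poly_eq_refl)
next
  case (3 w v r)
  then obtain c where c: "c \<in> cells" "v \<in> c" "w \<in> c" by auto
  have "\<exists>p. walk p \<and> hd p = v \<and> last p = last (v # r) \<and> 
     poly_eq ((pre @ [delta w]) @ map delta (v # r) @ post) ((pre @ [delta w]) @ map delta p @ post)"
    using 3(2)[of "pre @ [delta w]"] 3 by auto
  then obtain p where p: "walk p" "hd p = v" "last p = last (v # r)" 
     "poly_eq ((pre @ [delta w]) @ map delta (v # r) @ post) ((pre @ [delta w]) @ map delta p @ post)" by blast
  obtain t where t: "p = v # t" using p by (cases p) auto
  obtain m where m: "walk m" "hd m = w" "last m = v" "set m \<subseteq> c" using cell_walk[OF c(1,3,2)] by blast
  have mne: "m \<noteq> []" using m(1) by auto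
  have "poly_eq (pre @ hd (map delta m) # last (map delta m) # (map delta t @ post)) (pre @ map delta m @ (map delta t @ post))"
    using m mne c poly_eq_adm[OF p(4)] t cell_simplex
    by (intro poly_eq_fill[OF c(1)]) (auto simp: hd_map last_map)
  then have "poly_eq (pre @ map delta (w # v # r) @ post) (pre @ map delta (m @ t) @ post)"
    using p(4) t m mne by (auto simp: hd_map last_map intro: poly_eq_trans)
  moreover have "walk (m @ t)"
    using m(1,3) mne p(1) t by (cases t) (auto simp: walk_def successively_append_iff)
  moreover have "last (m @ t) = last (w # v # r)" using p(3) t m by (cases t) auto
  ultimately show ?case using m mne by (intro exI[of _ "m @ t"]) auto
qed simp

text \<open>A loop is homotopic to a polygonal path through vertices. The vertex \<open>v0\<close> is
  inserted next to both ends, and consecutive vertices are joined by edges of a common cube.\<close>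

theorem loop_homotopic_walk:
  assumes \<gamma>: "path \<gamma>" "path_image \<gamma> \<subseteq> K" "\<gamma> 0 = z" "\<gamma> 1 = z" and z: "0 < apply_bcontfun z v0"
  shows "\<exists>p. walk p \<and> hd p = v0 \<and> last p = v0 \<and> adm (z # map delta p @ [z]) \<and> 
    homotopic_paths K \<gamma> (polyline (z # map delta p @ [z]))"
proof -
  obtain vs where vs: "vs \<noteq> []" "adm (z # map delta vs @ [z])" "0 < apply_bcontfun z (hd vs)"
    "0 < apply_bcontfun z (last vs)" "homotopic_paths K \<gamma> (polyline (z # map delta vs @ [z]))"
    using path_approximable[OF \<gamma>(1,2)] \<gamma>(3,4) by (auto simp: approximable_def)
  have "z \<in> K" using vs(2) by (auto simp: adm_def)
  then obtain c where c: "c \<in> cells" "z \<in> bsimplex c" by (auto simp: polyhedron_def)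
  have in_c: "v0 \<in> c" "hd vs \<in> c" "last vs \<in> c" using simplexD(2)[OF c(2)] z vs by force+
  then have d: "delta v0 \<in> bsimplex c" "delta (hd vs) \<in> bsimplex c" "delta (last vs) \<in> bsimplex c" 
    using cell_simplex c by auto
  obtain v r where v: "vs = v # r" using vs(1) by (cases vs) auto
  obtain w r' where w: "vs = r' @ [w]" using vs(1) by (cases vs rule: rev_cases) auto
  have "poly_eq ([] @ z # delta v # (map delta r @ [z])) ([] @ z # delta v0 # delta v # (map delta r @ [z]))"
    using vs(2) d v by (intro poly_eq_insert[OF c]) auto
  then have 1: "poly_eq (z # map delta vs @ [z]) (z # delta v0 # map delta vs @ [z])" using v by simp
  have "poly_eq ((z # delta v0 # map delta r') @ delta w # z # []) ((z # delta v0 # map delta r') @ delta w # delta v0 # z # [])"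
    using poly_eq_adm[OF 1] d w c by (intro poly_eq_insert[OF c(1)]) auto
  then have "poly_eq (z # delta v0 # map delta vs @ [z]) (z # map delta (v0 # vs @ [v0]) @ [z])" using w by simp
  then have 2: "poly_eq (z # map delta vs @ [z]) (z # map delta (v0 # vs @ [v0]) @ [z])" 
    using 1 by (rule poly_eq_trans[rotated])
  have "successively near ([z] @ map delta vs @ [z])" using vs(2) by (simp add: adm_def)
  then have "successively near (map delta vs)" unfolding successively_append_iff by blast
  moreover have "near (delta a) (delta b) \<Longrightarrow> \<exists>c\<in>cells. a \<in> c \<and> b \<in> c" for a b
    using finite_CC delta_in_simplex unfolding near_def by blast
  ultimately have "successively (\<lambda>v w. \<exists>c\<in>cells. v \<in> c \<and> w \<in> c) vs"
    unfolding successively_map by (auto elim: successively_mono)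
  then have "successively (\<lambda>v w. \<exists>c\<in>cells. v \<in> c \<and> w \<in> c) (v0 # vs @ [v0])"
    using c in_c vs(1) by (auto simp: successively_Cons successively_append_iff)
  then obtain p where p: "walk p" "hd p = v0" "last p = v0" 
    "poly_eq ([z] @ map delta (v0 # vs @ [v0]) @ [z]) ([z] @ map delta p @ [z])"
    using chain_walk[of "v0 # vs @ [v0]" "[z]" "[z]"] poly_eq_adm[OF 2] by auto
  have 3: "poly_eq (z # map delta vs @ [z]) (z # map delta p @ [z])"
    using poly_eq_trans[OF 2] p(4) by simp
  then have "homotopic_paths K \<gamma> (polyline (z # map delta p @ [z]))"
    using vs(5) homotopic_paths_trans unfolding poly_eq_def by blast
  then show ?thesis using p poly_eq_adm[OF 3] by blast
qed

lemma walk_adm: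
  assumes z: "z \<in> bsimplex c" "c \<in> cells" "0 < apply_bcontfun z v0" and p: "walk p" "hd p = v0" "last p = v0"
  shows "adm (z # map delta p @ [z])"
proof -
  have v0: "delta v0 \<in> bsimplex c" using simplexD(2)[OF z(1)] z cell_simplex by force
  have near: "near (delta v) (delta w)" if "adj v w" for v w
    using adj_vertices[OF that] cell_simplex unfolding near_def by blast
  have "adm (map delta q @ [z])" if "walk q" "last q = v0" for q
    using that
  proof (induction q rule: induct_list012)
    case (2 v)
    then show ?case using z v0 by (auto simp: adm_simps near_def polyhedron_def)
  next
    case (3 v u q)
    then show ?case using near by (simp add: adm_simps(3))
  qed auto
  then have "adm (map delta p @ [z])" using p by blast
  moreover have "near z (delta v0)" using z v0 by (auto simp: near_def)
  ultimately show ?thesis using p by (cases p) (auto simp: adm_simps(3))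
qed

end

section \<open>Ends of a group of edge loops\<close>

lemma ecard_le_one:
  assumes "\<And>x y. x \<in> A \<Longrightarrow> y \<in> A \<Longrightarrow> x = y"
  shows "ecard A \<le> 1"
proof -
  have "A = {} \<or> (\<exists>x. A = {x})" using assms by blast
  then show ?thesis by (auto simp: ecard_def one_enat_def)
qed

text \<open>The group of closed walks at \<open>v0\<close> up to homotopy, where homotopy is expressed
  by equality of normal forms. The group axioms are inherited from concatenation and reversal
  of walks.\<close>

locale edge_path_group = ascending_links adj sq for adj :: "'v \<Rightarrow> 'v \<Rightarrow> bool" and sq +
  fixes G :: "'g monoid" and v0 :: 'v and \<theta> :: "'v list \<Rightarrow> 'g" and V :: "'v set"
  assumes finite_V: "finite V" and v0_V: "v0 \<in> V" and adj_V: "adj u v \<Longrightarrow> u \<in> V"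
    and \<theta>_in: "walk p \<Longrightarrow> hd p = v0 \<Longrightarrow> last p = v0 \<Longrightarrow> \<theta> p \<in> carrier G"
    and \<theta>_surj: "g \<in> carrier G \<Longrightarrow> \<exists>p. walk p \<and> hd p = v0 \<and> last p = v0 \<and> \<theta> p = g"
    and \<theta>_eq: "walk p \<Longrightarrow> hd p = v0 \<Longrightarrow> last p = v0 \<Longrightarrow> walk q \<Longrightarrow> hd q = v0 \<Longrightarrow> last q = v0 \<Longrightarrow>
        \<theta> p = \<theta> q \<longleftrightarrow> develop p [v0] = develop q [v0]"
    and \<theta>_mult: "walk p \<Longrightarrow> hd p = v0 \<Longrightarrow> last p = v0 \<Longrightarrow> walk q \<Longrightarrow> hd q = v0 \<Longrightarrow> last q = v0 \<Longrightarrow>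
        \<theta> (q @ tl p) = \<theta> p \<otimes>\<^bsub>G\<^esub> \<theta> q"
    and \<theta>_one: "\<theta> [v0] = \<one>\<^bsub>G\<^esub>"
begin

definition loop :: "'v list \<Rightarrow> bool" where
  "loop p \<longleftrightarrow> walk p \<and> hd p = v0 \<and> last p = v0"

lemma loop_join: "loop p \<Longrightarrow> loop q \<Longrightarrow> loop (q @ tl p)"
  using walk_join[of p q] by (auto simp: loop_def)

lemma walk_rev: "walk p \<Longrightarrow> walk (rev p)"
  unfolding walk_def using adj_sym by (auto simp: successively_rev elim: successively_mono)

lemma loop_rev: "loop p \<Longrightarrow> loop (rev p)"
  using walk_rev[of p] by (auto simp: loop_def hd_rev last_rev)

lemma develop_rev:
  assumes "walk p" "normal s" "hd s = last p"
  shows "develop (rev p) (develop p s) = s"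
  using assms(1,3)
proof (induction p rule: induct_list012)
  case (3 v u q)
  define t where "t = develop (u # q) s"
  have t: "normal t" "hd t = u" "develop (rev (u # q)) t = s"
    using 3 develop_facts[of "u # q" s] assms(2) by (auto simp: t_def)
  have "develop (rev (u # q) @ tl [u, v]) (act v t) = develop (rev (u # q)) (develop [u, v] (act v t))"
    by (rule develop_append) auto
  moreover have "act u (act v t) = t" using act_facts(6)[OF t(1), of v] t(2) 3 adj_sym by auto
  ultimately show ?case using t by (simp add: t_def)
qed auto

lemma develop_length:
  assumes "walk q" "normal s" "hd s = last q"
  shows "length s \<le> length (develop q s) + length q"
  using assms(1,3)
proof (induction q rule: induct_list012)
  case (3 w v q)
  have t: "normal (develop (v # q) s)" "hd (develop (v # q) s) = v"
    using develop_facts[of "v # q" s] 3 assms(2) by auto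
  then have "adj (hd (develop (v # q) s)) w" using 3 adj_sym by auto
  from act_facts(4,5)[OF t(1) this] have "length (develop (v # q) s) \<le> Suc (length (act w (develop (v # q) s)))"
    by (cases "w \<in> down (develop (v # q) s)") auto
  then show ?case using 3 by auto
qed auto

lemma \<theta>_surj': "g \<in> carrier G \<Longrightarrow> \<exists>p. loop p \<and> g = \<theta> p"
  using \<theta>_surj unfolding loop_def by blast

lemma \<theta>_closed: "loop p \<Longrightarrow> \<theta> p \<in> carrier G"
  using \<theta>_in unfolding loop_def by blast

lemma \<theta>_join: "loop p \<Longrightarrow> loop q \<Longrightarrow> \<theta> p \<otimes>\<^bsub>G\<^esub> \<theta> q = \<theta> (q @ tl p)"
  using \<theta>_mult unfolding loop_def by simp

lemma loop_singleton: "loop [v0]"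
  by (simp add: loop_def)

lemma loop_nonempty: "loop p \<Longrightarrow> p \<noteq> []"
  by (auto simp: loop_def)

sublocale group G
proof (rule groupI)
  show "\<one>\<^bsub>G\<^esub> \<in> carrier G" using \<theta>_closed[OF loop_singleton] \<theta>_one by simp
next
  fix x y assume "x \<in> carrier G" "y \<in> carrier G"
  then show "x \<otimes>\<^bsub>G\<^esub> y \<in> carrier G" using \<theta>_surj' \<theta>_join \<theta>_closed loop_join by metis
next
  fix x y z assume "x \<in> carrier G" "y \<in> carrier G" "z \<in> carrier G"
  then obtain p q r where *: "loop p" "x = \<theta> p" "loop q" "y = \<theta> q" "loop r" "z = \<theta> r" using \<theta>_surj' by metis
  then have "x \<otimes>\<^bsub>G\<^esub> y \<otimes>\<^bsub>G\<^esub> z = \<theta> (r @ tl (q @ tl p))" "x \<otimes>\<^bsub>G\<^esub> (y \<otimes>\<^bsub>G\<^esub> z) = \<theta> ((r @ tl q) @ tl p)"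
    by (simp_all add: \<theta>_join loop_join)
  then show "x \<otimes>\<^bsub>G\<^esub> y \<otimes>\<^bsub>G\<^esub> z = x \<otimes>\<^bsub>G\<^esub> (y \<otimes>\<^bsub>G\<^esub> z)"
    using loop_nonempty[OF *(3)] by (cases q) auto
next
  fix x assume "x \<in> carrier G"
  then obtain p where p: "loop p" "x = \<theta> p" using \<theta>_surj' by blast
  show "\<one>\<^bsub>G\<^esub> \<otimes>\<^bsub>G\<^esub> x = x" using \<theta>_join[OF loop_singleton p(1)] p(2) \<theta>_one by simp
  have q: "loop (rev p)" "loop (p @ tl (rev p))" using p(1) loop_rev loop_join by blast+
  have "develop (p @ tl (rev p)) [v0] = develop p (develop (rev p) [v0])"
    using p(1) by (intro develop_append) (auto simp: loop_def hd_rev)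
  also have "\<dots> = [v0]"
    using develop_rev[of "rev p" "[v0]"] q(1) normal_singleton by (simp add: loop_def)
  finally have "\<theta> (p @ tl (rev p)) = \<theta> [v0]" using q(2) \<theta>_eq[of "p @ tl (rev p)" "[v0]"] by (simp add: loop_def)
  then show "\<exists>y\<in>carrier G. y \<otimes>\<^bsub>G\<^esub> x = \<one>\<^bsub>G\<^esub>"
    using \<theta>_join[OF q(1) p(1)] \<theta>_closed[OF q(1)] p(2) \<theta>_one by metis
qed

definition state :: "'g \<Rightarrow> 'v list" where
  "state g = develop (SOME p. loop p \<and> g = \<theta> p) [v0]"

lemma state_\<theta>: "loop p \<Longrightarrow> state (\<theta> p) = develop p [v0]"
proof -
  assume p: "loop p"
  define q where "q = (SOME q. loop q \<and> \<theta> p = \<theta> q)"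
  have "loop q \<and> \<theta> p = \<theta> q" unfolding q_def by (rule someI[of _ p]) (simp add: p)
  then have "develop p [v0] = develop q [v0]" using p \<theta>_eq[of p q] by (simp add: loop_def)
  then show ?thesis by (simp add: state_def q_def)
qed

lemma state_facts:
  assumes "g \<in> carrier G"
  shows "normal (state g)" "hd (state g) = v0" "last (state g) = v0"
proof -
  obtain p where p: "loop p" "g = \<theta> p" using \<theta>_surj' assms by blast
  then show "normal (state g)" "hd (state g) = v0" "last (state g) = v0"
    using develop_facts[of p "[v0]"] normal_singleton by (auto simp: state_\<theta> loop_def)
qed

lemma state_inj: "inj_on state (carrier G)"
proof (rule inj_onI)
  fix g h assume *: "g \<in> carrier G" "h \<in> carrier G" "state g = state h"
  then obtain p q where "loop p" "g = \<theta> p" "loop q" "h = \<theta> q" using \<theta>_surj' by metis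
  then show "g = h" using *(3) \<theta>_eq by (simp add: state_\<theta>) (simp add: loop_def)
qed

lemma state_mult:
  assumes "g \<in> carrier G" "loop q"
  shows "state (g \<otimes>\<^bsub>G\<^esub> \<theta> q) = develop q (state g)"
proof -
  obtain p where p: "loop p" "g = \<theta> p" using \<theta>_surj' assms by blast
  then have "state (g \<otimes>\<^bsub>G\<^esub> \<theta> q) = develop (q @ tl p) [v0]"
    using assms(2) by (simp add: \<theta>_join state_\<theta> loop_join)
  also have "\<dots> = develop q (develop p [v0])"
    using p assms(2) loop_nonempty by (intro develop_append) (auto simp: loop_def)
  finally show ?thesis using p by (simp add: state_\<theta>)
qed

lemma walk_set: "walk p \<Longrightarrow> last p = v0 \<Longrightarrow> set p \<subseteq> V"
proof (induction p rule: induct_list012)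
  case (3 w v p)
  then show ?case using adj_V by auto
qed (use v0_V in auto)

lemma finite_ball: "finite {g \<in> carrier G. length (state g) \<le> n}"
proof (rule finite_imageD)
  show "inj_on state {g \<in> carrier G. length (state g) \<le> n}"
    using state_inj by (rule inj_on_subset) auto
  have "state ` {g \<in> carrier G. length (state g) \<le> n} \<subseteq> {p. set p \<subseteq> V \<and> length p \<le> n}"
    using walk_set state_facts by (auto simp: normal_def)
  then show "finite (state ` {g \<in> carrier G. length (state g) \<le> n})"
    using finite_lists_length_le[OF finite_V] by (rule finite_subset)
qed

text \<open>A way back from the vertex \<open>v\<close> to the base point. For \<open>v0\<close> itself
  it has to be the trivial one, so that group elements are recovered from their states.\<close>

definition return :: "'v \<Rightarrow> 'v list" where
  "return v = (if v = v0 then [v0] else SOME p. walk p \<and> hd p = v0 \<and> last p = v)"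

lemma return_facts:
  assumes "normal s" "last s = v0"
  shows "walk (return (hd s))" "hd (return (hd s)) = v0" "last (return (hd s)) = hd s"
proof -
  have "walk (rev s) \<and> hd (rev s) = v0 \<and> last (rev s) = hd s"
    using assms walk_rev by (auto simp: normal_def hd_rev last_rev)
  then have "\<exists>p. walk p \<and> hd p = v0 \<and> last p = hd s" by blast
  then have "walk (return (hd s)) \<and> hd (return (hd s)) = v0 \<and> last (return (hd s)) = hd s"
    unfolding return_def using someI_ex[of "\<lambda>p. walk p \<and> hd p = v0 \<and> last p = hd s"] by auto
  then show "walk (return (hd s))" "hd (return (hd s)) = v0" "last (return (hd s)) = hd s" by auto
qed

text \<open>A group element at bounded distance from a vertex of the universal cover, obtained by
  returning to the base point along a fixed path. Together with \<open>state\<close> it compares the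
  universal cover with the group; steps between neighbouring vertices become multiplications
  by the finitely many elements \<open>hop v w\<close>.\<close>

definition point :: "'v list \<Rightarrow> 'g" where
  "point s = \<theta> (return (hd s) @ tl s)"

definition hop :: "'v \<Rightarrow> 'v \<Rightarrow> 'g" where
  "hop v w = \<theta> (return w @ rev (return v))"

lemma point_facts:
  assumes "normal s" "last s = v0"
  shows "point s \<in> carrier G" "state (point s) = develop (return (hd s)) s"
    "length s \<le> length (state (point s)) + length (return (hd s))"
proof -
  note r = return_facts[OF assms]
  have s: "walk s" using assms by (simp add: normal_def)
  have l: "loop (return (hd s) @ tl s)" using walk_join[OF s r(1)] r assms(2) by (simp add: loop_def)
  then show "point s \<in> carrier G" unfolding point_def by (rule \<theta>_closed)
  have "develop (return (hd s) @ tl s) [v0] = develop (return (hd s)) (develop s [v0])"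
    using r s by (intro develop_append) auto
  then show e: "state (point s) = develop (return (hd s)) s"
    using state_\<theta>[OF l] develop_normal[OF assms(1)] assms(2) by (simp add: point_def)
  show "length s \<le> length (state (point s)) + length (return (hd s))"
    unfolding e using develop_length[OF r(1) assms(1)] r by simp
qed

lemma point_state:
  assumes "g \<in> carrier G"
  shows "point (state g) = g"
proof -
  note s = state_facts[OF assms]
  have "state (point (state g)) = develop (return (hd (state g))) (state g)"
    using point_facts(2)[OF s(1,3)] .
  also have "\<dots> = state g" by (simp add: s(2) return_def)
  finally show ?thesis using state_inj point_facts(1)[OF s(1,3)] assms by (auto dest: inj_onD)
qed

lemma point_act:
  assumes s: "normal s" "last s = v0" and w: "adj (hd s) w"
  shows "point (act w s) = point s \<otimes>\<^bsub>G\<^esub> hop (hd s) w" "hop (hd s) w \<in> carrier G" "\<exists>q. loop q \<and> hop (hd s) w = \<theta> q"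
proof -
  have a: "normal (act w s)" "hd (act w s) = w" "last (act w s) = v0" using act_facts[OF s(1) w] s by auto
  note r = return_facts[OF s] and r' = return_facts[OF a(1,3), unfolded a(2)]
  define m where "m = rev (return (hd s))"
  have m: "walk m" "hd m = hd s" "last m = v0" using r walk_rev[OF r(1)] by (auto simp: m_def hd_rev last_rev)
  then obtain t where t: "m = hd s # t" by (cases m) auto
  have wm: "walk (w # m)" using m w t adj_sym by auto
  have l: "loop (return w @ tl (w # m))"
    using walk_join[OF wm r'(1)] r' m t by (auto simp: loop_def)
  then show h: "hop (hd s) w \<in> carrier G" "\<exists>q. loop q \<and> hop (hd s) w = \<theta> q"
    using \<theta>_closed by (auto simp: hop_def m_def)
  note p = point_facts[OF s]
  have "state (point s \<otimes>\<^bsub>G\<^esub> hop (hd s) w) = develop (return w @ tl (w # m)) (develop (return (hd s)) s)"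
    using state_mult[OF p(1) l] p(2) by (simp add: hop_def m_def)
  also have "\<dots> = develop (return w) (develop (w # m) (develop (return (hd s)) s))"
    using r' by (intro develop_append) auto
  also have "develop (w # m) (develop (return (hd s)) s) = act w (develop m (develop (return (hd s)) s))"
    using t by simp
  also have "develop m (develop (return (hd s)) s) = s"
    unfolding m_def using develop_rev[OF r(1) s(1)] r by simp
  also have "develop (return w) (act w s) = state (point (act w s))"
    using point_facts(2)[OF a(1,3)] a(2) by simp
  finally show "point (act w s) = point s \<otimes>\<^bsub>G\<^esub> hop (hd s) w"
    using state_inj point_facts(1)[OF a(1,3)] p(1) h by (auto dest!: inj_onD)
qed

definition hops :: "'g set" where
  "hops = {hop (hd s) w | s w. normal s \<and> last s = v0 \<and> adj (hd s) w}"

lemma hops_facts: "finite hops" "hops \<subseteq> carrier G"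
proof -
  have "hops \<subseteq> (\<lambda>(v, w). hop v w) ` (V \<times> V)"
    using adj_V adj_sym by (fastforce simp: hops_def)
  then show "finite hops" by (rule finite_subset) (simp add: finite_V)
  show "hops \<subseteq> carrier G" using point_act(2) by (auto simp: hops_def)
qed

text \<open>Following a walk step by step writes a group element as a product of hops. As there are
  finitely many hops, the group is finitely generated.\<close>

lemma generate_hops: "generate G hops = carrier G"
proof
  show "generate G hops \<subseteq> carrier G" using hops_facts(2) generate_in_carrier by blast
  have "point (develop p [v0]) \<in> generate G hops" if "walk p" "last p = v0" for p
    using that
  proof (induction p rule: induct_list012)
    case (2 v)
    then show ?case by (simp add: point_def return_def \<theta>_one generate.one)
  next
    case (3 w v p)
    define s where "s = develop (v # p) [v0]"
    have s: "normal s" "hd s = v" "last s = v0" 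
      using develop_facts[of "v # p" "[v0]"] 3 normal_singleton by (auto simp: s_def)
    have w: "adj (hd s) w" using s 3 adj_sym by auto
    then have "hop (hd s) w \<in> hops" using s unfolding hops_def by blast
    then have "point (act w s) \<in> generate G hops"
      using point_act(1)[OF s(1,3) w] 3 by (auto simp: s_def intro: generate.eng generate.incl)
    then show ?case by (simp add: s_def)
  qed auto
  note pt = this
  show "carrier G \<subseteq> generate G hops"
  proof
    fix g assume g: "g \<in> carrier G"
    then have "point (develop (state g) [v0]) \<in> generate G hops"
      using state_facts[OF g] pt by (auto simp: normal_def)
    then show "g \<in> generate G hops"
      using develop_normal[OF state_facts(1)[OF g]] state_facts[OF g] point_state[OF g] by simp
  qed
qed

text \<open>Multiplication by a fixed element can be carried out along a path in the Cayley graph that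
  comes closer to the base point by at most a constant.\<close>

lemma short_word:
  assumes S: "S \<subseteq> carrier G" and h: "h \<in> generate G S"
  shows "\<exists>C. \<forall>g\<in>carrier G. (g, g \<otimes>\<^bsub>G\<^esub> h) \<in>
     (cayley_edges G S \<inter> {k \<in> carrier G. length (state g) \<le> length (state k) + C} \<times> 
        {k \<in> carrier G. length (state g) \<le> length (state k) + C})\<^sup>*"
  using h
proof (induction)
  case one
  then show ?case by (auto simp: r_one)
next
  case (incl s)
  then have s: "s \<in> carrier G" using S by auto
  then obtain q where q: "loop q" "s = \<theta> q" using \<theta>_surj' by blast
  have "length (state g) \<le> length (state (g \<otimes>\<^bsub>G\<^esub> s)) + length q" if "g \<in> carrier G" for g
    using develop_length[of q "state g"] state_facts[OF that] state_mult[OF that q(1)] q by (simp add: loop_def)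
  then show ?case using incl s by (intro exI[of _ "length q"]) (auto simp: cayley_edges_def)
next
  case (inv s)
  then have s: "s \<in> carrier G" "inv\<^bsub>G\<^esub> s \<in> carrier G" using S by auto
  then obtain q where q: "loop q" "inv\<^bsub>G\<^esub> s = \<theta> q" using \<theta>_surj' by blast
  have "length (state g) \<le> length (state (g \<otimes>\<^bsub>G\<^esub> inv\<^bsub>G\<^esub> s)) + length q" if "g \<in> carrier G" for g
    using develop_length[of q "state g"] state_facts[OF that] state_mult[OF that q(1)] q by (simp add: loop_def)
  moreover have "(g, g \<otimes>\<^bsub>G\<^esub> inv\<^bsub>G\<^esub> s) \<in> cayley_edges G S" if "g \<in> carrier G" for g
  proof -
    have "g = g \<otimes>\<^bsub>G\<^esub> inv\<^bsub>G\<^esub> s \<otimes>\<^bsub>G\<^esub> s" using that s by (simp add: m_assoc)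
    then show ?thesis using inv that s unfolding cayley_edges_def by blast
  qed
  ultimately show ?case using s by (intro exI[of _ "length q"]) (auto intro!: r_into_rtrancl)
next
  case (eng h1 h2)
  have h: "h1 \<in> carrier G" "h2 \<in> carrier G" using eng(1,2) S generate_in_carrier by blast+
  obtain C1 where C1: "\<And>g. g \<in> carrier G \<Longrightarrow> (g, g \<otimes>\<^bsub>G\<^esub> h1) \<in>
     (cayley_edges G S \<inter> {k \<in> carrier G. length (state g) \<le> length (state k) + C1} \<times> 
        {k \<in> carrier G. length (state g) \<le> length (state k) + C1})\<^sup>*" using eng(3) by blast
  obtain C2 where C2: "\<And>g. g \<in> carrier G \<Longrightarrow> (g, g \<otimes>\<^bsub>G\<^esub> h2) \<in>
     (cayley_edges G S \<inter> {k \<in> carrier G. length (state g) \<le> length (state k) + C2} \<times> 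
        {k \<in> carrier G. length (state g) \<le> length (state k) + C2})\<^sup>*" using eng(4) by blast
  obtain q where q: "loop q" "h1 = \<theta> q" using \<theta>_surj' h by blast
  show ?case
  proof (intro exI[of _ "C1 + C2 + length q"] ballI)
    fix g assume g: "g \<in> carrier G"
    let ?R = "\<lambda>g C. cayley_edges G S \<inter> {k \<in> carrier G. length (state g) \<le> length (state k) + C} \<times> 
        {k \<in> carrier G. length (state g) \<le> length (state k) + C}"
    have len: "length (state g) \<le> length (state (g \<otimes>\<^bsub>G\<^esub> h1)) + length q"
      using develop_length[of q "state g"] state_facts[OF g] state_mult[OF g q(1)] q by (simp add: loop_def)
    have "(g, g \<otimes>\<^bsub>G\<^esub> h1) \<in> (?R g (C1 + C2 + length q))\<^sup>*"
      by (rule rtrancl_mono[THEN subsetD, OF _ C1[OF g]]) auto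
    moreover have "(g \<otimes>\<^bsub>G\<^esub> h1, g \<otimes>\<^bsub>G\<^esub> h1 \<otimes>\<^bsub>G\<^esub> h2) \<in> (?R g (C1 + C2 + length q))\<^sup>*"
      by (rule rtrancl_mono[THEN subsetD, OF _ C2[of "g \<otimes>\<^bsub>G\<^esub> h1"]]) (use len g h in auto)
    ultimately show "(g, g \<otimes>\<^bsub>G\<^esub> (h1 \<otimes>\<^bsub>G\<^esub> h2)) \<in> (?R g (C1 + C2 + length q))\<^sup>*"
      using g h by (simp add: m_assoc) 
  qed
qed

text \<open>Both components contain elements far away from the base point, since balls are finite. These
  are joined by a path in the universal cover outside of a large ball. Replacing each of its
  steps by a path in the Cayley graph decreases the distance by at most a constant, so that
  the resulting path avoids \<open>F\<close>.\<close>

theorem infinite_components_equal: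
  assumes S: "finite_generating_set G S" and F: "finite F"
    and C: "C \<in> graph_components (carrier G - F) (cayley_edges G S)" "infinite C"
    and D: "D \<in> graph_components (carrier G - F) (cayley_edges G S)" "infinite D"
  shows "C = D"
proof -
  define R where "R = cayley_edges G S \<inter> (carrier G - F) \<times> (carrier G - F)"
  have "sym R" by (auto simp: R_def sym_def cayley_edges_def)
  then have symR: "sym (R\<^sup>*)" by (rule sym_rtrancl)
  obtain g0 h0 where g0: "g0 \<in> carrier G - F" "C = {w. (g0, w) \<in> R\<^sup>*}" 
    and h0: "h0 \<in> carrier G - F" "D = {w. (h0, w) \<in> R\<^sup>*}"
    using C D unfolding graph_components_def R_def by blast
  define near_word where "near_word t N \<longleftrightarrow> (\<forall>g\<in>carrier G. (g, g \<otimes>\<^bsub>G\<^esub> t) \<in>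
     (cayley_edges G S \<inter> {k \<in> carrier G. length (state g) \<le> length (state k) + N} \<times> 
        {k \<in> carrier G. length (state g) \<le> length (state k) + N})\<^sup>*)" for t N
  have "\<forall>t\<in>hops. \<exists>N. near_word t N"
    using short_word[of S] S hops_facts(2) unfolding near_word_def finite_generating_set_def by blast
  then obtain N where N: "\<And>t. t \<in> hops \<Longrightarrow> near_word t (N t)" using bchoice[of hops near_word] by blast
  define M where "M = sum N hops"
  have near_mono: "near_word t M" if "near_word t m" "m \<le> M" for t m
    unfolding near_word_def
  proof
    fix g assume "g \<in> carrier G"
    then have "(g, g \<otimes>\<^bsub>G\<^esub> t) \<in> (cayley_edges G S \<inter> {k \<in> carrier G. length (state g) \<le> length (state k) + m} \<times> 
        {k \<in> carrier G. length (state g) \<le> length (state k) + m})\<^sup>*"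
      using that(1) unfolding near_word_def by blast
    then show "(g, g \<otimes>\<^bsub>G\<^esub> t) \<in> (cayley_edges G S \<inter> {k \<in> carrier G. length (state g) \<le> length (state k) + M} \<times> 
        {k \<in> carrier G. length (state g) \<le> length (state k) + M})\<^sup>*"
      by (rule rtrancl_mono[THEN subsetD, rotated]) (use that(2) in auto)
  qed
  have "near_word t M" if "t \<in> hops" for t
    using near_mono[OF N[OF that]] member_le_sum[OF that _ hops_facts(1), of N] by (simp add: M_def)
  then have M: "\<And>t g. t \<in> hops \<Longrightarrow> g \<in> carrier G \<Longrightarrow> (g, g \<otimes>\<^bsub>G\<^esub> t) \<in>
     (cayley_edges G S \<inter> {k \<in> carrier G. length (state g) \<le> length (state k) + M} \<times> 
        {k \<in> carrier G. length (state g) \<le> length (state k) + M})\<^sup>*" 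
    unfolding near_word_def by blast
  define B where "B = (\<Sum>f\<in>F. length (state f))"
  have B: "k \<notin> F" if "B < length (state k)" for k
    using that member_le_sum[of k F "\<lambda>f. length (state f)"] F by (auto simp: B_def)
  define Q where "Q = (\<Sum>v\<in>V. length (return v))"
  \<comment> \<open>\<open>B\<close> bounds the length of the states in \<open>F\<close>, \<open>M\<close> the loss in the Cayley graph, and \<open>Q\<close> the loss in passing from states to elements.\<close>
  define n where "n = B + M + Q + 1"
  have Q: "length s \<le> length (state (point s)) + Q" if "normal s" "last s = v0" for s
  proof -
    have "walk s" using that by (simp add: normal_def)
    then have "hd s \<in> V" using walk_set[of s] that by (cases s) auto
    then have "length (return (hd s)) \<le> Q" unfolding Q_def
      using member_le_sum[of "hd s" V "\<lambda>v. length (return v)"] finite_V by simp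
    then show ?thesis using point_facts(3)[OF that] by simp
  qed
  have step: "(point s, point t) \<in> R\<^sup>*" if st: "far n s t" "last s = v0" for s t
  proof -
    obtain w where w: "normal s" "n \<le> length s" "adj (hd s) w" "t = act w s" using st by (auto simp: far_def)
    then have "hop (hd s) w \<in> hops" unfolding hops_def using st(2) by blast
    note edge = M[OF this point_facts(1)[OF w(1) st(2)]]
    have "B + M < length (state (point s))" using Q[OF w(1) st(2)] w(2) by (simp add: n_def)
    then have "{k \<in> carrier G. length (state (point s)) \<le> length (state k) + M} \<subseteq> carrier G - F"
      using B by force
    then have "(point s, point s \<otimes>\<^bsub>G\<^esub> hop (hd s) w) \<in> R\<^sup>*"
      unfolding R_def by (intro rtrancl_mono[THEN subsetD, OF _ edge]) blast
    then show ?thesis using point_act(1)[OF w(1) st(2) w(3)] w(4) by simp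
  qed
  have path: "(point s, point t) \<in> R\<^sup>*" if "(far n)\<^sup>*\<^sup>* s t" "normal s" "last s = v0" for s t
  proof -
    from that have "last t = v0 \<and> (point s, point t) \<in> R\<^sup>*"
    proof (induction)
      case (step t t')
      then show ?case using \<open>\<And>s t. far n s t \<Longrightarrow> last s = v0 \<Longrightarrow> (point s, point t) \<in> R\<^sup>*\<close> far_facts(3)
        by (metis rtrancl_trans)
    qed auto
    then show ?thesis by blast
  qed
  have far_elem: "\<exists>g\<in>carrier G. g \<in> X \<and> n \<le> length (state g)" if X: "infinite X" "X \<subseteq> carrier G" for X
  proof (rule ccontr)
    assume "\<not> ?thesis"
    then have "X \<subseteq> {g \<in> carrier G. length (state g) \<le> n}" using X by force
    then show False using finite_ball X(1) finite_subset by blast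
  qed
  have sub: "{w. (k, w) \<in> R\<^sup>*} \<subseteq> carrier G" if "k \<in> carrier G - F" for k
  proof
    fix w assume "w \<in> {w. (k, w) \<in> R\<^sup>*}"
    then have "(k, w) \<in> R\<^sup>*" by simp
    then show "w \<in> carrier G" by (induction) (use that in \<open>auto simp: R_def\<close>)
  qed
  obtain g where g: "g \<in> carrier G" "g \<in> C" "n \<le> length (state g)"
    using far_elem[OF C(2)] sub[OF g0(1)] g0(2) by blast
  obtain h where h: "h \<in> carrier G" "h \<in> D" "n \<le> length (state h)"
    using far_elem[OF D(2)] sub[OF h0(1)] h0(2) by blast
  have "(far n)\<^sup>*\<^sup>* (state g) (state h)"
    using far_connected state_facts g h by metis
  then have gh: "(g, h) \<in> R\<^sup>*"
    using path[of "state g" "state h"] state_facts[OF g(1)] point_state g(1) h(1) by simp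
  have "(g0, h0) \<in> R\<^sup>*"
  proof -
    have "(g0, g) \<in> R\<^sup>*" "(h0, h) \<in> R\<^sup>*" using g(2) h(2) g0(2) h0(2) by auto
    then show ?thesis using gh symD[OF symR] by (blast intro: rtrancl_trans)
  qed
  then have "(h0, g0) \<in> R\<^sup>*" using symD[OF symR] by blast
  then show "C = D"
    unfolding g0(2) h0(2) using \<open>(g0, h0) \<in> R\<^sup>*\<close> by (auto intro: rtrancl_trans)
qed

theorem one_end: "at_most_one_end G"
  unfolding at_most_one_end_def
proof (intro conjI exI allI impI)
  show "finite_generating_set G hops"
    using hops_facts generate_hops by (simp add: finite_generating_set_def)
  fix S assume S: "finite_generating_set G S"
  show "number_of_graph_ends (carrier G) (cayley_edges G S) \<le> 1"
    unfolding number_of_graph_ends_def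
  proof (rule SUP_least)
    fix F assume "F \<in> {F. finite F \<and> F \<subseteq> carrier G}"
    then have F: "finite F" by simp
    show "ecard {C \<in> graph_components (carrier G - F) (cayley_edges G S). infinite C} \<le> 1"
      by (rule ecard_le_one) (use infinite_components_equal[OF S F] in blast)
  qed
qed

end

section \<open>Isometries between faces of cubes\<close>

definition sqdist :: "nat \<Rightarrow> (nat \<Rightarrow> real) \<Rightarrow> (nat \<Rightarrow> real) \<Rightarrow> real" where
  "sqdist n x y = (\<Sum>i<n. (x i - y i)\<^sup>2)"

lemma cube_dist_eq_iff: "cube_dist n x y = cube_dist m x' y' \<longleftrightarrow> sqdist n x y = sqdist m x' y'"
  by (simp add: cube_dist_def L2_set_def sqdist_def)

lemma unit_cube_bounds: "x \<in> unit_cube n \<Longrightarrow> i < n \<Longrightarrow> 0 \<le> x i \<and> x i \<le> 1"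
  by (auto simp: unit_cube_def PiE_def Pi_def)

lemma unit_cube_eqI:
  "x \<in> unit_cube n \<Longrightarrow> y \<in> unit_cube n \<Longrightarrow> (\<And>i. i < n \<Longrightarrow> x i = y i) \<Longrightarrow> x = y"
  unfolding unit_cube_def by (rule PiE_ext) auto

definition face :: "nat \<Rightarrow> nat set \<Rightarrow> (nat \<Rightarrow> real) \<Rightarrow> (nat \<Rightarrow> real) set" where
  "face n J e = {x \<in> unit_cube n. \<forall>i\<in>J. x i = e i}"

lemma sqdist_face:
  assumes "J \<subseteq> {..<n}" "x \<in> face n J e" "y \<in> face n J e"
  shows "sqdist n x y = (\<Sum>i\<in>{..<n} - J. (x i - y i)\<^sup>2)"
  unfolding sqdist_def
  by (rule sum.mono_neutral_right) (use assms in \<open>auto simp: face_def\<close>)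

lemma unit_interval_sq: "0 \<le> a \<and> a \<le> 1 \<Longrightarrow> 0 \<le> b \<and> b \<le> 1 \<Longrightarrow> (a - b)\<^sup>2 \<le> (1::real)"
  using abs_square_le_1[of "a - b"] by (simp add: abs_le_iff)

lemma sqdist_face_le:
  assumes "J \<subseteq> {..<n}" "x \<in> face n J e" "y \<in> face n J e"
  shows "sqdist n x y \<le> card ({..<n} - J)"
proof -
  have "(\<Sum>i\<in>{..<n} - J. (x i - y i)\<^sup>2) \<le> (\<Sum>i\<in>{..<n} - J. 1)"
    using assms unit_cube_bounds by (intro sum_mono unit_interval_sq) (auto simp: face_def)
  then show ?thesis using sqdist_face[OF assms] by simp
qed

text \<open>Corners are recognized metrically: a point whose distance to some other point is the
  diameter of the face has all its free coordinates in \<open>{0, 1}\<close>.\<close>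

lemma extremal_coordinates:
  assumes "J \<subseteq> {..<n}" "x \<in> face n J e" "y \<in> face n J e" "sqdist n x y = card ({..<n} - J)" "i \<in> {..<n} - J"
  shows "x i \<in> {0, 1}"
proof -
  have b: "0 \<le> x i \<and> x i \<le> 1" "0 \<le> y i \<and> y i \<le> 1" if "i \<in> {..<n} - J" for i
    using assms that unit_cube_bounds by (auto simp: face_def)
  have "(\<Sum>i\<in>{..<n} - J. 1 - (x i - y i)\<^sup>2) = 0"
    using assms sqdist_face[OF assms(1-3)] by (simp add: sum_subtractf)
  moreover have "0 \<le> 1 - (x i - y i)\<^sup>2" if "i \<in> {..<n} - J" for i
    using unit_interval_sq b[OF that] by simp
  ultimately have "1 - (x i - y i)\<^sup>2 = 0"
    using assms(5) sum_nonneg_eq_0_iff[of "{..<n} - J" "\<lambda>i. 1 - (x i - y i)\<^sup>2"] by auto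
  then have "(x i - y i)\<^sup>2 = 1" by simp
  then have "x i - y i = 1 \<or> x i - y i = -1" by (simp add: power2_eq_1_iff)
  then show ?thesis using b[OF assms(5)] by auto
qed

definition fill :: "nat \<Rightarrow> nat set \<Rightarrow> (nat \<Rightarrow> real) \<Rightarrow> (nat \<Rightarrow> real) \<Rightarrow> nat \<Rightarrow> real" where
  "fill n J e f = (\<lambda>i\<in>{..<n}. if i \<in> J then e i else f i)"

lemma fill_face:
  assumes "J \<subseteq> {..<n}" "\<forall>i\<in>J. e i \<in> {0, 1}" "\<And>i. i \<in> {..<n} - J \<Longrightarrow> 0 \<le> f i \<and> f i \<le> 1"
  shows "fill n J e f \<in> face n J e"
proof -
  have "0 \<le> e i \<and> e i \<le> 1" if "i \<in> J" for i using assms(2) that by force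
  then show ?thesis using assms by (auto simp: fill_def face_def unit_cube_def)
qed

lemma sqdist_fill:
  assumes "J \<subseteq> {..<n}" "x \<in> face n J e" "\<forall>i\<in>J. e i \<in> {0, 1}" "\<And>i. i \<in> {..<n} - J \<Longrightarrow> 0 \<le> f i \<and> f i \<le> 1"
  shows "sqdist n x (fill n J e f) = (\<Sum>i\<in>{..<n} - J. (x i - f i)\<^sup>2)"
proof -
  have "fill n J e f \<in> face n J e" using assms by (intro fill_face) auto
  then have "sqdist n x (fill n J e f) = (\<Sum>i\<in>{..<n} - J. (x i - fill n J e f i)\<^sup>2)"
    by (rule sqdist_face[OF assms(1,2)])
  also have "\<dots> = (\<Sum>i\<in>{..<n} - J. (x i - f i)\<^sup>2)"
    by (rule sum.cong) (auto simp: fill_def)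
  finally show ?thesis .
qed

text \<open>The dimension of a face is the square of its diameter.\<close>

lemma isometry_dim_le:
  assumes J: "J \<subseteq> {..<n}" "\<forall>i\<in>J. e i \<in> {0, 1::real}" and J': "J' \<subseteq> {..<m}"
    and h: "\<And>x. x \<in> face n J e \<Longrightarrow> h x \<in> face m J' e'"
    and iso: "\<And>x y. x \<in> face n J e \<Longrightarrow> y \<in> face n J e \<Longrightarrow> sqdist m (h x) (h y) = sqdist n x y"
  shows "card ({..<n} - J) \<le> card ({..<m} - J')"
proof -
  let ?o = "fill n J e (\<lambda>_. 0)" and ?w = "fill n J e (\<lambda>_. 1)"
  have o: "?o \<in> face n J e" "?w \<in> face n J e" using J by (auto intro!: fill_face)
  have "sqdist n ?o ?w = (\<Sum>i\<in>{..<n} - J. (?o i - 1)\<^sup>2)" using J o by (intro sqdist_fill) auto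
  also have "\<dots> = (\<Sum>i\<in>{..<n} - J. 1)" by (rule sum.cong) (auto simp: fill_def)
  finally have "real (card ({..<n} - J)) = sqdist m (h ?o) (h ?w)" using iso o by simp
  also have "\<dots> \<le> card ({..<m} - J')" using sqdist_face_le[OF J' h h] o by blast
  finally show ?thesis by simp
qed

text \<open>An isometry maps corners to corners and neighbouring corners to neighbouring corners. This
  defines the permutation \<open>\<tau>\<close> of the directions at the corner
  \<open>o0\<close>. A coordinate of a point is an affine function of the difference of the
  squared distances to \<open>o0\<close> and to its neighbour in that direction, so it is
  preserved, up to the reflection that is needed if the image of \<open>o0\<close> is not at
  the origin.\<close>

theorem face_isometry_signed_permutation:
  assumes J: "J \<subseteq> {..<n}" "\<forall>i\<in>J. e i \<in> {0, 1::real}" and J': "J' \<subseteq> {..<m}" "\<forall>i\<in>J'. e' i \<in> {0, 1::real}"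
    and iso: "face_isometry n (face n J e) m (face m J' e') h"
  shows "\<exists>\<tau> \<epsilon>. bij_betw \<tau> ({..<n} - J) ({..<m} - J') \<and> (\<forall>i\<in>{..<n} - J. \<epsilon> i \<in> {0, 1::real}) \<and>
     (\<forall>x\<in>face n J e. \<forall>i\<in>{..<n} - J. h x (\<tau> i) = \<bar>x i - \<epsilon> i\<bar>)"
proof -
  let ?N = "{..<n} - J" and ?M = "{..<m} - J'"
  have hF: "h x \<in> face m J' e'" if "x \<in> face n J e" for x using iso that by (auto simp: face_isometry_def)
  have hd: "sqdist m (h x) (h y) = sqdist n x y" if "x \<in> face n J e" "y \<in> face n J e" for x y
    using iso that by (simp add: face_isometry_def cube_dist_eq_iff)
  define g where "g y = (SOME x. x \<in> face n J e \<and> h x = y)" for y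
  have g: "g y \<in> face n J e \<and> h (g y) = y" if "y \<in> face m J' e'" for y
  proof -
    have "y \<in> h ` face n J e" using iso that by (simp add: face_isometry_def)
    then have "\<exists>x. x \<in> face n J e \<and> h x = y" by blast
    then show ?thesis unfolding g_def by (rule someI_ex)
  qed
  have gd: "sqdist n (g x) (g y) = sqdist m x y" if "x \<in> face m J' e'" "y \<in> face m J' e'" for x y
    using hd[of "g x" "g y"] g that by simp
  have card: "card ?N = card ?M"
  proof (rule antisym)
    show "card ?N \<le> card ?M" by (rule isometry_dim_le[OF J J'(1) hF hd])
    show "card ?M \<le> card ?N" by (rule isometry_dim_le[OF J' J(1), of g e]) (use g gd in auto)
  qed
  define pt where "pt f = fill n J e f" for f
  have pt: "pt f \<in> face n J e" if "\<And>i. i \<in> ?N \<Longrightarrow> f i \<in> {0, 1}" for f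
    unfolding pt_def using that J by (intro fill_face) force+
  have pt_dist: "sqdist n x (pt f) = (\<Sum>i\<in>?N. (x i - f i)\<^sup>2)"
    if "x \<in> face n J e" "\<And>i. i \<in> ?N \<Longrightarrow> f i \<in> {0, 1}" for x f
    unfolding pt_def using that J by (intro sqdist_fill) force+
  have pt_at: "pt f i = f i" if "i \<in> ?N" for f i using that by (simp add: pt_def fill_def)
  have corner: "h (pt f) s \<in> {0, 1}" if f: "\<And>i. i \<in> ?N \<Longrightarrow> f i \<in> {0, 1}" and s: "s \<in> ?M" for f s
  proof -
    have f': "\<And>i. i \<in> ?N \<Longrightarrow> 1 - f i \<in> {0, 1}" using f by force
    have p: "pt f \<in> face n J e" "pt (\<lambda>i. 1 - f i) \<in> face n J e"
      by (rule pt, rule f, assumption) (rule pt, rule f')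
    have "sqdist n (pt f) (pt (\<lambda>i. 1 - f i)) = (\<Sum>i\<in>?N. (pt f i - (1 - f i))\<^sup>2)"
      using p(1) f' by (rule pt_dist)
    also have "\<dots> = (\<Sum>i\<in>?N. 1)"
    proof (rule sum.cong)
      fix i assume "i \<in> ?N"
      then show "(pt f i - (1 - f i))\<^sup>2 = 1" using f[of i] pt_at[of i f] by force
    qed simp
    finally have "sqdist m (h (pt f)) (h (pt (\<lambda>i. 1 - f i))) = card ?M"
      using hd[OF p] card by simp
    then show ?thesis by (rule extremal_coordinates[OF J'(1) hF[OF p(1)] hF[OF p(2)] _ s])
  qed
  \<comment> \<open>\<open>o0\<close> is the corner of the first face with all free coordinates 0, and \<open>u i\<close> is its neighbour in direction \<open>i\<close>.\<close>
  define o0 where "o0 = pt (\<lambda>_. 0)"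
  define u where "u i = pt (\<lambda>k. if k = i then 1 else 0)" for i
  have o0: "o0 \<in> face n J e" "\<And>s. s \<in> ?M \<Longrightarrow> h o0 s \<in> {0, 1}"
    and u: "u i \<in> face n J e" "\<And>s. s \<in> ?M \<Longrightarrow> h (u i) s \<in> {0, 1}" for i
    unfolding o0_def u_def by (intro pt corner; auto)+
  have u_at: "u i k = (if k = i then 1 else 0)" if "k \<in> ?N" for i k using pt_at[OF that] by (simp add: u_def)
  have o_at: "o0 k = 0" if "k \<in> ?N" for k using pt_at[OF that] by (simp add: o0_def)
  have du: "sqdist n x (u i) = (\<Sum>k\<in>?N. (x k - (if k = i then 1 else 0))\<^sup>2)" if "x \<in> face n J e" for x i
    unfolding u_def by (rule pt_dist[OF that]) auto
  have do: "sqdist n x o0 = (\<Sum>k\<in>?N. (x k)\<^sup>2)" if "x \<in> face n J e" for x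
    using pt_dist[OF that, of "\<lambda>_. 0"] by (simp add: o0_def)
  \<comment> \<open>The quadratic terms cancel, and the coordinate in direction \<open>i\<close> remains.\<close>
  have split: "sqdist n x o0 - sqdist n x (u i) = 2 * x i - 1" if x: "x \<in> face n J e" and i: "i \<in> ?N" for x i
  proof -
    have "sqdist n x o0 - sqdist n x (u i) = (\<Sum>k\<in>?N. (x k)\<^sup>2 - (x k - (if k = i then 1 else 0))\<^sup>2)"
      unfolding du[OF x] do[OF x] by (simp add: sum_subtractf)
    also have "\<dots> = (\<Sum>k\<in>?N. if k = i then 2 * x k - 1 else 0)"
      by (rule sum.cong) (auto simp: power2_eq_square algebra_simps)
    also have "\<dots> = 2 * x i - 1" using i by simp
    finally show ?thesis .
  qed
  have one: "\<exists>t\<in>?M. \<forall>s\<in>?M. h (u i) s = (if s = t then 1 - h o0 s else h o0 s)" if i: "i \<in> ?N" for i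
  proof -
    have "sqdist n o0 (u i) = 1"
      using split[OF o0(1) i] o_at[OF i] do[OF o0(1)] o_at by simp
    then have "(\<Sum>s\<in>?M. (h o0 s - h (u i) s)\<^sup>2) = 1"
      using hd[OF o0(1) u(1)] sqdist_face[OF J'(1) hF[OF o0(1)] hF[OF u(1)]] by simp
    moreover have "(h o0 s - h (u i) s)\<^sup>2 = (if h o0 s \<noteq> h (u i) s then 1 else 0)" if "s \<in> ?M" for s
      using o0(2)[OF that] u(2)[OF that, of i] by auto
    ultimately have "(\<Sum>s\<in>?M. if h o0 s \<noteq> h (u i) s then 1 else 0::real) = 1" by simp
    then have "real (card {s \<in> ?M. h o0 s \<noteq> h (u i) s}) = 1"
      by (simp add: sum.If_cases Int_def conj_commute)
    then obtain t where t: "{s \<in> ?M. h o0 s \<noteq> h (u i) s} = {t}" using card_1_singletonE by (metis of_nat_eq_1_iff)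
    show ?thesis
    proof (intro bexI[of _ t] ballI)
      show "t \<in> ?M" using t by blast
      fix s assume s: "s \<in> ?M"
      show "h (u i) s = (if s = t then 1 - h o0 s else h o0 s)"
      proof (cases "s = t")
        case True
        then have "h o0 s \<noteq> h (u i) s" using t by blast
        then show ?thesis using True o0(2)[OF s] u(2)[OF s, of i] by auto
      next
        case False
        then have "h o0 s = h (u i) s" using t s by blast
        then show ?thesis using False by simp
      qed
    qed
  qed
  then obtain \<tau> where \<tau>: "\<And>i. i \<in> ?N \<Longrightarrow> \<tau> i \<in> ?M"
     "\<And>i s. i \<in> ?N \<Longrightarrow> s \<in> ?M \<Longrightarrow> h (u i) s = (if s = \<tau> i then 1 - h o0 s else h o0 s)" by metis
  have inj: "inj_on \<tau> ?N"
  proof (rule inj_onI, rule ccontr)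
    fix i k assume *: "i \<in> ?N" "k \<in> ?N" "\<tau> i = \<tau> k" "i \<noteq> k"
    have "sqdist m (h (u i)) (h (u k)) = 0"
      unfolding sqdist_face[OF J'(1) hF[OF u(1)] hF[OF u(1)]] using * \<tau>(2) by simp
    then have "sqdist n (u i) (u k) = 0" using hd[OF u(1) u(1)] by simp
    moreover have "sqdist n (u i) o0 - sqdist n (u i) (u k) = -1"
      using split[OF u(1) *(2)] u_at[OF *(2), of i] *(4) by simp
    moreover have "sqdist n (u i) o0 \<ge> 0" by (simp add: sqdist_def sum_nonneg)
    ultimately show False by simp
  qed
  have "\<tau> ` ?N = ?M"
    by (rule card_subset_eq) (use \<tau>(1) card_image[OF inj] card in auto)
  then have bij: "bij_betw \<tau> ?N ?M" using inj by (simp add: bij_betw_def)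
  have "h x (\<tau> i) = \<bar>x i - h o0 (\<tau> i)\<bar>" if x: "x \<in> face n J e" and i: "i \<in> ?N" for x i
  proof -
    define y where "y = h x"
    have y: "y \<in> face m J' e'" using hF x y_def by simp
    let ?a = "h o0 (\<tau> i)"
    have a: "?a \<in> {0, 1}" using o0(2) \<tau>(1) i by blast
    have "sqdist m y (h o0) - sqdist m y (h (u i)) = (\<Sum>s\<in>?M. (y s - h o0 s)\<^sup>2 - (y s - h (u i) s)\<^sup>2)"
      unfolding sqdist_face[OF J'(1) y hF[OF o0(1)]] sqdist_face[OF J'(1) y hF[OF u(1)]] 
      by (simp add: sum_subtractf)
    also have "\<dots> = (\<Sum>s\<in>?M. if s = \<tau> i then (y s - h o0 s)\<^sup>2 - (y s - (1 - h o0 s))\<^sup>2 else 0)"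
      by (rule sum.cong) (auto simp: \<tau>(2)[OF i])
    also have "\<dots> = (y (\<tau> i) - ?a)\<^sup>2 - (y (\<tau> i) - (1 - ?a))\<^sup>2" using \<tau>(1)[OF i] by simp
    finally have "2 * x i - 1 = (y (\<tau> i) - ?a)\<^sup>2 - (y (\<tau> i) - (1 - ?a))\<^sup>2"
      using split[OF x i] hd[OF x o0(1)] hd[OF x u(1), of i] by (simp add: y_def)
    moreover have "0 \<le> x i \<and> x i \<le> 1" using x i unit_cube_bounds by (auto simp: face_def)
    ultimately show ?thesis using a by (auto simp: y_def power2_eq_square algebra_simps)
  qed
  then show ?thesis using bij o0(2) \<tau>(1) by (intro exI[of _ \<tau>] exI[of _ "\<lambda>i. h o0 (\<tau> i)"]) auto
qed

text \<open>The way in which two cubes meet, in coordinates: \<open>R x y\<close> says that the point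
  \<open>x\<close> of one cube equals the point \<open>y\<close> of the other one. The common
  face is given by the fixed coordinates \<open>J\<close>, \<open>e\<close> in the first and
  \<open>J'\<close>, \<open>e'\<close> in the second cube; its directions correspond under
  \<open>\<tau>\<close>, with a reflection where \<open>\<epsilon>\<close> is 1.\<close>

definition glued :: "nat \<Rightarrow> nat \<Rightarrow> nat set \<Rightarrow> (nat \<Rightarrow> real) \<Rightarrow> nat set \<Rightarrow> (nat \<Rightarrow> real) \<Rightarrow> (nat \<Rightarrow> nat) \<Rightarrow> (nat \<Rightarrow> real)
    \<Rightarrow> ((nat \<Rightarrow> real) \<Rightarrow> (nat \<Rightarrow> real) \<Rightarrow> bool) \<Rightarrow> bool" where
  "glued n m J e J' e' \<tau> \<epsilon> R \<longleftrightarrow> J \<subseteq> {..<n} \<and> (\<forall>i\<in>J. e i \<in> {0, 1}) \<and> J' \<subseteq> {..<m} \<and> (\<forall>i\<in>J'. e' i \<in> {0, 1}) \<and>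
     bij_betw \<tau> ({..<n} - J) ({..<m} - J') \<and> (\<forall>i\<in>{..<n} - J. \<epsilon> i \<in> {0, 1}) \<and>
     (\<forall>x\<in>unit_cube n. \<forall>y\<in>unit_cube m. R x y \<longleftrightarrow> (\<forall>i\<in>J. x i = e i) \<and> (\<forall>i\<in>J'. y i = e' i) \<and>
        (\<forall>i\<in>{..<n} - J. y (\<tau> i) = \<bar>x i - \<epsilon> i\<bar>))"

lemma cube_complex_glued:
  assumes X: "cube_complex X" and l: "l \<in> cindex X" "m \<in> cindex X"
    and x: "x \<in> unit_cube (cdim X l)" "y \<in> unit_cube (cdim X m)" "cmap X l x = cmap X m y"
  shows "\<exists>J e J' e' \<tau> \<epsilon>. glued (cdim X l) (cdim X m) J e J' e' \<tau> \<epsilon> (\<lambda>x y. cmap X l x = cmap X m y)"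
proof -
  let ?n = "cdim X l" and ?m = "cdim X m"
  have "cmap X l ` unit_cube ?n \<inter> cmap X m ` unit_cube ?m \<noteq> {}" using x by blast
  then have "\<exists>j k F F' h. cube_face ?n j F \<and> cube_face ?m k F' \<and> face_isometry ?n F ?m F' h \<and>
     (\<forall>x\<in>unit_cube ?n. \<forall>y\<in>unit_cube ?m. cmap X l x = cmap X m y \<longleftrightarrow> x \<in> F \<and> y = h x)"
    using bspec[OF bspec[OF X[unfolded cube_complex_def, THEN conjunct2, THEN conjunct2, THEN conjunct2, THEN conjunct1] l(1)] l(2)]
    by (rule mp[rotated])
  then obtain j k F F' h where *: "cube_face ?n j F \<and> cube_face ?m k F' \<and> face_isometry ?n F ?m F' h \<and>
     (\<forall>x\<in>unit_cube ?n. \<forall>y\<in>unit_cube ?m. cmap X l x = cmap X m y \<longleftrightarrow> x \<in> F \<and> y = h x)"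
    by (elim exE)
  then have F: "cube_face ?n j F" "cube_face ?m k F'" "face_isometry ?n F ?m F' h" by auto
  have eq: "cmap X l x = cmap X m y \<longleftrightarrow> x \<in> F \<and> y = h x" if "x \<in> unit_cube ?n" "y \<in> unit_cube ?m" for x y
    using * that by blast
  obtain J e where J: "J \<subseteq> {..<?n}" "\<forall>i\<in>J. e i \<in> {0, 1}" "F = face ?n J e"
    using F(1) by (auto simp: cube_face_def face_def)
  obtain J' e' where J': "J' \<subseteq> {..<?m}" "\<forall>i\<in>J'. e' i \<in> {0, 1}" "F' = face ?m J' e'"
    using F(2) by (auto simp: cube_face_def face_def)
  have iso: "face_isometry ?n (face ?n J e) ?m (face ?m J' e') h" using F(3) J(3) J'(3) by simp
  obtain \<tau> \<epsilon> where \<tau>: "bij_betw \<tau> ({..<?n} - J) ({..<?m} - J') \<and> (\<forall>i\<in>{..<?n} - J. \<epsilon> i \<in> {0, 1::real}) \<and>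
     (\<forall>x\<in>face ?n J e. \<forall>i\<in>{..<?n} - J. h x (\<tau> i) = \<bar>x i - \<epsilon> i\<bar>)"
    using face_isometry_signed_permutation[OF J(1,2) J'(1,2) iso] by (elim exE)
  then have \<tau>: "bij_betw \<tau> ({..<?n} - J) ({..<?m} - J')" "\<forall>i\<in>{..<?n} - J. \<epsilon> i \<in> {0, 1}"
     "\<And>x i. x \<in> face ?n J e \<Longrightarrow> i \<in> {..<?n} - J \<Longrightarrow> h x (\<tau> i) = \<bar>x i - \<epsilon> i\<bar>"
    by blast+
  have hF: "h x \<in> F'" if "x \<in> F" for x using F(3) that by (auto simp: face_isometry_def)
  have "cmap X l x = cmap X m y \<longleftrightarrow> (\<forall>i\<in>J. x i = e i) \<and> (\<forall>i\<in>J'. y i = e' i) \<and>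
        (\<forall>i\<in>{..<?n} - J. y (\<tau> i) = \<bar>x i - \<epsilon> i\<bar>)" (is "?L \<longleftrightarrow> ?R")
    if xy: "x \<in> unit_cube ?n" "y \<in> unit_cube ?m" for x y
  proof
    assume ?L
    then have "x \<in> F" "y = h x" using eq xy by auto
    then show ?R using hF[of x] \<tau>(3) J(3) J'(3) by (auto simp: face_def)
  next
    assume R: ?R
    then have xF: "x \<in> F" using xy J(3) by (auto simp: face_def)
    have "y = h x"
    proof (rule unit_cube_eqI[OF xy(2)])
      show "h x \<in> unit_cube ?m" using hF[OF xF] J'(3) by (auto simp: face_def)
      fix s assume s: "s < ?m"
      show "y s = h x s"
      proof (cases "s \<in> J'")
        case True
        then show ?thesis using R hF[OF xF] J'(3) by (auto simp: face_def)
      next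
        case False
        then obtain i where "i \<in> {..<?n} - J" "s = \<tau> i" using \<tau>(1) s by (auto simp: bij_betw_def)
        then show ?thesis using R \<tau>(3)[of x i] xF J(3) by auto
      qed
    qed
    then show ?L using eq xy xF by blast
  qed
  then have "glued ?n ?m J e J' e' \<tau> \<epsilon> (\<lambda>x y. cmap X l x = cmap X m y)"
    unfolding glued_def using J(1,2) J'(1,2) \<tau>(1,2) by (intro conjI ballI) auto
  then show ?thesis by (intro exI)
qed

section \<open>Multilinear coordinates\<close>

definition corner_of :: "nat \<Rightarrow> nat set \<Rightarrow> nat \<Rightarrow> real" where
  "corner_of n A = (\<lambda>i\<in>{..<n}. if i \<in> A then 1 else 0)"

lemma corner_of_cube [simp]: "corner_of n A \<in> unit_cube n"
  by (auto simp: corner_of_def unit_cube_def)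

lemma corner_of_at: "i < n \<Longrightarrow> corner_of n A i = (if i \<in> A then 1 else 0)"
  by (simp add: corner_of_def)

lemma corner_of_inj: "A \<subseteq> {..<n} \<Longrightarrow> B \<subseteq> {..<n} \<Longrightarrow> corner_of n A = corner_of n B \<Longrightarrow> A = B"
proof -
  assume *: "A \<subseteq> {..<n}" "B \<subseteq> {..<n}" "corner_of n A = corner_of n B"
  have "i \<in> A \<longleftrightarrow> i \<in> B" if "i < n" for i
    using fun_cong[OF *(3), of i] that by (simp add: corner_of_at split: if_splits)
  then show ?thesis using * by blast
qed

text \<open>The multilinear weight of the corner \<open>A\<close> at the point \<open>x\<close> of the
  cube, i.e. the probability of \<open>A\<close> if each direction \<open>i\<close> is chosen
  independently with probability \<open>x i\<close>.\<close>

definition weight :: "nat \<Rightarrow> (nat \<Rightarrow> real) \<Rightarrow> nat set \<Rightarrow> real" where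
  "weight n x A = (\<Prod>i<n. if i \<in> A then x i else 1 - x i)"

lemma weight_split:
  assumes "A \<subseteq> {..<n}"
  shows "weight n x A = (\<Prod>i\<in>A. x i) * (\<Prod>i\<in>{..<n} - A. 1 - x i)"
proof -
  have "{..<n} \<inter> {i. i \<in> A} = A" "{..<n} \<inter> - {i. i \<in> A} = {..<n} - A" using assms by auto
  then show ?thesis unfolding weight_def by (simp add: prod.If_cases)
qed

lemma weight_nonneg: "x \<in> unit_cube n \<Longrightarrow> 0 \<le> weight n x A"
  unfolding weight_def by (rule prod_nonneg) (use unit_cube_bounds in force)

lemma weight_nonzero: "weight n x A \<noteq> 0 \<longleftrightarrow> (\<forall>i<n. (i \<in> A \<longrightarrow> x i \<noteq> 0) \<and> (i \<notin> A \<longrightarrow> x i \<noteq> 1))"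
  unfolding weight_def by auto

lemma sum_weight: "(\<Sum>A\<in>Pow {..<n}. weight n x A) = 1"
proof -
  have "(\<Prod>i<n. x i + (1 - x i)) = (\<Sum>A\<in>Pow {..<n}. (\<Prod>i\<in>A. x i) * (\<Prod>i\<in>{..<n} - A. 1 - x i))"
    by (rule prod_add) simp
  then show ?thesis by (simp add: weight_split)
qed

text \<open>A point is the average of the corners with its weights.\<close>

lemma sum_weight_coordinate:
  assumes "j < n"
  shows "(\<Sum>A\<in>Pow {..<n}. weight n x A * corner_of n A j) = x j"
proof -
  let ?g = "\<lambda>i. if i = j then 0 else 1 - x i"
  have "(\<Sum>A\<in>Pow {..<n}. weight n x A * corner_of n A j) = 
      (\<Sum>A\<in>Pow {..<n}. (\<Prod>i\<in>A. x i) * (\<Prod>i\<in>{..<n} - A. ?g i))"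
  proof (rule sum.cong)
    fix A assume A: "A \<in> Pow {..<n}"
    show "weight n x A * corner_of n A j = (\<Prod>i\<in>A. x i) * (\<Prod>i\<in>{..<n} - A. ?g i)"
    proof (cases "j \<in> A")
      case True
      then have "(\<Prod>i\<in>{..<n} - A. ?g i) = (\<Prod>i\<in>{..<n} - A. 1 - x i)" by (intro prod.cong) auto
      then show ?thesis using A True assms by (simp add: weight_split corner_of_at)
    next
      case False
      then have "(\<Prod>i\<in>{..<n} - A. ?g i) = 0" using assms by (intro prod_zero) auto
      then show ?thesis using False assms by (simp add: corner_of_at)
    qed
  qed simp
  also have "\<dots> = (\<Prod>i<n. x i + ?g i)" by (rule prod_add[symmetric]) simp
  also have "\<dots> = (\<Prod>i<n. if i = j then x i else 1)" by (rule prod.cong) auto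
  also have "\<dots> = x j" using assms by (simp add: prod.delta)
  finally show ?thesis .
qed

lemma gluedD:
  assumes "glued n m J e J' e' \<tau> \<epsilon> R"
  shows "J \<subseteq> {..<n}" "i \<in> J \<Longrightarrow> e i = 0 \<or> e i = 1" "J' \<subseteq> {..<m}" "i \<in> J' \<Longrightarrow> e' i = 0 \<or> e' i = 1"
    "bij_betw \<tau> ({..<n} - J) ({..<m} - J')" "i \<in> {..<n} - J \<Longrightarrow> \<epsilon> i = 0 \<or> \<epsilon> i = 1"
    "x \<in> unit_cube n \<Longrightarrow> y \<in> unit_cube m \<Longrightarrow> R x y \<longleftrightarrow> (\<forall>i\<in>J. x i = e i) \<and> (\<forall>i\<in>J'. y i = e' i) \<and>
        (\<forall>i\<in>{..<n} - J. y (\<tau> i) = \<bar>x i - \<epsilon> i\<bar>)"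
  using assms unfolding glued_def by blast+

lemma glued_corners:
  assumes g: "glued n m J e J' e' \<tau> \<epsilon> R"
  shows "R (corner_of n A) (corner_of m A') \<longleftrightarrow> (\<forall>i\<in>J. i \<in> A \<longleftrightarrow> e i = 1) \<and> (\<forall>t\<in>J'. t \<in> A' \<longleftrightarrow> e' t = 1) \<and>
     (\<forall>i\<in>{..<n} - J. \<tau> i \<in> A' \<longleftrightarrow> (i \<in> A) \<noteq> (\<epsilon> i = 1))"
proof -
  have 1: "corner_of n A i = e i \<longleftrightarrow> (i \<in> A \<longleftrightarrow> e i = 1)" if "i \<in> J" for i
  proof -
    have "i < n" "e i = 0 \<or> e i = 1" using gluedD(1,2)[OF g] that by auto
    then show ?thesis by (auto simp: corner_of_at)
  qed
  have 2: "corner_of m A' i = e' i \<longleftrightarrow> (i \<in> A' \<longleftrightarrow> e' i = 1)" if "i \<in> J'" for i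
  proof -
    have "i < m" "e' i = 0 \<or> e' i = 1" using gluedD(3,4)[OF g] that by auto
    then show ?thesis by (auto simp: corner_of_at)
  qed
  have 3: "corner_of m A' (\<tau> i) = \<bar>corner_of n A i - \<epsilon> i\<bar> \<longleftrightarrow> (\<tau> i \<in> A' \<longleftrightarrow> (i \<in> A) \<noteq> (\<epsilon> i = 1))" 
    if i: "i \<in> {..<n} - J" for i
  proof -
    have "\<tau> i < m" using gluedD(5)[OF g] i by (auto simp: bij_betw_def)
    then show ?thesis using gluedD(6)[OF g i] i by (auto simp: corner_of_at)
  qed
  show ?thesis unfolding gluedD(7)[OF g corner_of_cube corner_of_cube] using 1 2 3 by simp
qed

lemma glued_partner:
  assumes g: "glued n m J e J' e' \<tau> \<epsilon> R" and A: "\<And>i. i \<in> J \<Longrightarrow> i \<in> A \<longleftrightarrow> e i = 1"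
  shows "\<exists>A'\<subseteq>{..<m}. R (corner_of n A) (corner_of m A')"
proof -
  let ?S = "{i \<in> {..<n} - J. (i \<in> A) \<noteq> (\<epsilon> i = 1)}"
  let ?A' = "{t \<in> J'. e' t = 1} \<union> \<tau> ` ?S"
  have \<tau>: "inj_on \<tau> ({..<n} - J)" "\<tau> ` ({..<n} - J) = {..<m} - J'"
    using gluedD(5)[OF g] by (auto simp: bij_betw_def)
  have 1: "?A' \<subseteq> {..<m}" using gluedD(3)[OF g] \<tau>(2) by auto
  have 2: "\<forall>t\<in>J'. t \<in> ?A' \<longleftrightarrow> e' t = 1" using \<tau>(2) by auto
  have 3: "\<tau> i \<in> ?A' \<longleftrightarrow> (i \<in> A) \<noteq> (\<epsilon> i = 1)" if "i \<in> {..<n} - J" for i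
  proof -
    have "\<tau> i \<notin> J'" using \<tau>(2) that by blast
    moreover have "\<tau> i \<in> \<tau> ` ?S \<longleftrightarrow> i \<in> ?S"
      by (rule inj_on_image_mem_iff[OF \<tau>(1) that]) auto
    ultimately show ?thesis using that unfolding Un_iff mem_Collect_eq by blast
  qed
  have "R (corner_of n A) (corner_of m ?A')"
    by (rule iffD2[OF glued_corners[OF g]], intro conjI ballI) (fact A, fact bspec[OF 2], fact 3)
  with 1 show ?thesis by (intro exI[of _ ?A'] conjI)
qed

text \<open>Weights agree in both cubes: fixed directions contribute the factor 1, and free directions
  are permuted and reflected.\<close>

lemma glued_weight:
  assumes g: "glued n m J e J' e' \<tau> \<epsilon> R" and xy: "x \<in> unit_cube n" "y \<in> unit_cube m" "R x y"
    and A: "R (corner_of n A) (corner_of m A')"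
  shows "weight n x A = weight m y A'"
proof -
  have x: "\<forall>i\<in>J. x i = e i" "\<forall>i\<in>J'. y i = e' i" "\<forall>i\<in>{..<n} - J. y (\<tau> i) = \<bar>x i - \<epsilon> i\<bar>"
    using gluedD(7)[OF g xy(1,2)] xy(3) by auto
  have c: "\<forall>i\<in>J. i \<in> A \<longleftrightarrow> e i = 1" "\<forall>t\<in>J'. t \<in> A' \<longleftrightarrow> e' t = 1"
     "\<forall>i\<in>{..<n} - J. \<tau> i \<in> A' \<longleftrightarrow> (i \<in> A) \<noteq> (\<epsilon> i = 1)"
    using A unfolding glued_corners[OF g] by auto
  have "weight n x A = (\<Prod>i\<in>{..<n} - J. if i \<in> A then x i else 1 - x i)"
    unfolding weight_def
    by (rule prod.mono_neutral_right) (use x c gluedD(1,2)[OF g] in \<open>force+\<close>)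
  also have "\<dots> = (\<Prod>i\<in>{..<n} - J. if \<tau> i \<in> A' then y (\<tau> i) else 1 - y (\<tau> i))"
  proof (rule prod.cong)
    fix i assume i: "i \<in> {..<n} - J"
    then have "0 \<le> x i \<and> x i \<le> 1" using unit_cube_bounds xy by auto
    moreover have "\<epsilon> i = 0 \<or> \<epsilon> i = 1" using gluedD(6)[OF g i] .
    moreover have "y (\<tau> i) = \<bar>x i - \<epsilon> i\<bar>" "\<tau> i \<in> A' \<longleftrightarrow> (i \<in> A) \<noteq> (\<epsilon> i = 1)" using x c i by auto
    ultimately show "(if i \<in> A then x i else 1 - x i) = (if \<tau> i \<in> A' then y (\<tau> i) else 1 - y (\<tau> i))"
      by auto
  qed simp
  also have "\<dots> = (\<Prod>t\<in>{..<m} - J'. if t \<in> A' then y t else 1 - y t)"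
    by (rule prod.reindex_bij_betw[OF gluedD(5)[OF g]])
  also have "\<dots> = weight m y A'"
    unfolding weight_def
    by (rule prod.mono_neutral_left) (use x c gluedD(3,4)[OF g] in \<open>force+\<close>)
  finally show ?thesis .
qed

lemma glued_weight_face:
  assumes g: "glued n m J e J' e' \<tau> \<epsilon> R" and xy: "x \<in> unit_cube n" "y \<in> unit_cube m" "R x y"
    and A: "weight n x A \<noteq> 0" "i \<in> J"
  shows "i \<in> A \<longleftrightarrow> e i = 1"
proof -
  have "x i = e i" using gluedD(7)[OF g xy(1,2)] xy(3) A(2) by auto
  moreover have "i < n" "e i = 0 \<or> e i = 1" using gluedD(1,2)[OF g] A(2) by auto
  ultimately show ?thesis using A(1) weight_nonzero by (metis zero_neq_one)
qed

lemma glued_toggle: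
  assumes g: "glued n m J e J' e' \<tau> \<epsilon> R" and AB: "A \<subseteq> {..<n}" "B \<subseteq> {..<n}" "A' \<subseteq> {..<m}" "B' \<subseteq> {..<m}"
    and R: "R (corner_of n A) (corner_of m A')" "R (corner_of n B) (corner_of m B')"
  shows "A' \<oplus> B' = \<tau> ` (A \<oplus> B)" "card (A' \<oplus> B') = card (A \<oplus> B)"
proof -
  have \<tau>: "inj_on \<tau> ({..<n} - J)" "\<tau> ` ({..<n} - J) = {..<m} - J'"
    using gluedD(5)[OF g] by (auto simp: bij_betw_def)
  note c = R[unfolded glued_corners[OF g]]
  have sub: "A \<oplus> B \<subseteq> {..<n} - J" using c AB by (auto simp: toggle_def)
  have "t \<in> A' \<oplus> B' \<longleftrightarrow> t \<in> \<tau> ` (A \<oplus> B)" for t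
  proof (cases "t \<in> {..<m} - J'")
    case True
    then obtain i where i: "i \<in> {..<n} - J" "t = \<tau> i" using \<tau>(2) by blast
    have "t \<in> \<tau> ` (A \<oplus> B) \<longleftrightarrow> i \<in> A \<oplus> B" using inj_on_image_mem_iff[OF \<tau>(1) i(1) sub] i(2) by simp
    then show ?thesis using c i by (auto simp: toggle_def)
  next
    case False
    then have "t \<notin> \<tau> ` (A \<oplus> B)" using sub \<tau>(2) by blast
    then show ?thesis using False c AB by (auto simp: toggle_def)
  qed
  then show "A' \<oplus> B' = \<tau> ` (A \<oplus> B)" by blast
  then show "card (A' \<oplus> B') = card (A \<oplus> B)"
    using card_image[OF inj_on_subset[OF \<tau>(1) sub]] by simp
qed

lemma cube_face_vertex:
  "cube_face n 0 F \<longleftrightarrow> (\<exists>A\<subseteq>{..<n}. F = {corner_of n A})"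
proof
  assume "cube_face n 0 F"
  then obtain J e where J: "J \<subseteq> {..<n}" "card J = n" "\<forall>i\<in>J. e i \<in> {0, 1}" "F = {x \<in> unit_cube n. \<forall>i\<in>J. x i = e i}"
    by (auto simp: cube_face_def)
  then have Jn: "J = {..<n}" by (simp add: card_subset_eq)
  let ?A = "{i \<in> {..<n}. e i = 1}"
  have "F = {corner_of n ?A}"
  proof
    show "F \<subseteq> {corner_of n ?A}"
    proof
      fix x assume "x \<in> F"
      then have "x = corner_of n ?A"
        using J(3,4) Jn by (intro unit_cube_eqI[of _ n]) (auto simp: corner_of_at)
      then show "x \<in> {corner_of n ?A}" by simp
    qed
    show "{corner_of n ?A} \<subseteq> F" using J(3,4) Jn by (auto simp: corner_of_at)
  qed
  then show "\<exists>A\<subseteq>{..<n}. F = {corner_of n A}" by (intro exI[of _ ?A]) auto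
next
  assume "\<exists>A\<subseteq>{..<n}. F = {corner_of n A}"
  then obtain A where A: "A \<subseteq> {..<n}" "F = {corner_of n A}" by blast
  have "F = {x \<in> unit_cube n. \<forall>i\<in>{..<n}. x i = corner_of n A i}"
    unfolding A(2) by (auto intro: unit_cube_eqI)
  moreover have "\<forall>i\<in>{..<n}. corner_of n A i \<in> {0, 1}" by (auto simp: corner_of_at)
  ultimately show "cube_face n 0 F" unfolding cube_face_def by (intro exI[of _ "{..<n}"] exI[of _ "corner_of n A"]) auto
qed

lemma cube_vertices_eq:
  assumes "cube_complex X"
  shows "cube_vertices X = {cmap X l (corner_of (cdim X l) A) | l A. l \<in> cindex X \<and> A \<subseteq> {..<cdim X l}}"
  unfolding cube_vertices_def is_cube_def cube_face_vertex by (auto; blast)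

lemma cube_complexD:
  assumes "cube_complex X"
  shows "topspace (cspace X) = (\<Union>l\<in>cindex X. cmap X l ` unit_cube (cdim X l))"
    "U \<subseteq> topspace (cspace X) \<Longrightarrow> openin (cspace X) U \<longleftrightarrow>
          (\<forall>l\<in>cindex X. openin (unit_cube_topology (cdim X l)) {x \<in> unit_cube (cdim X l). cmap X l x \<in> U})"
    "l \<in> cindex X \<Longrightarrow> inj_on (cmap X l) (unit_cube (cdim X l))"
    "connected_space (cspace X)"
  using assms unfolding cube_complex_def by (elim conjE; blast)+

text \<open>The vertices of the cube complex are encoded as numbers, by an arbitrary injection
  \<open>enc\<close>.\<close>

locale cube_space =
  fixes X :: "('a, 'i) cube_structure" and enc :: "'a \<Rightarrow> nat"
  assumes cc: "cube_complex X" and enc_inj: "inj_on enc (cube_vertices X)"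
begin

abbreviation "Ix \<equiv> cindex X"
abbreviation "dm \<equiv> cdim X"

definition vm :: "'i \<Rightarrow> nat set \<Rightarrow> nat" where
  "vm l A = enc (cmap X l (corner_of (dm l) A))"

lemma vertex_in: "l \<in> Ix \<Longrightarrow> A \<subseteq> {..<dm l} \<Longrightarrow> cmap X l (corner_of (dm l) A) \<in> cube_vertices X"
  unfolding cube_vertices_eq[OF cc] by blast

lemma vm_eq: 
  assumes "l \<in> Ix" "m \<in> Ix" "A \<subseteq> {..<dm l}" "B \<subseteq> {..<dm m}"
  shows "vm l A = vm m B \<longleftrightarrow> cmap X l (corner_of (dm l) A) = cmap X m (corner_of (dm m) B)"
  unfolding vm_def using inj_on_eq_iff[OF enc_inj vertex_in vertex_in] assms by blast

lemma glue:
  assumes "l \<in> Ix" "m \<in> Ix" "x \<in> unit_cube (dm l)" "y \<in> unit_cube (dm m)" "cmap X l x = cmap X m y"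
  obtains J e J' e' \<tau> \<epsilon> where "glued (dm l) (dm m) J e J' e' \<tau> \<epsilon> (\<lambda>x y. cmap X l x = cmap X m y)"
  using cube_complex_glued[OF cc assms] by (elim exE)

sublocale cubing Ix dm vm
proof
  fix l m A B A' B' C
  assume l: "l \<in> Ix"
  show "inj_on (vm l) (Pow {..<dm l})"
  proof (rule inj_onI)
    fix A B assume *: "A \<in> Pow {..<dm l}" "B \<in> Pow {..<dm l}" "vm l A = vm l B"
    then have "cmap X l (corner_of (dm l) A) = cmap X l (corner_of (dm l) B)" using vm_eq l by auto
    then have "corner_of (dm l) A = corner_of (dm l) B"
      using cube_complexD(3)[OF cc l] by (simp add: inj_on_eq_iff)
    then show "A = B" using corner_of_inj * by blast
  qed
  assume m: "m \<in> Ix" and sub: "A \<subseteq> {..<dm l}" "B \<subseteq> {..<dm l}" "A' \<subseteq> {..<dm m}" "B' \<subseteq> {..<dm m}"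
    and eq: "vm l A = vm m A'" "vm l B = vm m B'"
  have eq': "cmap X l (corner_of (dm l) A) = cmap X m (corner_of (dm m) A')"
    "cmap X l (corner_of (dm l) B) = cmap X m (corner_of (dm m) B')"
    using eq vm_eq l m sub by auto
  obtain J e J' e' \<tau> \<epsilon> where g: "glued (dm l) (dm m) J e J' e' \<tau> \<epsilon> (\<lambda>x y. cmap X l x = cmap X m y)"
    using glue[OF l m corner_of_cube corner_of_cube eq'(1)] .
  show "card (A \<oplus> B) = card (A' \<oplus> B')" using glued_toggle(2)[OF g sub eq'] by simp
  assume C: "A \<inter> B \<subseteq> C" "C \<subseteq> A \<union> B"
  note cA = bspec[OF conjunct1[OF iffD1[OF glued_corners[OF g] eq'(1)]]]
    and cB = bspec[OF conjunct1[OF iffD1[OF glued_corners[OF g] eq'(2)]]]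
  have "i \<in> C \<longleftrightarrow> e i = 1" if "i \<in> J" for i
    using cA[OF that] cB[OF that] C by auto
  then obtain C' where C': "C' \<subseteq> {..<dm m}" "cmap X l (corner_of (dm l) C) = cmap X m (corner_of (dm m) C')"
    using glued_partner[OF g, of C] by blast
  have "C \<subseteq> {..<dm l}" using sub C by blast
  then have "vm l C = vm m C'" using vm_eq[OF l m _ C'(1)] C'(2) by blast
  then show "\<exists>C'\<subseteq>{..<dm m}. vm l C = vm m C'" using C'(1) by blast
qed

text \<open>A point of a cube is mapped to the simplex spanned by all corners of the cube.\<close>

definition bary :: "'i \<Rightarrow> (nat \<Rightarrow> real) \<Rightarrow> nat \<Rightarrow>\<^sub>C real" where
  "bary l x = (\<Sum>A\<in>Pow {..<dm l}. weight (dm l) x A *\<^sub>R delta (vm l A))"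

lemma apply_sum: "apply_bcontfun (\<Sum>a\<in>S. f a) n = (\<Sum>a\<in>S. apply_bcontfun (f a) n)"
  by (induction S rule: infinite_finite_induct) auto

lemma apply_bary: "apply_bcontfun (bary l x) k = (\<Sum>A\<in>Pow {..<dm l}. if k = vm l A then weight (dm l) x A else 0)"
  unfolding bary_def apply_sum by (rule sum.cong) (auto simp: apply_delta)

lemma apply_bary_vm:
  assumes "l \<in> Ix" "A \<subseteq> {..<dm l}"
  shows "apply_bcontfun (bary l x) (vm l A) = weight (dm l) x A"
proof -
  have "apply_bcontfun (bary l x) (vm l A) = (\<Sum>B\<in>Pow {..<dm l}. if A = B then weight (dm l) x B else 0)"
    unfolding apply_bary by (rule sum.cong) (use vm_eq_iff assms in auto)
  then show ?thesis using assms by simp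
qed

lemma apply_bary_out: "k \<notin> cell l \<Longrightarrow> apply_bcontfun (bary l x) k = 0"
  unfolding apply_bary by (rule sum.neutral) (auto simp: cell_def)

lemma bary_in: 
  assumes "l \<in> Ix" "x \<in> unit_cube (dm l)"
  shows "bary l x \<in> bsimplex (cell l)"
  unfolding bsimplex_def
proof (intro CollectI conjI allI impI)
  show "0 \<le> apply_bcontfun (bary l x) n" for n
    unfolding apply_bary using weight_nonneg[OF assms(2)] by (intro sum_nonneg) auto
  show "apply_bcontfun (bary l x) n = 0" if "n \<notin> cell l" for n using apply_bary_out[OF that] .
  have "sum (apply_bcontfun (bary l x)) (cell l) = (\<Sum>A\<in>Pow {..<dm l}. apply_bcontfun (bary l x) (vm l A))"
    unfolding cell_def using vm_inj[OF assms(1)] by (rule sum.reindex_cong) auto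
  also have "\<dots> = 1" using sum_weight assms(1) by (simp add: apply_bary_vm)
  finally show "sum (apply_bcontfun (bary l x)) (cell l) = 1" .
qed

lemma bary_partner:
  assumes "l \<in> Ix" "m \<in> Ix" "x \<in> unit_cube (dm l)" "y \<in> unit_cube (dm m)" "cmap X l x = cmap X m y"
    and "apply_bcontfun (bary l x) k \<noteq> 0"
  shows "apply_bcontfun (bary m y) k = apply_bcontfun (bary l x) k"
proof -
  obtain J e J' e' \<tau> \<epsilon> where g: "glued (dm l) (dm m) J e J' e' \<tau> \<epsilon> (\<lambda>x y. cmap X l x = cmap X m y)"
    using glue[OF assms(1-5)] .
  have "k \<in> cell l" using apply_bary_out assms(6) by blast
  then obtain A where A: "A \<subseteq> {..<dm l}" "k = vm l A" by (auto simp: cell_def)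
  then have "weight (dm l) x A \<noteq> 0" using assms by (simp add: apply_bary_vm)
  then obtain A' where A': "A' \<subseteq> {..<dm m}" "cmap X l (corner_of (dm l) A) = cmap X m (corner_of (dm m) A')"
    using glued_partner[OF g, of A] glued_weight_face[OF g assms(3,4,5)] by blast
  have "weight (dm l) x A = weight (dm m) y A'" by (rule glued_weight[OF g assms(3,4,5) A'(2)])
  moreover have "k = vm m A'" using A A' vm_eq assms by auto
  ultimately show ?thesis
    using apply_bary_vm[OF assms(1) A(1), of x] apply_bary_vm[OF assms(2) A'(1), of y] A(2) by simp
qed

lemma bary_cong:
  assumes "l \<in> Ix" "m \<in> Ix" "x \<in> unit_cube (dm l)" "y \<in> unit_cube (dm m)" "cmap X l x = cmap X m y"
  shows "bary l x = bary m y"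
proof (rule bcontfun_eqI)
  fix k
  show "apply_bcontfun (bary l x) k = apply_bcontfun (bary m y) k"
    using bary_partner[OF assms] bary_partner[OF assms(2,1,4,3) assms(5)[symmetric]] by metis
qed

text \<open>The map from the cube complex to the polyhedron; by \<open>bary_cong\<close> the choice does not matter.\<close>

definition \<beta> :: "'a \<Rightarrow> nat \<Rightarrow>\<^sub>C real" where
  "\<beta> p = (SOME z. \<exists>l\<in>Ix. \<exists>x\<in>unit_cube (dm l). p = cmap X l x \<and> z = bary l x)"

lemma \<beta>_eq:
  assumes "l \<in> Ix" "x \<in> unit_cube (dm l)"
  shows "\<beta> (cmap X l x) = bary l x"
  unfolding \<beta>_def
proof (rule some_equality)
  show "\<exists>l'\<in>Ix. \<exists>x'\<in>unit_cube (dm l'). cmap X l x = cmap X l' x' \<and> bary l x = bary l' x'"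
    using assms by blast
  fix z assume "\<exists>l'\<in>Ix. \<exists>x'\<in>unit_cube (dm l'). cmap X l x = cmap X l' x' \<and> z = bary l' x'"
  then show "z = bary l x" using bary_cong[OF _ assms(1) _ assms(2)] by metis
qed

text \<open>Conversely, a point of this simplex is mapped to the average of the corners with the given
  weights.\<close>

definition avg :: "'i \<Rightarrow> (nat \<Rightarrow>\<^sub>C real) \<Rightarrow> nat \<Rightarrow> real" where
  "avg l z = (\<lambda>i\<in>{..<dm l}. \<Sum>A\<in>Pow {..<dm l}. apply_bcontfun z (vm l A) * corner_of (dm l) A i)"

lemma sum_cell:
  assumes "l \<in> Ix"
  shows "(\<Sum>A\<in>Pow {..<dm l}. f (vm l A)) = sum f (cell l)"
  unfolding cell_def using vm_inj[OF assms] by (simp add: sum.reindex)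

lemma avg_in:
  assumes "l \<in> Ix" "z \<in> bsimplex (cell l)"
  shows "avg l z \<in> unit_cube (dm l)"
proof -
  have "0 \<le> (\<Sum>A\<in>Pow {..<dm l}. apply_bcontfun z (vm l A) * corner_of (dm l) A i)" 
    "(\<Sum>A\<in>Pow {..<dm l}. apply_bcontfun z (vm l A) * corner_of (dm l) A i) \<le> 1" if i: "i < dm l" for i
  proof -
    show "0 \<le> (\<Sum>A\<in>Pow {..<dm l}. apply_bcontfun z (vm l A) * corner_of (dm l) A i)"
      using simplexD(1)[OF assms(2)] i by (intro sum_nonneg) (auto simp: corner_of_at)
    have "(\<Sum>A\<in>Pow {..<dm l}. apply_bcontfun z (vm l A) * corner_of (dm l) A i) \<le> 
        (\<Sum>A\<in>Pow {..<dm l}. apply_bcontfun z (vm l A))"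
      using simplexD(1)[OF assms(2)] i by (intro sum_mono) (auto simp: corner_of_at)
    then show "(\<Sum>A\<in>Pow {..<dm l}. apply_bcontfun z (vm l A) * corner_of (dm l) A i) \<le> 1"
      using sum_cell[OF assms(1), of "apply_bcontfun z"] simplexD(4)[OF assms(2)] by simp
  qed
  then show ?thesis by (auto simp: avg_def unit_cube_def)
qed

lemma avg_bary:
  assumes "l \<in> Ix" "x \<in> unit_cube (dm l)"
  shows "avg l (bary l x) = x"
proof (rule unit_cube_eqI[OF avg_in[OF assms(1) bary_in[OF assms]] assms(2)])
  fix i assume i: "i < dm l"
  have "avg l (bary l x) i = (\<Sum>A\<in>Pow {..<dm l}. weight (dm l) x A * corner_of (dm l) A i)"
    unfolding avg_def using i assms(1) by (simp add: apply_bary_vm)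
  then show "avg l (bary l x) i = x i" using sum_weight_coordinate[OF i] by simp
qed

lemma avg_coordinate:
  assumes l: "l \<in> Ix" and i: "i < dm l" and z: "z \<in> bsimplex (cell l)" 
    and f: "\<And>A. A \<subseteq> {..<dm l} \<Longrightarrow> apply_bcontfun z (vm l A) \<noteq> 0 \<Longrightarrow> f (vm l A) = corner_of (dm l) A i"
  shows "avg l z i = (\<Sum>k\<in>{k. apply_bcontfun z k \<noteq> 0}. apply_bcontfun z k * f k)"
proof -
  have "avg l z i = (\<Sum>A\<in>Pow {..<dm l}. apply_bcontfun z (vm l A) * f (vm l A))"
  proof -
    have "apply_bcontfun z (vm l A) * corner_of (dm l) A i = apply_bcontfun z (vm l A) * f (vm l A)"
      if "A \<in> Pow {..<dm l}" for A
      using f[of A] that by (cases "apply_bcontfun z (vm l A) = 0") auto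
    then have "(\<Sum>A\<in>Pow {..<dm l}. apply_bcontfun z (vm l A) * corner_of (dm l) A i) =
        (\<Sum>A\<in>Pow {..<dm l}. apply_bcontfun z (vm l A) * f (vm l A))"
      by (rule sum.cong[OF refl])
    then show ?thesis using i by (simp add: avg_def)
  qed
  also have "\<dots> = (\<Sum>k\<in>cell l. apply_bcontfun z k * f k)" using sum_cell[OF l] .
  also have "\<dots> = (\<Sum>k\<in>{k. apply_bcontfun z k \<noteq> 0}. apply_bcontfun z k * f k)"
    by (rule sum.mono_neutral_right) (use simplexD(2)[OF z] in \<open>auto simp: cell_def\<close>)
  finally show ?thesis .
qed

lemma sum_support:
  assumes "l \<in> Ix" "z \<in> bsimplex (cell l)"
  shows "(\<Sum>k\<in>{k. apply_bcontfun z k \<noteq> 0}. apply_bcontfun z k) = 1"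
proof -
  have "(\<Sum>k\<in>cell l. apply_bcontfun z k) = (\<Sum>k\<in>{k. apply_bcontfun z k \<noteq> 0}. apply_bcontfun z k)"
    by (rule sum.mono_neutral_right) (use simplexD(2)[OF assms(2)] in \<open>auto simp: cell_def\<close>)
  then show ?thesis using simplexD(4)[OF assms(2)] by simp
qed

text \<open>All corners of positive weight lie in the common face, and the identification of the two
  faces is affine.\<close>

lemma avg_cong:
  assumes l: "l \<in> Ix" "z \<in> bsimplex (cell l)" and m: "m \<in> Ix" "z \<in> bsimplex (cell m)"
  shows "cmap X l (avg l z) = cmap X m (avg m z)"
proof -
  obtain k0 where k0: "apply_bcontfun z k0 \<noteq> 0" using simplexD(3)[OF l(2)] by force
  have both: "\<exists>A A'. A \<subseteq> {..<dm l} \<and> A' \<subseteq> {..<dm m} \<and> k = vm l A \<and> k = vm m A' \<and>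
     cmap X l (corner_of (dm l) A) = cmap X m (corner_of (dm m) A')" if "apply_bcontfun z k \<noteq> 0" for k
  proof -
    have "k \<in> cell l" "k \<in> cell m" using simplexD(2)[OF l(2) that] simplexD(2)[OF m(2) that] by auto
    then obtain A A' where "A \<subseteq> {..<dm l}" "A' \<subseteq> {..<dm m}" "k = vm l A" "k = vm m A'" by (auto simp: cell_def)
    then show ?thesis using vm_eq l m by metis
  qed
  obtain A0 A0' where A0: "cmap X l (corner_of (dm l) A0) = cmap X m (corner_of (dm m) A0')" using both[OF k0] by blast
  obtain J e J' e' \<tau> \<epsilon> where g: "glued (dm l) (dm m) J e J' e' \<tau> \<epsilon> (\<lambda>x y. cmap X l x = cmap X m y)"
    using glue[OF l(1) m(1) corner_of_cube corner_of_cube A0] .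
  have pair: "A' \<subseteq> {..<dm m} \<Longrightarrow> A \<subseteq> {..<dm l} \<Longrightarrow> apply_bcontfun z (vm l A) \<noteq> 0 \<Longrightarrow> vm l A = vm m A' \<Longrightarrow>
     (\<forall>i\<in>J. i \<in> A \<longleftrightarrow> e i = 1) \<and> (\<forall>t\<in>J'. t \<in> A' \<longleftrightarrow> e' t = 1) \<and>
     (\<forall>i\<in>{..<dm l} - J. \<tau> i \<in> A' \<longleftrightarrow> (i \<in> A) \<noteq> (\<epsilon> i = 1))" for A A'
    by (rule iffD1[OF glued_corners[OF g]]) (use vm_eq l m in auto)
  let ?S = "{k. apply_bcontfun z k \<noteq> 0}"
  have one: "(\<Sum>k\<in>?S. apply_bcontfun z k) = 1" using sum_support[OF l] .
  have "avg l z i = e i" if i: "i \<in> J" for i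
  proof -
    have i': "e i = 0 \<or> e i = 1" "i < dm l" using gluedD(1,2)[OF g] i by auto
    have "avg l z i = (\<Sum>k\<in>?S. apply_bcontfun z k * e i)"
    proof (rule avg_coordinate[OF l(1) i'(2) l(2)])
      fix A assume A: "A \<subseteq> {..<dm l}" "apply_bcontfun z (vm l A) \<noteq> 0"
      then obtain A' where "A' \<subseteq> {..<dm m}" "vm l A = vm m A'" using both by metis
      then have "i \<in> A \<longleftrightarrow> e i = 1" using pair[of A' A] A i by simp
      then show "e i = corner_of (dm l) A i" using i' by (auto simp: corner_of_at)
    qed
    then show ?thesis using one by (simp flip: sum_distrib_right)
  qed
  moreover have "avg m z t = e' t" if t: "t \<in> J'" for t
  proof -
    have t': "e' t = 0 \<or> e' t = 1" "t < dm m" using gluedD(3,4)[OF g] t by auto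
    have "avg m z t = (\<Sum>k\<in>?S. apply_bcontfun z k * e' t)"
    proof (rule avg_coordinate[OF m(1) t'(2) m(2)])
      fix A' assume A': "A' \<subseteq> {..<dm m}" "apply_bcontfun z (vm m A') \<noteq> 0"
      then obtain A where "A \<subseteq> {..<dm l}" "vm l A = vm m A'" using both by metis
      then have "t \<in> A' \<longleftrightarrow> e' t = 1" using pair[OF A'(1)] A'(2) t by simp
      then show "e' t = corner_of (dm m) A' t" using t' by (auto simp: corner_of_at)
    qed
    then show ?thesis using one by (simp flip: sum_distrib_right)
  qed
  moreover have "avg m z (\<tau> i) = \<bar>avg l z i - \<epsilon> i\<bar>" if i: "i \<in> {..<dm l} - J" for i
  proof -
    have \<epsilon>: "\<epsilon> i = 0 \<or> \<epsilon> i = 1" using gluedD(6)[OF g i] .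
    have ti: "\<tau> i < dm m" using gluedD(5)[OF g] i by (auto simp: bij_betw_def)
    define f where "f k = corner_of (dm l) (inv_into (Pow {..<dm l}) (vm l) k) i" for k
    have f: "f (vm l A) = corner_of (dm l) A i" if "A \<subseteq> {..<dm l}" for A
      using that vm_inj[OF l(1)] by (simp add: f_def)
    have xl: "avg l z i = (\<Sum>k\<in>?S. apply_bcontfun z k * f k)"
      using i f by (intro avg_coordinate[OF l(1) _ l(2)]) auto
    have xm: "avg m z (\<tau> i) = (\<Sum>k\<in>?S. apply_bcontfun z k * (if \<epsilon> i = 1 then 1 - f k else f k))"
    proof (rule avg_coordinate[OF m(1) ti m(2)])
      fix A' assume A': "A' \<subseteq> {..<dm m}" "apply_bcontfun z (vm m A') \<noteq> 0"
      then obtain A where A: "A \<subseteq> {..<dm l}" "vm l A = vm m A'" using both by metis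
      then have "\<tau> i \<in> A' \<longleftrightarrow> (i \<in> A) \<noteq> (\<epsilon> i = 1)" using pair[OF A'(1)] A'(2) i by simp
      moreover have "f (vm m A') = (if i \<in> A then 1 else 0)" using f[OF A(1)] A(2) i by (simp add: corner_of_at)
      ultimately show "(if \<epsilon> i = 1 then 1 - f (vm m A') else f (vm m A')) = corner_of (dm m) A' (\<tau> i)"
        using ti by (auto simp: corner_of_at)
    qed
    have b: "0 \<le> avg l z i \<and> avg l z i \<le> 1" using unit_cube_bounds[OF avg_in[OF l]] i by simp
    show ?thesis
    proof (cases "\<epsilon> i = 1")
      case True
      then have "avg m z (\<tau> i) = 1 - avg l z i"
        unfolding xl xm by (simp add: right_diff_distrib sum_subtractf one)
      then show ?thesis using True b by simp
    next
      case False
      then show ?thesis using xl xm \<epsilon> b by simp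
    qed
  qed
  ultimately show ?thesis
    using gluedD(7)[OF g avg_in[OF l] avg_in[OF m]] by blast
qed

end

section \<open>The cube complex as a retract of the polyhedron\<close>

lemma topspace_unit_cube_topology: "topspace (unit_cube_topology n) = unit_cube n"
  by (simp add: unit_cube_topology_def unit_cube_def)

lemma corner_preimage:
  assumes g: "glued n m J e J' e' \<tau> \<epsilon> R" and x: "x \<in> unit_cube n" and R: "R x (corner_of m A')"
  shows "\<exists>A\<subseteq>{..<n}. x = corner_of n A"
proof -
  have c: "\<forall>i\<in>J. x i = e i" "\<forall>i\<in>{..<n} - J. corner_of m A' (\<tau> i) = \<bar>x i - \<epsilon> i\<bar>"
    using gluedD(7)[OF g x corner_of_cube] R by auto
  have "x i = 0 \<or> x i = 1" if i: "i < n" for i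
  proof (cases "i \<in> J")
    case True
    then show ?thesis using c(1) gluedD(2)[OF g True] by simp
  next
    case False
    then have i': "i \<in> {..<n} - J" using i by simp
    then have "\<tau> i < m" using gluedD(5)[OF g] by (auto simp: bij_betw_def)
    then have "\<bar>x i - \<epsilon> i\<bar> = 0 \<or> \<bar>x i - \<epsilon> i\<bar> = 1"
      using bspec[OF c(2) i'] by (auto simp: corner_of_at split: if_splits)
    then show ?thesis using gluedD(6)[OF g i'] unit_cube_bounds[OF x i] by auto
  qed
  then have "x = corner_of n {i \<in> {..<n}. x i = 1}"
    by (intro unit_cube_eqI[OF x]) (auto simp: corner_of_at)
  then show ?thesis by (intro exI[of _ "{i \<in> {..<n}. x i = 1}"]) auto
qed

text \<open>Each cube contains finitely many vertices, so every set of vertices is closed. Hence, for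
  each vertex, removing all the other vertices from the space leaves an open set. These sets
  cover the space, and each vertex lies in only one of them.\<close>

theorem finite_cube_vertices:
  assumes X: "cube_complex X" and cp: "compact_space (cspace X)"
  shows "finite (cube_vertices X)"
proof (cases "cube_vertices X = {}")
  case False
  let ?V = "cube_vertices X"
  have sub: "?V \<subseteq> topspace (cspace X)"
    unfolding cube_vertices_eq[OF X] cube_complexD(1)[OF X] by auto
  have op: "openin (cspace X) (topspace (cspace X) - S)" if S: "S \<subseteq> ?V" for S
  proof -
    have "openin (unit_cube_topology (cdim X l)) {x \<in> unit_cube (cdim X l). cmap X l x \<in> topspace (cspace X) - S}"
      if l: "l \<in> cindex X" for l
    proof -
      let ?P = "{x \<in> unit_cube (cdim X l). cmap X l x \<in> S}"
      have "?P \<subseteq> corner_of (cdim X l) ` Pow {..<cdim X l}"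
      proof
        fix x assume "x \<in> ?P"
        then have x: "x \<in> unit_cube (cdim X l)" "cmap X l x \<in> ?V" using S by auto
        then obtain m A where m: "m \<in> cindex X" "cmap X l x = cmap X m (corner_of (cdim X m) A)"
          unfolding cube_vertices_eq[OF X] by blast
        obtain J e J' e' \<tau> \<epsilon> where g: "glued (cdim X l) (cdim X m) J e J' e' \<tau> \<epsilon> (\<lambda>x y. cmap X l x = cmap X m y)"
          using cube_complex_glued[OF X l m(1) x(1) corner_of_cube m(2)] by (elim exE)
        from corner_preimage[OF g x(1) m(2)] show "x \<in> corner_of (cdim X l) ` Pow {..<cdim X l}" by blast
      qed
      then have "finite ?P" by (rule finite_subset) simp
      moreover have "Hausdorff_space (unit_cube_topology (cdim X l))"
        unfolding unit_cube_topology_def Hausdorff_space_product_topology by (simp add: Hausdorff_space_subtopology)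
      ultimately have "closedin (unit_cube_topology (cdim X l)) ?P"
        by (intro closedin_Hausdorff_finite) (auto simp: topspace_unit_cube_topology)
      then have "openin (unit_cube_topology (cdim X l)) (unit_cube (cdim X l) - ?P)"
        by (simp add: closedin_def topspace_unit_cube_topology)
      moreover have "unit_cube (cdim X l) - ?P = {x \<in> unit_cube (cdim X l). cmap X l x \<in> topspace (cspace X) - S}"
        using cube_complexD(1)[OF X] l by blast
      ultimately show ?thesis by simp
    qed
    then show ?thesis using cube_complexD(2)[OF X, of "topspace (cspace X) - S"] by blast
  qed
  let ?f = "\<lambda>v. topspace (cspace X) - (?V - {v})"
  have "topspace (cspace X) \<subseteq> \<Union>(?f ` ?V)" using False by blast
  moreover have "\<forall>U\<in>?f ` ?V. openin (cspace X) U" using op by blast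
  ultimately have "\<exists>\<F>. finite \<F> \<and> \<F> \<subseteq> ?f ` ?V \<and> topspace (cspace X) \<subseteq> \<Union>\<F>"
    using spec[OF iffD1[OF compact_space_alt cp], of "?f ` ?V"] by simp
  then obtain \<F> where \<F>: "finite \<F>" "\<F> \<subseteq> ?f ` ?V" "topspace (cspace X) \<subseteq> \<Union>\<F>" by blast
  obtain W where W: "W \<subseteq> ?V" "finite W" "\<F> = ?f ` W" using finite_subset_image[OF \<F>(1,2)] by blast
  have "?V \<subseteq> W"
  proof
    fix v assume v: "v \<in> ?V"
    then obtain w where "w \<in> W" "v \<in> ?f w" using sub \<F>(3) W(3) by blast
    then show "v \<in> W" using v by blast
  qed
  then show ?thesis using W(2) finite_subset by blast
qed simp

lemma continuous_coordinate:
  assumes "i < n"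
  shows "continuous_map (unit_cube_topology n) euclideanreal (\<lambda>x. x i)"
proof -
  have "continuous_map (unit_cube_topology n) (top_of_set {0..1}) (\<lambda>x. x i)"
    unfolding unit_cube_topology_def
    using continuous_map_product_projection[of i "{..<n}" "\<lambda>_. top_of_set {0..1::real}"] assms by simp
  then show ?thesis by (rule continuous_map_into_fulltopology)
qed

lemma continuous_weight: "continuous_map (unit_cube_topology n) euclideanreal (\<lambda>x. weight n x A)"
  unfolding weight_def
proof (rule continuous_map_prod)
  fix i assume "i \<in> {..<n}"
  then have "continuous_map (unit_cube_topology n) euclideanreal (\<lambda>x. x i)" by (intro continuous_coordinate) simp
  then show "continuous_map (unit_cube_topology n) euclideanreal (\<lambda>x. if i \<in> A then x i else 1 - x i)"
    by (cases "i \<in> A") (auto intro: continuous_map_diff)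
qed simp

lemma closed_bsimplex: "finite c \<Longrightarrow> closed (bsimplex c)"
proof -
  assume "finite c"
  have ap: "continuous_on UNIV (\<lambda>z. apply_bcontfun z (n::nat) :: real)" for n
    by (intro continuous_apply_bcontfun continuous_on_id)
  have "bsimplex c = (\<Inter>n. {z. 0 \<le> apply_bcontfun z n}) \<inter> (\<Inter>n\<in>-c. {z. apply_bcontfun z n = 0}) \<inter>
     {z. (\<Sum>n\<in>c. apply_bcontfun z n) = 1}"
    by (auto simp: bsimplex_def)
  moreover have "closed {z :: nat \<Rightarrow>\<^sub>C real. 0 \<le> apply_bcontfun z n}" "closed {z :: nat \<Rightarrow>\<^sub>C real. apply_bcontfun z n = 0}" for n
    by (intro closed_Collect_le closed_Collect_eq ap continuous_on_const)+
  moreover have "closed {z :: nat \<Rightarrow>\<^sub>C real. (\<Sum>n\<in>c. apply_bcontfun z n) = 1}"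
    by (intro closed_Collect_eq continuous_on_sum ap continuous_on_const)
  ultimately show ?thesis by (simp only:) (intro closed_Int closed_INT ballI; simp)
qed

context cube_space
begin

lemma continuous_cmap: "l \<in> Ix \<Longrightarrow> continuous_map (unit_cube_topology (dm l)) (cspace X) (cmap X l)"
  unfolding continuous_map_def topspace_unit_cube_topology
proof (intro conjI allI impI)
  assume l: "l \<in> Ix"
  show "cmap X l \<in> unit_cube (dm l) \<rightarrow> topspace (cspace X)"
    using l cube_complexD(1)[OF cc] by auto
  fix U assume "openin (cspace X) U"
  moreover from this have "U \<subseteq> topspace (cspace X)" by (rule openin_subset)
  ultimately show "openin (unit_cube_topology (dm l)) {x \<in> unit_cube (dm l). cmap X l x \<in> U}"
    using cube_complexD(2)[OF cc] l by blast
qed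

lemma continuous_bary: "continuous_map (unit_cube_topology (dm l)) euclidean (bary l)"
  unfolding bary_def
proof (rule continuous_map_sum)
  fix A
  have "continuous_map euclideanreal euclidean (\<lambda>t. t *\<^sub>R delta (vm l A))"
    by (simp add: continuous_on_scaleR continuous_on_id)
  then show "continuous_map (unit_cube_topology (dm l)) euclidean (\<lambda>x. weight (dm l) x A *\<^sub>R delta (vm l A))"
    using continuous_map_compose[OF continuous_weight[of "dm l" A], of euclidean "\<lambda>t. t *\<^sub>R delta (vm l A)"]
    by (simp add: o_def)
qed simp

lemma \<beta>_in: "p \<in> topspace (cspace X) \<Longrightarrow> \<exists>l\<in>Ix. p \<in> cmap X l ` unit_cube (dm l) \<and> \<beta> p \<in> bsimplex (cell l)"
  using cube_complexD(1)[OF cc] \<beta>_eq bary_in by fastforce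

lemma continuous_\<beta>: "continuous_map (cspace X) (top_of_set (polyhedron cells)) \<beta>"
  unfolding continuous_map_in_subtopology
proof
  show "\<beta> \<in> topspace (cspace X) \<rightarrow> polyhedron cells"
    using \<beta>_in by (auto simp: polyhedron_def cells_def)
  show "continuous_map (cspace X) euclidean \<beta>"
    unfolding continuous_map_def
  proof (intro conjI allI impI)
    fix U :: "(nat \<Rightarrow>\<^sub>C real) set" assume U: "openin euclidean U"
    have "openin (unit_cube_topology (dm l)) {x \<in> unit_cube (dm l). cmap X l x \<in> {p \<in> topspace (cspace X). \<beta> p \<in> U}}"
      if l: "l \<in> Ix" for l
    proof -
      have "{x \<in> unit_cube (dm l). cmap X l x \<in> {p \<in> topspace (cspace X). \<beta> p \<in> U}} = 
          {x \<in> topspace (unit_cube_topology (dm l)). bary l x \<in> U}"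
      proof -
        have "cmap X l x \<in> topspace (cspace X)" if "x \<in> unit_cube (dm l)" for x
          using that l cube_complexD(1)[OF cc] by blast
        then show ?thesis using \<beta>_eq[OF l] by (auto simp: topspace_unit_cube_topology)
      qed
      then show ?thesis using continuous_bary[of l] U unfolding continuous_map_def by simp
    qed
    then show "openin (cspace X) {p \<in> topspace (cspace X). \<beta> p \<in> U}"
      using cube_complexD(2)[OF cc, of "{p \<in> topspace (cspace X). \<beta> p \<in> U}"] by blast
  qed simp
qed

definition \<rho> :: "(nat \<Rightarrow>\<^sub>C real) \<Rightarrow> 'a" where
  "\<rho> z = (let l = (SOME l. l \<in> Ix \<and> z \<in> bsimplex (cell l)) in cmap X l (avg l z))"

lemma \<rho>_eq:
  assumes "l \<in> Ix" "z \<in> bsimplex (cell l)"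
  shows "\<rho> z = cmap X l (avg l z)"
proof -
  define m where "m = (SOME l. l \<in> Ix \<and> z \<in> bsimplex (cell l))"
  have "m \<in> Ix \<and> z \<in> bsimplex (cell m)"
    unfolding m_def by (rule someI[of _ l]) (use assms in simp)
  then show ?thesis using avg_cong[of m z l] assms by (simp add: \<rho>_def Let_def m_def)
qed

lemma \<rho>_\<beta>: 
  assumes "p \<in> topspace (cspace X)"
  shows "\<rho> (\<beta> p) = p"
proof -
  obtain l x where "l \<in> Ix" "x \<in> unit_cube (dm l)" "p = cmap X l x"
    using assms cube_complexD(1)[OF cc] by blast
  then show ?thesis using \<rho>_eq[of l "\<beta> p"] by (simp add: \<beta>_eq bary_in avg_bary)
qed

text \<open>A point of the polyhedron and its image under \<open>\<beta> \<circ> \<rho>\<close> lie in a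
  common simplex; therefore this map is homotopic to the identity along segments.\<close>

lemma \<beta>_\<rho>:
  assumes "l \<in> Ix" "z \<in> bsimplex (cell l)"
  shows "\<beta> (\<rho> z) \<in> bsimplex (cell l)"
  using assms by (simp add: \<rho>_eq \<beta>_eq avg_in bary_in)

lemma continuous_avg:
  assumes "l \<in> Ix"
  shows "continuous_map (top_of_set (bsimplex (cell l))) (unit_cube_topology (dm l)) (avg l)"
  unfolding unit_cube_topology_def continuous_map_componentwise
proof (intro conjI ballI)
  show "avg l ` topspace (top_of_set (bsimplex (cell l))) \<subseteq> extensional {..<dm l}"
    by (auto simp: avg_def)
  fix i assume i: "i \<in> {..<dm l}"
  show "continuous_map (top_of_set (bsimplex (cell l))) (top_of_set {0..1}) (\<lambda>z. avg l z i)"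
    unfolding continuous_map_in_subtopology
  proof
    show "(\<lambda>z. avg l z i) \<in> topspace (top_of_set (bsimplex (cell l))) \<rightarrow> {0..1}"
      using avg_in[OF assms] unit_cube_bounds i by fastforce
    have "continuous_on (bsimplex (cell l)) (\<lambda>z. \<Sum>A\<in>Pow {..<dm l}. apply_bcontfun z (vm l A) * corner_of (dm l) A i)"
      by (intro continuous_on_sum continuous_on_mult continuous_apply_bcontfun continuous_on_id continuous_on_const)
    then show "continuous_map (top_of_set (bsimplex (cell l))) euclideanreal (\<lambda>z. avg l z i)"
      using i by (simp add: avg_def)
  qed
qed

text \<open>The polyhedron is a finite union of closed simplices, on each of which the map is an average
  in one cube.\<close>

lemma continuous_\<rho>:
  assumes "finite (cube_vertices X)"
  shows "continuous_map (top_of_set (polyhedron cells)) (cspace X) \<rho>"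
  unfolding continuous_map_closedin
proof (intro conjI allI impI)
  have finc: "finite cells"
  proof (rule finite_subset)
    show "cells \<subseteq> Pow (enc ` cube_vertices X)"
    proof
      fix c assume "c \<in> cells"
      then obtain l where l: "l \<in> Ix" "c = cell l" by (auto simp: cells_def)
      have "c = vm l ` Pow {..<dm l}" unfolding l(2) cell_def ..
      moreover have "vm l A \<in> enc ` cube_vertices X" if "A \<subseteq> {..<dm l}" for A
        unfolding vm_def using vertex_in[OF l(1) that] by simp
      ultimately show "c \<in> Pow (enc ` cube_vertices X)" by auto
    qed
  qed (use assms in simp)
  show "\<rho> \<in> topspace (top_of_set (polyhedron cells)) \<rightarrow> topspace (cspace X)"
  proof
    fix z assume "z \<in> topspace (top_of_set (polyhedron cells))"
    then obtain l where l: "l \<in> Ix" "z \<in> bsimplex (cell l)" by (auto simp: polyhedron_def cells_def)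
    then show "\<rho> z \<in> topspace (cspace X)" 
      using \<rho>_eq[OF l] avg_in[OF l] cube_complexD(1)[OF cc] by auto
  qed
  fix C assume C: "closedin (cspace X) C"
  have "closed {z \<in> bsimplex c. \<rho> z \<in> C}" if c: "c \<in> cells" for c
  proof -
    obtain l where l: "l \<in> Ix" "c = cell l" using c by (auto simp: cells_def)
    have "continuous_map (top_of_set (bsimplex (cell l))) (cspace X) (cmap X l \<circ> avg l)"
      by (rule continuous_map_compose[OF continuous_avg[OF l(1)] continuous_cmap[OF l(1)]])
    then have "closedin (top_of_set (bsimplex (cell l))) {z \<in> bsimplex (cell l). (cmap X l \<circ> avg l) z \<in> C}"
      using C unfolding continuous_map_closedin by simp
    moreover have "closed (bsimplex (cell l))" by (rule closed_bsimplex) (simp add: cell_def)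
    ultimately have "closed {z \<in> bsimplex (cell l). (cmap X l \<circ> avg l) z \<in> C}" by (rule closedin_closed_trans)
    moreover have "{z \<in> bsimplex (cell l). (cmap X l \<circ> avg l) z \<in> C} = {z \<in> bsimplex c. \<rho> z \<in> C}"
      using \<rho>_eq[OF l(1)] l(2) by auto
    ultimately show ?thesis by simp
  qed
  then have "closed (\<Union>c\<in>cells. {z \<in> bsimplex c. \<rho> z \<in> C})" using finc by (intro closed_UN) auto
  moreover have "(\<Union>c\<in>cells. {z \<in> bsimplex c. \<rho> z \<in> C}) = {z \<in> polyhedron cells. \<rho> z \<in> C}"
    by (auto simp: polyhedron_def)
  ultimately show "closedin (top_of_set (polyhedron cells)) {z \<in> topspace (top_of_set (polyhedron cells)). \<rho> z \<in> C}"
    by (simp add: closed_subset)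
qed

end

section \<open>Vertex links\<close>

text \<open>Removing the open star of a simplex \<open>W\<close> leaves the points whose support is
  disjoint from \<open>W\<close>. The vertices in such a support are adjacent, so a connected
  component \<open>C\<close> of the graph outside of \<open>W\<close> would separate the space
  into the points with some weight in \<open>C\<close> and those with some weight outside of
  \<open>C\<close>.\<close>

lemma link_graph_connected:
  fixes A :: "'b set set"
  assumes fin: "\<And>s. s \<in> A \<Longrightarrow> finite s" and down: "\<And>s t. s \<in> A \<Longrightarrow> t \<subseteq> s \<Longrightarrow> t \<noteq> {} \<Longrightarrow> t \<in> A"
    and conn: "connectedin (simplicial_realization A)
         (topspace (simplicial_realization A) - open_star A (faces_of_simplex W))"
    and ab: "{a} \<in> A" "a \<notin> W" "{b} \<in> A" "b \<notin> W"
  shows "(\<lambda>u w. u \<notin> W \<and> w \<notin> W \<and> (\<exists>s\<in>A. u \<in> s \<and> w \<in> s))\<^sup>*\<^sup>* a b"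
proof (rule ccontr)
  assume nb: "\<not> (\<lambda>u w. u \<notin> W \<and> w \<notin> W \<and> (\<exists>s\<in>A. u \<in> s \<and> w \<in> s))\<^sup>*\<^sup>* a b"
  let ?R = "\<lambda>u w. u \<notin> W \<and> w \<notin> W \<and> (\<exists>s\<in>A. u \<in> s \<and> w \<in> s)"
  let ?T = "simplicial_realization A"
  define C where "C = {c. ?R\<^sup>*\<^sup>* a c}"
  \<comment> \<open>The points with some weight in \<open>P\<close>.\<close>
  define U where "U P = {f \<in> topspace ?T. \<exists>c\<in>P. f c \<noteq> 0}" for P :: "'b set"
  define Y where "Y = topspace ?T - open_star A (faces_of_simplex W)"
  have top: "topspace ?T = (\<Union>s\<in>A. closed_simplex s)" by (rule topspace_simplicial_realization)
  have open_U: "openin ?T (U P)" for P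
    unfolding openin_simplicial_realization
  proof (intro conjI ballI)
    show "U P \<subseteq> (\<Union>s\<in>A. closed_simplex s)" by (auto simp: U_def top)
    fix s assume s: "s \<in> A"
    have "open {f :: 'b \<Rightarrow> real. f c \<noteq> 0}" for c
      by (intro open_Collect_neq continuous_on_const) simp
    then have "open (\<Union>c\<in>P. {f :: 'b \<Rightarrow> real. f c \<noteq> 0})" by blast
    then have "openin (top_of_set (closed_simplex s)) (closed_simplex s \<inter> (\<Union>c\<in>P. {f. f c \<noteq> 0}))"
      by (rule openin_open_Int)
    moreover have "closed_simplex s \<inter> (\<Union>c\<in>P. {f. f c \<noteq> 0}) = U P \<inter> closed_simplex s"
      using s by (auto simp: U_def top)
    ultimately show "openin (top_of_set (closed_simplex s)) (U P \<inter> closed_simplex s)" by simp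
  qed
  have support: "\<exists>t\<in>A. t \<inter> W = {} \<and> t \<noteq> {} \<and> (\<forall>c. f c \<noteq> 0 \<longleftrightarrow> c \<in> t)" if f: "f \<in> Y" for f
  proof -
    obtain s where s: "s \<in> A" "f \<in> closed_simplex s" using f by (auto simp: Y_def top)
    define t where "t = {c. f c \<noteq> 0}"
    have ts: "t \<subseteq> s" using s(2) by (auto simp: t_def closed_simplex_def)
    have sum: "sum f t = 1"
    proof -
      have "sum f s = sum f t" by (rule sum.mono_neutral_right) (use fin[OF s(1)] ts in \<open>auto simp: t_def\<close>)
      then show ?thesis using s(2) by (simp add: closed_simplex_def)
    qed
    then have "t \<noteq> {}" by auto
    then have tA: "t \<in> A" using down[OF s(1) ts] by blast
    have "f \<in> open_simplex t"
      using s(2) ts sum by (auto simp: open_simplex_def closed_simplex_def t_def order_less_le)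
    moreover have "f \<notin> open_star A (faces_of_simplex W)" using f by (simp add: Y_def)
    ultimately have "t \<inter> W = {}" using tA unfolding open_star_def faces_of_simplex_def by blast
    then show ?thesis using tA sum t_def by (intro bexI[of _ t]) auto
  qed
  have 1: "Y \<subseteq> U C \<union> U (- C)"
  proof
    fix f assume f: "f \<in> Y"
    then obtain c where "f c \<noteq> 0" using support by blast
    then show "f \<in> U C \<union> U (- C)" using f by (auto simp: U_def Y_def)
  qed
  have 2: "U C \<inter> U (- C) \<inter> Y = {}"
  proof (rule ccontr)
    assume "U C \<inter> U (- C) \<inter> Y \<noteq> {}"
    then obtain f where f: "f \<in> U C" "f \<in> U (- C)" "f \<in> Y" by blast
    then obtain c d where cd: "c \<in> C" "f c \<noteq> 0" "d \<notin> C" "f d \<noteq> 0" by (auto simp: U_def)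
    obtain t where t: "t \<in> A" "t \<inter> W = {}" "\<And>c. f c \<noteq> 0 \<longleftrightarrow> c \<in> t" using support[OF f(3)] by blast
    have "?R c d" using t cd by blast
    then have "d \<in> C" using cd(1) unfolding C_def by (simp add: rtranclp.rtrancl_into_rtrancl)
    then show False using cd by simp
  qed
  have vertex: "(\<lambda>c. if c = v then 1 else 0) \<in> Y" if v: "{v} \<in> A" "v \<notin> W" for v
  proof -
    let ?f = "\<lambda>c. if c = v then 1 else 0 :: real"
    have "?f \<in> topspace ?T" using v unfolding top closed_simplex_def by force
    moreover have "?f \<notin> open_star A (faces_of_simplex W)"
    proof
      assume "?f \<in> open_star A (faces_of_simplex W)"
      then obtain s t where st: "s \<in> A" "t \<noteq> {}" "t \<subseteq> W" "t \<subseteq> s" "?f \<in> open_simplex s"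
        by (auto simp: open_star_def faces_of_simplex_def)
      then have "\<forall>c\<in>s. 0 < ?f c" by (simp add: open_simplex_def)
      then have "c = v" if "c \<in> s" for c using that by (cases "c = v") auto
      then show False using st v by blast
    qed
    ultimately show ?thesis by (simp add: Y_def)
  qed
  have "U C \<inter> Y \<noteq> {}"
  proof -
    have "a \<in> C" by (simp add: C_def)
    then show ?thesis using vertex[OF ab(1,2)] unfolding U_def Y_def by force
  qed
  moreover have "U (- C) \<inter> Y \<noteq> {}"
  proof -
    have "b \<in> - C" using nb by (simp add: C_def)
    then show ?thesis using vertex[OF ab(3,4)] unfolding U_def Y_def by force
  qed
  ultimately have "\<not> connectedin ?T Y"
    using open_U[of C] open_U[of "- C"] 1 2 unfolding connectedin by blast
  then show False using conn by (simp add: Y_def)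
qed

text \<open>Otherwise, a corner of nonzero weight could be changed in direction \<open>i\<close> into
  one of the wrong kind, and its weight would still be nonzero.\<close>

lemma weight_support_coordinate:
  assumes "i < n" "e i = 0 \<or> e i = (1::real)"
    and A: "\<And>A. A \<subseteq> {..<n} \<Longrightarrow> weight n y A \<noteq> 0 \<Longrightarrow> i \<in> A \<longleftrightarrow> e i = 1"
  shows "y i = e i"
proof (rule ccontr)
  assume ne: "y i \<noteq> e i"
  obtain B where B: "B \<subseteq> {..<n}" "weight n y B \<noteq> 0"
    using sum_weight[of n y] by (metis Pow_iff sum.neutral zero_neq_one)
  have w: "(j \<in> B \<longrightarrow> y j \<noteq> 0) \<and> (j \<notin> B \<longrightarrow> y j \<noteq> 1)" if "j < n" for j
    using B(2) that unfolding weight_nonzero by blast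
  show False
  proof (cases "e i = 1")
    case True
    have "weight n y (B - {i}) \<noteq> 0" unfolding weight_nonzero using w True ne by auto
    then show False using A[of "B - {i}"] B True by auto
  next
    case False
    have "weight n y (insert i B) \<noteq> 0" unfolding weight_nonzero using w False ne assms(2) by auto
    then show False using A[of "insert i B"] B False assms(1) by auto
  qed
qed

context cube_space
begin

text \<open>The points all of whose weight is on vertices in \<open>S\<close>. If \<open>S\<close> is
  the vertex set of a face of a cube, this is the face; so faces are determined by their
  vertices.\<close>

definition cube_hull :: "nat set \<Rightarrow> 'a set" where
  "cube_hull S = {p \<in> topspace (cspace X). \<forall>k. apply_bcontfun (\<beta> p) k \<noteq> 0 \<longrightarrow> k \<in> S}"

definition face_codes :: "'i \<Rightarrow> nat set \<Rightarrow> (nat \<Rightarrow> real) \<Rightarrow> nat set" where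
  "face_codes l J e = {vm l A | A. A \<subseteq> {..<dm l} \<and> (\<forall>i\<in>J. i \<in> A \<longleftrightarrow> e i = 1)}"

lemma face_codes_iff:
  "l \<in> Ix \<Longrightarrow> A \<subseteq> {..<dm l} \<Longrightarrow> vm l A \<in> face_codes l J e \<longleftrightarrow> (\<forall>i\<in>J. i \<in> A \<longleftrightarrow> e i = 1)"
  unfolding face_codes_def using vm_eq_iff by blast

lemma \<beta>_support:
  assumes "l \<in> Ix" "x \<in> unit_cube (dm l)" "apply_bcontfun (\<beta> (cmap X l x)) k \<noteq> 0"
  shows "\<exists>A\<subseteq>{..<dm l}. k = vm l A \<and> weight (dm l) x A \<noteq> 0"
proof -
  have b: "apply_bcontfun (bary l x) k \<noteq> 0" using assms \<beta>_eq by simp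
  then have "k \<in> cell l" using apply_bary_out by blast
  then obtain A where "A \<subseteq> {..<dm l}" "k = vm l A" by (auto simp: cell_def)
  then show ?thesis using b apply_bary_vm[OF assms(1)] by auto
qed

text \<open>The inclusion of the hull in the face is the point where cubes interact. If \<open>p\<close>
  lies in some other cube, all corners of nonzero weight of \<open>p\<close> are common to
  both cubes, so \<open>p\<close> lies in the common face and can be moved to the first cube.\<close>

theorem face_hull:
  assumes l: "l \<in> Ix" and J: "J \<subseteq> {..<dm l}" "\<And>i. i \<in> J \<Longrightarrow> e i = 0 \<or> e i = 1"
  shows "cmap X l ` face (dm l) J e = cube_hull (face_codes l J e)"
proof
  show "cmap X l ` face (dm l) J e \<subseteq> cube_hull (face_codes l J e)"
  proof
    fix p assume "p \<in> cmap X l ` face (dm l) J e"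
    then obtain x where x: "p = cmap X l x" "x \<in> unit_cube (dm l)" "\<And>i. i \<in> J \<Longrightarrow> x i = e i"
      by (auto simp: face_def)
    have "k \<in> face_codes l J e" if k: "apply_bcontfun (\<beta> p) k \<noteq> 0" for k
    proof -
      obtain A where A: "A \<subseteq> {..<dm l}" "k = vm l A" "weight (dm l) x A \<noteq> 0"
        using \<beta>_support[OF l x(2)] k x(1) by blast
      have "i \<in> A \<longleftrightarrow> e i = 1" if "i \<in> J" for i
      proof -
        have "i < dm l" using J(1) that by auto
        then have "(i \<in> A \<longrightarrow> x i \<noteq> 0) \<and> (i \<notin> A \<longrightarrow> x i \<noteq> 1)" using A(3) unfolding weight_nonzero by blast
        then show ?thesis using J(2)[OF that] x(3)[OF that] by auto
      qed
      then show ?thesis using A face_codes_iff[OF l A(1)] by simp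
    qed
    then show "p \<in> cube_hull (face_codes l J e)" using x l cube_complexD(1)[OF cc] by (auto simp: cube_hull_def)
  qed
  show "cube_hull (face_codes l J e) \<subseteq> cmap X l ` face (dm l) J e"
  proof
    fix p assume p: "p \<in> cube_hull (face_codes l J e)"
    then obtain m y where m: "m \<in> Ix" "y \<in> unit_cube (dm m)" "p = cmap X m y"
      using cube_complexD(1)[OF cc] by (auto simp: cube_hull_def)
    have supp: "\<exists>A\<subseteq>{..<dm l}. vm l A = vm m A' \<and> (\<forall>i\<in>J. i \<in> A \<longleftrightarrow> e i = 1)" 
      if A': "A' \<subseteq> {..<dm m}" "weight (dm m) y A' \<noteq> 0" for A'
    proof -
      have "apply_bcontfun (\<beta> p) (vm m A') \<noteq> 0" using A' m \<beta>_eq apply_bary_vm by simp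
      then have "vm m A' \<in> face_codes l J e" using p by (auto simp: cube_hull_def)
      then show ?thesis by (auto simp: face_codes_def)
    qed
    obtain A0' where A0': "A0' \<subseteq> {..<dm m}" "weight (dm m) y A0' \<noteq> 0"
      using sum_weight[of "dm m" y] by (metis Pow_iff sum.neutral zero_neq_one)
    then obtain A0 where "A0 \<subseteq> {..<dm l}" "vm l A0 = vm m A0'" using supp by blast
    then have "cmap X l (corner_of (dm l) A0) = cmap X m (corner_of (dm m) A0')" using vm_eq l m A0' by auto
    from glue[OF l m(1) corner_of_cube corner_of_cube this]
    obtain K e1 K' e' \<tau> \<epsilon> where g: "glued (dm l) (dm m) K e1 K' e' \<tau> \<epsilon> (\<lambda>x y. cmap X l x = cmap X m y)" .
    have y: "y t = e' t" if t: "t \<in> K'" for t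
    proof (rule weight_support_coordinate)
      show "t < dm m" "e' t = 0 \<or> e' t = 1" using gluedD(3,4)[OF g] t by auto
      fix A' assume A': "A' \<subseteq> {..<dm m}" "weight (dm m) y A' \<noteq> 0"
      obtain A where "A \<subseteq> {..<dm l}" "vm l A = vm m A'" using supp[OF A'] by blast
      then have "cmap X l (corner_of (dm l) A) = cmap X m (corner_of (dm m) A')" using vm_eq l m A' by auto
      from iffD1[OF glued_corners[OF g] this] show "t \<in> A' \<longleftrightarrow> e' t = 1" using t by blast
    qed
    \<comment> \<open>The map between the faces is a signed permutation of the free coordinates; reflections are their own inverses.\<close>
    define x where "x = (\<lambda>i\<in>{..<dm l}. if i \<in> K then e1 i else \<bar>y (\<tau> i) - \<epsilon> i\<bar>)"
    have yb: "0 \<le> y (\<tau> i) \<and> y (\<tau> i) \<le> 1" "\<epsilon> i = 0 \<or> \<epsilon> i = 1" if "i \<in> {..<dm l} - K" for i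
      using gluedD(5,6)[OF g] that unit_cube_bounds[OF m(2)] by (auto simp: bij_betw_def)
    have xc: "x \<in> unit_cube (dm l)"
    proof -
      have "0 \<le> x i \<and> x i \<le> 1" if "i < dm l" for i
        using gluedD(2)[OF g, of i] yb[of i] that by (cases "i \<in> K") (auto simp: x_def)
      then show ?thesis by (auto simp: unit_cube_def x_def)
    qed
    have "cmap X l x = cmap X m y"
    proof (rule iffD2[OF gluedD(7)[OF g xc m(2)]], intro conjI ballI)
      show "x i = e1 i" if "i \<in> K" for i using gluedD(1)[OF g] that by (auto simp: x_def)
      show "y t = e' t" if "t \<in> K'" for t using y[OF that] .
      show "y (\<tau> i) = \<bar>x i - \<epsilon> i\<bar>" if "i \<in> {..<dm l} - K" for i
        using yb[OF that] that by (auto simp: x_def)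
    qed
    then have px: "p = cmap X l x" using m by simp
    have "x i = e i" if i: "i \<in> J" for i
    proof (rule weight_support_coordinate)
      show "i < dm l" "e i = 0 \<or> e i = 1" using J i by auto
      fix A assume A: "A \<subseteq> {..<dm l}" "weight (dm l) x A \<noteq> 0"
      then have "apply_bcontfun (\<beta> p) (vm l A) \<noteq> 0" using px l xc \<beta>_eq apply_bary_vm by simp
      then have "vm l A \<in> face_codes l J e" using p by (auto simp: cube_hull_def)
      then show "i \<in> A \<longleftrightarrow> e i = 1" using face_codes_iff[OF l A(1)] i by blast
    qed
    then show "p \<in> cmap X l ` face (dm l) J e" using px xc by (auto simp: face_def)
  qed
qed

lemma is_cube_hull:
  "is_cube X k c \<longleftrightarrow> (\<exists>l\<in>Ix. \<exists>J e. J \<subseteq> {..<dm l} \<and> card J + k = dm l \<and> (\<forall>i\<in>J. e i \<in> {0, 1}) \<and>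
     c = cube_hull (face_codes l J e))" (is "?L \<longleftrightarrow> ?R")
proof
  assume ?L
  then obtain l F where l: "l \<in> Ix" "cube_face (dm l) k F" "c = cmap X l ` F" by (auto simp: is_cube_def)
  then obtain J e where J: "J \<subseteq> {..<dm l}" "card J + k = dm l" "\<forall>i\<in>J. e i \<in> {0, 1}" "F = face (dm l) J e"
    by (auto simp: cube_face_def face_def)
  then have "c = cube_hull (face_codes l J e)" using face_hull[OF l(1) J(1), of e] l(3) by auto
  then show ?R using J l by blast
next
  assume ?R
  then obtain l J e where J: "l \<in> Ix" "J \<subseteq> {..<dm l}" "card J + k = dm l" "\<forall>i\<in>J. e i \<in> {0, 1}" 
    "c = cube_hull (face_codes l J e)" by blast
  then have "c = cmap X l ` face (dm l) J e" using face_hull[OF J(1,2), of e] by auto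
  moreover have "cube_face (dm l) k (face (dm l) J e)" using J by (auto simp: cube_face_def face_def)
  ultimately show ?L using J(1) by (auto simp: is_cube_def)
qed

definition codes :: "nat set" where
  "codes = enc ` cube_vertices X"

lemma vm_codes: "l \<in> Ix \<Longrightarrow> A \<subseteq> {..<dm l} \<Longrightarrow> vm l A \<in> codes"
  using vertex_in by (auto simp: codes_def vm_def)

lemma vertex_hull:
  assumes "x \<in> cube_vertices X"
  shows "x \<in> cube_hull S \<longleftrightarrow> enc x \<in> S"
proof -
  obtain l A where l: "l \<in> Ix" "A \<subseteq> {..<dm l}" "x = cmap X l (corner_of (dm l) A)"
    using assms unfolding cube_vertices_eq[OF cc] by blast
  have "apply_bcontfun (\<beta> x) k \<noteq> 0 \<longleftrightarrow> k = enc x" for k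
  proof
    assume "apply_bcontfun (\<beta> x) k \<noteq> 0"
    then obtain B where B: "B \<subseteq> {..<dm l}" "k = vm l B" "weight (dm l) (corner_of (dm l) A) B \<noteq> 0"
      using \<beta>_support[OF l(1) corner_of_cube] l(3) by blast
    have "i \<in> A \<longleftrightarrow> i \<in> B" if "i < dm l" for i
      using B(3) that unfolding weight_nonzero by (auto simp: corner_of_at split: if_splits)
    then have "B = A" using B(1) l(2) by blast
    then show "k = enc x" using B l by (simp add: vm_def)
  next
    assume "k = enc x"
    then have "k = vm l A" using l by (simp add: vm_def)
    moreover have "weight (dm l) (corner_of (dm l) A) A \<noteq> 0" unfolding weight_nonzero by (simp add: corner_of_at)
    ultimately show "apply_bcontfun (\<beta> x) k \<noteq> 0"
      using l \<beta>_eq[OF l(1) corner_of_cube] apply_bary_vm[OF l(1,2)] by simp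
  qed
  moreover have "x \<in> topspace (cspace X)" using l cube_complexD(1)[OF cc] corner_of_cube by blast
  ultimately show ?thesis by (auto simp: cube_hull_def)
qed

lemma cube_hull_mono_iff:
  assumes "S \<subseteq> codes"
  shows "cube_hull S \<subseteq> cube_hull T \<longleftrightarrow> S \<subseteq> T"
proof
  assume sub: "cube_hull S \<subseteq> cube_hull T"
  show "S \<subseteq> T"
  proof
    fix k assume k: "k \<in> S"
    then obtain x where x: "x \<in> cube_vertices X" "k = enc x" using assms by (auto simp: codes_def)
    then have "x \<in> cube_hull S" using vertex_hull k by simp
    then show "k \<in> T" using sub vertex_hull x by blast
  qed
qed (auto simp: cube_hull_def)

lemma edge_codes:
  assumes "l \<in> Ix" "A \<subseteq> {..<dm l}" "i < dm l" "\<And>j. j \<in> {..<dm l} - {i} \<Longrightarrow> j \<in> A \<longleftrightarrow> e j = 1"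
  shows "face_codes l ({..<dm l} - {i}) e = {vm l A, vm l (A \<oplus> {i})}"
proof -
  have "B = A \<or> B = A \<oplus> {i}" if "B \<subseteq> {..<dm l}" "\<forall>j\<in>{..<dm l} - {i}. j \<in> B \<longleftrightarrow> e j = 1" for B
  proof -
    have ag: "j \<in> B \<longleftrightarrow> j \<in> A" if "j \<noteq> i" for j using that assms(2,4) \<open>B \<subseteq> _\<close> \<open>\<forall>j\<in>_. _\<close> by blast
    show ?thesis
    proof (cases "i \<in> B \<longleftrightarrow> i \<in> A")
      case True
      then have "j \<in> B \<longleftrightarrow> j \<in> A" for j using ag[of j] by (cases "j = i") auto
      then have "B = A" by blast
      then show ?thesis ..
    next
      case False
      then have "j \<in> B \<longleftrightarrow> j \<in> A \<oplus> {i}" for j using ag[of j] by (cases "j = i") (auto simp: toggle_def)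
      then have "B = A \<oplus> {i}" by blast
      then show ?thesis ..
    qed
  qed
  moreover have "A \<oplus> {i} \<subseteq> {..<dm l}" "\<forall>j\<in>{..<dm l} - {i}. j \<in> A \<oplus> {i} \<longleftrightarrow> e j = 1"
    using assms by (auto simp: toggle_def)
  ultimately show ?thesis using assms unfolding face_codes_def by blast
qed

lemma is_edge: "is_cube X 1 E \<longleftrightarrow> (\<exists>u v. adj u v \<and> E = cube_hull {u, v})" (is "?L \<longleftrightarrow> ?R")
proof
  assume ?L
  then obtain l J e where l: "l \<in> Ix" "J \<subseteq> {..<dm l}" "card J + 1 = dm l" "\<forall>i\<in>J. e i \<in> {0, 1}" 
    "E = cube_hull (face_codes l J e)" unfolding is_cube_hull by blast
  have "card ({..<dm l} - J) = 1" using l by (simp add: card_Diff_subset finite_subset)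
  then obtain i where "{..<dm l} - J = {i}" by (rule card_1_singletonE)
  then have i: "i < dm l" "J = {..<dm l} - {i}" using l(2) by auto
  let ?A = "{j \<in> {..<dm l} - {i}. e j = 1}"
  have "face_codes l J e = {vm l ?A, vm l (?A \<oplus> {i})}"
    unfolding i(2) by (rule edge_codes) (use l i in auto)
  moreover have "adj (vm l ?A) (vm l (?A \<oplus> {i}))"
    unfolding adj_def using l(1) i(1) by (intro bexI[of _ l] exI[of _ ?A] exI[of _ i]) auto
  ultimately show ?R using l(5)
    by (intro exI[of _ "vm l ?A"] exI[of _ "vm l (?A \<oplus> {i})"] conjI) simp_all
next
  assume ?R
  then obtain l A i where l: "l \<in> Ix" "A \<subseteq> {..<dm l}" "i < dm l" "E = cube_hull {vm l A, vm l (A \<oplus> {i})}"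
    unfolding adj_def by blast
  have "face_codes l ({..<dm l} - {i}) (corner_of (dm l) A) = {vm l A, vm l (A \<oplus> {i})}"
    by (rule edge_codes) (use l in \<open>auto simp: corner_of_at\<close>)
  moreover have "card ({..<dm l} - {i}) + 1 = dm l" using l(3) by (simp add: card_Diff_singleton)
  ultimately show ?L unfolding is_cube_hull using l
    by (intro bexI[of _ l] exI[of _ "{..<dm l} - {i}"] exI[of _ "corner_of (dm l) A"]) (auto simp: corner_of_at)
qed

lemma adj_codes: "adj u v \<Longrightarrow> u \<in> codes \<and> v \<in> codes \<and> u \<noteq> v"
proof -
  assume "adj u v"
  then obtain l A i where l: "l \<in> Ix" "A \<subseteq> {..<dm l}" "i < dm l" "u = vm l A" "v = vm l (A \<oplus> {i})"
    unfolding adj_def by blast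
  then have A: "A \<oplus> {i} \<subseteq> {..<dm l}" by (auto simp: toggle_def)
  then have "u \<noteq> v" using vm_eq_iff[OF l(1,2) A] l by simp
  then show ?thesis using vm_codes l A by simp
qed

lemma corner_edges:
  assumes x: "x \<in> cube_vertices X" and l: "l \<in> Ix" "A \<subseteq> {..<dm l}" "vm l A = enc x"
    and J: "J \<subseteq> {..<dm l}" "\<And>i. i \<in> J \<Longrightarrow> i \<in> A \<longleftrightarrow> e i = 1"
  shows "{E. is_cube X 1 E \<and> x \<in> E \<and> E \<subseteq> cube_hull (face_codes l J e)} =
     (\<lambda>i. cube_hull {enc x, vm l (A \<oplus> {i})}) ` ({..<dm l} - J)"
proof
  have fc: "vm l B \<in> face_codes l J e \<longleftrightarrow> (\<forall>i\<in>J. i \<in> B \<longleftrightarrow> i \<in> A)" if "B \<subseteq> {..<dm l}" for B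
    using face_codes_iff[OF l(1) that] J(2) by auto
  show "{E. is_cube X 1 E \<and> x \<in> E \<and> E \<subseteq> cube_hull (face_codes l J e)} \<subseteq>
     (\<lambda>i. cube_hull {enc x, vm l (A \<oplus> {i})}) ` ({..<dm l} - J)"
  proof
    fix E assume "E \<in> {E. is_cube X 1 E \<and> x \<in> E \<and> E \<subseteq> cube_hull (face_codes l J e)}"
    then have E: "is_cube X 1 E" "x \<in> E" "E \<subseteq> cube_hull (face_codes l J e)" by auto
    obtain a b where ab: "adj a b" "E = cube_hull {a, b}" using E(1) unfolding is_edge by blast
    then have "enc x = a \<or> enc x = b" using vertex_hull[OF x] E(2) by auto
    then have "\<exists>v. adj (enc x) v \<and> E = cube_hull {enc x, v}"
    proof
      assume "enc x = a"
      then show ?thesis using ab by (intro exI[of _ b]) simp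
    next
      assume "enc x = b"
      then show ?thesis using ab adj_sym[OF ab(1)] by (intro exI[of _ a]) (simp add: insert_commute)
    qed
    then obtain v where v: "adj (enc x) v" "E = cube_hull {enc x, v}" by blast
    have "{enc x, v} \<subseteq> face_codes l J e"
      using E(3) v adj_codes[OF v(1)] cube_hull_mono_iff[of "{enc x, v}"] by simp
    then obtain B where B: "B \<subseteq> {..<dm l}" "v = vm l B" "vm l B \<in> face_codes l J e" by (auto simp: face_codes_def)
    obtain m A' i' where m: "m \<in> Ix" "A' \<subseteq> {..<dm m}" "i' < dm m" "enc x = vm m A'" "v = vm m (A' \<oplus> {i'})"
      using v(1) unfolding adj_def by blast
    have "A' \<oplus> {i'} \<subseteq> {..<dm m}" using m by (auto simp: toggle_def)
    then have "card (A \<oplus> B) = card (A' \<oplus> (A' \<oplus> {i'}))"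
      using vm_dist[OF l(1) m(1) l(2) B(1) m(2)] l m B by simp
    then obtain i where i: "B = A \<oplus> {i}" using card_toggle_1[of A B] by auto
    have "i < dm l"
    proof -
      have "A \<oplus> B = {i}" unfolding i by simp
      then show ?thesis using toggle_subset[OF l(2) B(1)] by auto
    qed
    moreover have "i \<notin> J"
    proof
      assume "i \<in> J"
      then have "i \<in> B \<longleftrightarrow> i \<in> A" using fc[OF B(1)] B(3) by blast
      then show False unfolding i by (auto simp: toggle_def)
    qed
    ultimately show "E \<in> (\<lambda>i. cube_hull {enc x, vm l (A \<oplus> {i})}) ` ({..<dm l} - J)" using v B i by auto
  qed
  show "(\<lambda>i. cube_hull {enc x, vm l (A \<oplus> {i})}) ` ({..<dm l} - J) \<subseteq> 
     {E. is_cube X 1 E \<and> x \<in> E \<and> E \<subseteq> cube_hull (face_codes l J e)}"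
  proof
    fix E assume "E \<in> (\<lambda>i. cube_hull {enc x, vm l (A \<oplus> {i})}) ` ({..<dm l} - J)"
    then obtain i where i: "i < dm l" "i \<notin> J" "E = cube_hull {enc x, vm l (A \<oplus> {i})}" by auto
    have Ai: "A \<oplus> {i} \<subseteq> {..<dm l}" using l i by (auto simp: toggle_def)
    have a: "adj (enc x) (vm l (A \<oplus> {i}))" unfolding adj_def using l i
      by (intro bexI[of _ l] exI[of _ A] exI[of _ i] conjI) simp_all
    have "vm l (A \<oplus> {i}) \<in> face_codes l J e" unfolding fc[OF Ai] using i(2) by (auto simp: toggle_def)
    moreover have "enc x \<in> face_codes l J e" using fc[OF l(2)] l(3) by simp
    ultimately have "E \<subseteq> cube_hull (face_codes l J e)"
      unfolding i(3) using cube_hull_mono_iff[of "{enc x, vm l (A \<oplus> {i})}"] adj_codes[OF a] by simp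
    moreover have "x \<in> E" unfolding i(3) vertex_hull[OF x] by simp
    ultimately show "E \<in> {E. is_cube X 1 E \<and> x \<in> E \<and> E \<subseteq> cube_hull (face_codes l J e)}"
      using a i(3) is_edge by auto
  qed
qed

text \<open>The simplices of the link at \<open>x\<close> are the sets of directions \<open>D\<close> at
  a corner \<open>A\<close> equal to \<open>x\<close> of some cube, an edge being the hull of
  \<open>x\<close> and the neighbour of \<open>x\<close>.\<close>

theorem vertex_link_iff:
  assumes x: "x \<in> cube_vertices X"
  shows "s \<in> vertex_link X x \<longleftrightarrow> (\<exists>l\<in>Ix. \<exists>A\<subseteq>{..<dm l}. \<exists>D\<subseteq>{..<dm l}. vm l A = enc x \<and> D \<noteq> {} \<and>
     s = (\<lambda>i. cube_hull {enc x, vm l (A \<oplus> {i})}) ` D)" (is "?L \<longleftrightarrow> ?R")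
proof
  assume ?L
  then obtain k c where c: "s \<noteq> {}" "is_cube X k c" "x \<in> c" "s = {E. is_cube X 1 E \<and> x \<in> E \<and> E \<subseteq> c}"
    by (auto simp: vertex_link_def)
  then obtain l J e where l: "l \<in> Ix" "J \<subseteq> {..<dm l}" "c = cube_hull (face_codes l J e)" unfolding is_cube_hull by blast
  have "enc x \<in> face_codes l J e" using c(3) l(3) vertex_hull[OF x] by simp
  then obtain A where A: "A \<subseteq> {..<dm l}" "vm l A = enc x" "\<forall>i\<in>J. i \<in> A \<longleftrightarrow> e i = 1" by (auto simp: face_codes_def)
  have "s = (\<lambda>i. cube_hull {enc x, vm l (A \<oplus> {i})}) ` ({..<dm l} - J)"
    unfolding c(4) l(3) by (rule corner_edges[OF x l(1) A(1,2) l(2)]) (use A in auto)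
  moreover from this have "{..<dm l} - J \<noteq> {}" using c(1) by blast
  ultimately show ?R using l(1) A(1,2) 
    by (intro bexI[of _ l] exI[of _ A] exI[of _ "{..<dm l} - J"] conjI) simp_all
next
  assume ?R
  then obtain l A D where l: "l \<in> Ix" "A \<subseteq> {..<dm l}" "D \<subseteq> {..<dm l}" "vm l A = enc x" "D \<noteq> {}"
    "s = (\<lambda>i. cube_hull {enc x, vm l (A \<oplus> {i})}) ` D" by blast
  let ?J = "{..<dm l} - D" and ?e = "corner_of (dm l) A"
  let ?c = "cube_hull (face_codes l ?J ?e)"
  have e: "i \<in> A \<longleftrightarrow> ?e i = 1" if "i \<in> ?J" for i using that by (auto simp: corner_of_at)
  have "{E. is_cube X 1 E \<and> x \<in> E \<and> E \<subseteq> ?c} = (\<lambda>i. cube_hull {enc x, vm l (A \<oplus> {i})}) ` ({..<dm l} - ?J)"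
    by (rule corner_edges[OF x l(1,2,4) _ e]) auto
  moreover have "{..<dm l} - ?J = D" using l(3) by auto
  ultimately have s: "s = {E. is_cube X 1 E \<and> x \<in> E \<and> E \<subseteq> ?c}" using l(6) by simp
  have "card ?J + card D = dm l" using l(3) card_mono[OF _ l(3)] by (simp add: card_Diff_subset finite_subset)
  then have "is_cube X (card D) ?c" unfolding is_cube_hull using l(1) 
    by (intro bexI[of _ l] exI[of _ ?J] exI[of _ ?e]) (auto simp: corner_of_at)
  moreover have "x \<in> ?c" unfolding vertex_hull[OF x] using face_codes_iff[OF l(1,2), of ?J ?e] l(4) e by auto
  ultimately show ?L using s l(5,6) unfolding vertex_link_def by blast
qed

end

section \<open>One-endedness of the fundamental group\<close>

locale npc_space = cube_space +
  assumes npc: "nonpositively_curved X"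
    and link_connected_space: "x \<in> cube_vertices X \<Longrightarrow> connected_space (simplicial_realization (vertex_link X x))"
    and no_cut_simplex: "x \<in> cube_vertices X \<Longrightarrow> \<not> cut_simplex (vertex_link X x) s"
    and finite_cube_vertices: "finite (cube_vertices X)"
begin

lemma adj_vertex:
  assumes "adj v w"
  obtains x where "x \<in> cube_vertices X" "enc x = v"
  using adj_codes[OF assms] by (auto simp: codes_def)

lemma edge_eq_iff:
  assumes "adj v a" "adj v b"
  shows "cube_hull {v, a} = cube_hull {v, b} \<longleftrightarrow> a = b"
proof
  assume "cube_hull {v, a} = cube_hull {v, b}"
  then have "{v, a} \<subseteq> {v, b}" using cube_hull_mono_iff[of "{v, a}" "{v, b}"] adj_codes[OF assms(1)] by simp
  then show "a = b" using adj_codes[OF assms(1)] by auto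
qed simp

lemma link_pair:
  assumes x: "x \<in> cube_vertices X" and cd: "sq (enc x) c q d"
  shows "{cube_hull {enc x, c}, cube_hull {enc x, d}} \<in> vertex_link X x"
proof -
  obtain l A i j where l: "l \<in> Ix" "A \<subseteq> {..<dm l}" "i < dm l" "j < dm l" "enc x = vm l A" 
    "c = vm l (A \<oplus> {i})" "d = vm l (A \<oplus> {j})" using cd unfolding sq_def by blast
  show ?thesis unfolding vertex_link_iff[OF x]
    by (rule bexI[of _ l], rule exI[of _ A], rule conjI, fact, rule exI[of _ "{i, j}"])
      (use l in auto)
qed

lemma link_vertex:
  assumes x: "x \<in> cube_vertices X" and c: "adj (enc x) c"
  shows "{cube_hull {enc x, c}} \<in> vertex_link X x"
proof -
  obtain l A i where l: "l \<in> Ix" "A \<subseteq> {..<dm l}" "i < dm l" "enc x = vm l A" "c = vm l (A \<oplus> {i})" 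
    using c unfolding adj_def by blast
  show ?thesis unfolding vertex_link_iff[OF x]
    by (rule bexI[of _ l], rule exI[of _ A], rule conjI, fact, rule exI[of _ "{i}"])
      (use l in auto)
qed

lemma clique_in_link:
  assumes x: "x \<in> cube_vertices X" and D: "finite D" "D \<noteq> {}" "D \<subseteq> {w. adj (enc x) w}"
    and sqs: "\<And>c d. c \<in> D \<Longrightarrow> d \<in> D \<Longrightarrow> c \<noteq> d \<Longrightarrow> \<exists>q. sq (enc x) c q d"
  shows "(\<lambda>d. cube_hull {enc x, d}) ` D \<in> vertex_link X x"
proof -
  have "flag_complex (vertex_link X x)" using npc x by (simp add: nonpositively_curved_def)
  moreover have "{a, b} \<in> vertex_link X x" if ab: "a \<in> (\<lambda>d. cube_hull {enc x, d}) ` D" "b \<in> (\<lambda>d. cube_hull {enc x, d}) ` D" for a b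
  proof -
    obtain c d where cd: "c \<in> D" "d \<in> D" "a = cube_hull {enc x, c}" "b = cube_hull {enc x, d}" using ab by blast
    show ?thesis
    proof (cases "c = d")
      case True
      then show ?thesis using cd link_vertex[OF x, of d] D(3) by auto
    next
      case False
      then obtain q where "sq (enc x) c q d" using sqs cd by blast
      then show ?thesis using link_pair[OF x] cd by simp
    qed
  qed
  moreover have "finite ((\<lambda>d. cube_hull {enc x, d}) ` D)" "(\<lambda>d. cube_hull {enc x, d}) ` D \<noteq> {}" using D by auto
  ultimately show ?thesis unfolding flag_complex_def by blast
qed

lemma link_closed:
  assumes x: "x \<in> cube_vertices X" and s: "s \<in> vertex_link X x"
  shows "finite s" "t \<subseteq> s \<Longrightarrow> t \<noteq> {} \<Longrightarrow> t \<in> vertex_link X x"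
proof -
  obtain l A D where l: "l \<in> Ix" "A \<subseteq> {..<dm l}" "D \<subseteq> {..<dm l}" "vm l A = enc x" "D \<noteq> {}"
    "s = (\<lambda>i. cube_hull {enc x, vm l (A \<oplus> {i})}) ` D" using s unfolding vertex_link_iff[OF x] by blast
  show "finite s" using l(3,6) finite_subset by blast
  assume t: "t \<subseteq> s" "t \<noteq> {}"
  obtain D' where D': "D' \<subseteq> D" "t = (\<lambda>i. cube_hull {enc x, vm l (A \<oplus> {i})}) ` D'" using t(1) l(6) by (meson subset_imageE)
  show "t \<in> vertex_link X x" unfolding vertex_link_iff[OF x]
    by (rule bexI[of _ l], rule exI[of _ A], rule conjI, fact, rule exI[of _ D'])
      (use l D' t in auto)
qed

lemma link_simplex_square:
  assumes x: "x \<in> cube_vertices X" and s: "s \<in> vertex_link X x" and e: "e \<in> s"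
  shows "\<exists>d. adj (enc x) d \<and> e = cube_hull {enc x, d} \<and>
     (\<forall>c. adj (enc x) c \<and> cube_hull {enc x, c} \<in> s \<and> c \<noteq> d \<longrightarrow> (\<exists>q. sq (enc x) c q d))"
proof -
  obtain l A D where l: "l \<in> Ix" "A \<subseteq> {..<dm l}" "D \<subseteq> {..<dm l}" "vm l A = enc x"
    "s = (\<lambda>i. cube_hull {enc x, vm l (A \<oplus> {i})}) ` D" using s unfolding vertex_link_iff[OF x] by blast
  have adj: "adj (enc x) (vm l (A \<oplus> {i}))" if "i \<in> D" for i
    unfolding adj_def using l(1-4) that by (intro bexI[of _ l] exI[of _ A] exI[of _ i] conjI) auto
  obtain j where j: "j \<in> D" "e = cube_hull {enc x, vm l (A \<oplus> {j})}" using e l(5) by blast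
  have "\<exists>q. sq (enc x) c q (vm l (A \<oplus> {j}))" 
    if c: "adj (enc x) c" "cube_hull {enc x, c} \<in> s" "c \<noteq> vm l (A \<oplus> {j})" for c
  proof -
    obtain i where i: "i \<in> D" "cube_hull {enc x, c} = cube_hull {enc x, vm l (A \<oplus> {i})}" using c(2) l(5) by blast
    then have ci: "c = vm l (A \<oplus> {i})" using edge_eq_iff[OF c(1) adj[OF i(1)]] by simp
    then have "i \<noteq> j" using c(3) by auto
    then have "sq (vm l A) (vm l (A \<oplus> {i})) (vm l (A \<oplus> {i, j})) (vm l (A \<oplus> {j}))"
      using l i j by (intro sqI[where i = i and j = j]) auto
    then show ?thesis using ci l(4) by auto
  qed
  then show ?thesis using adj[OF j(1)] j(2) by blast
qed

lemma vertices_finite: "finite (\<Union>cells)"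
proof (rule finite_subset)
  show "\<Union>cells \<subseteq> codes" 
    unfolding cells_def cell_def using vm_codes by auto
  show "finite codes" using finite_cube_vertices by (simp add: codes_def)
qed

text \<open>Either \<open>D\<close> is empty and the whole link is connected, or \<open>D\<close> is a
  simplex of the link by the flag condition, and it is not a cut simplex.\<close>

lemma links_connected:
  assumes D: "D \<subseteq> {w. adj v w}" and sqs: "\<And>c d. c \<in> D \<Longrightarrow> d \<in> D \<Longrightarrow> c \<noteq> d \<Longrightarrow> \<exists>q. sq v c q d"
    and a: "adj v a" "a \<notin> D" and b: "adj v b" "b \<notin> D"
  shows "(\<lambda>c d. c \<notin> D \<and> d \<notin> D \<and> (\<exists>q. sq v c q d))\<^sup>*\<^sup>* a b"
proof -
  obtain x where x: "x \<in> cube_vertices X" "enc x = v" using adj_vertex[OF a(1)] .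
  let ?L = "vertex_link X x" and ?e = "\<lambda>d. cube_hull {v, d}"
  let ?W = "?e ` D"
  have "finite D"
  proof (rule finite_subset[OF D])
    show "finite {w. adj v w}"
      by (rule finite_subset[OF _ finite_imageI[OF finite_cube_vertices, of enc]])
        (use adj_codes in \<open>auto simp: codes_def\<close>)
  qed
  have conn: "connectedin (simplicial_realization ?L)
         (topspace (simplicial_realization ?L) - open_star ?L (faces_of_simplex ?W))"
  proof (cases "D = {}")
    case True
    have "faces_of_simplex ?W = {}" unfolding True faces_of_simplex_def by auto
    then have "open_star ?L (faces_of_simplex ?W) = {}" by (simp add: open_star_def)
    then show ?thesis using link_connected_space[OF x(1)] by (simp add: connectedin_topspace)
  next
    case False
    then have "?W \<in> ?L" using clique_in_link[OF x(1) \<open>finite D\<close>] D sqs x(2) by simp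
    then show ?thesis using no_cut_simplex[OF x(1), of ?W] by (simp add: cut_simplex_def)
  qed
  have out: "?e c \<notin> ?W" if "adj v c" "c \<notin> D" for c
    using that D edge_eq_iff[OF that(1)] by auto
  have sing: "{?e c} \<in> ?L" if "adj v c" for c using link_vertex[OF x(1), of c] x(2) that by simp
  have "(\<lambda>u w. u \<notin> ?W \<and> w \<notin> ?W \<and> (\<exists>s\<in>?L. u \<in> s \<and> w \<in> s))\<^sup>*\<^sup>* (?e a) (?e b)"
    by (rule link_graph_connected[OF link_closed(1)[OF x(1)] link_closed(2)[OF x(1)] conn
        sing[OF a(1)] out[OF a] sing[OF b(1)] out[OF b]])
  then have "\<exists>c. adj v c \<and> c \<notin> D \<and> ?e b = ?e c \<and> (\<lambda>c d. c \<notin> D \<and> d \<notin> D \<and> (\<exists>q. sq v c q d))\<^sup>*\<^sup>* a c"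
  proof (induction)
    case base
    then show ?case using a by blast
  next
    case (step y e)
    then obtain c where c: "adj v c" "c \<notin> D" "y = ?e c" 
      "(\<lambda>c d. c \<notin> D \<and> d \<notin> D \<and> (\<exists>q. sq v c q d))\<^sup>*\<^sup>* a c" by blast
    obtain s where s: "s \<in> ?L" "y \<in> s" "e \<in> s" "e \<notin> ?W" using step(2) by blast
    obtain d where d: "adj v d" "e = ?e d" 
      "\<And>c. adj v c \<Longrightarrow> ?e c \<in> s \<Longrightarrow> c \<noteq> d \<Longrightarrow> \<exists>q. sq v c q d"
      using link_simplex_square[OF x(1) s(1,3)] x(2) by blast
    have dD: "d \<notin> D" using s(4) d(2) by blast
    show ?case
    proof (cases "c = d")
      case True
      then show ?thesis using c d by blast
    next
      case False
      then have "\<exists>q. sq v c q d" using d(3)[OF c(1)] s(2) c(3) by simp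
      then have "(\<lambda>c d. c \<notin> D \<and> d \<notin> D \<and> (\<exists>q. sq v c q d))\<^sup>*\<^sup>* a d"
        using c(2,4) dD by (simp add: rtranclp.rtrancl_into_rtrancl)
      then show ?thesis using d dD by blast
    qed
  qed
  then show ?thesis using edge_eq_iff[OF b(1)] by blast
qed

sublocale flag_cubing Ix dm vm
proof
  show "finite (\<Union>cells)" by (rule vertices_finite)
  show "(\<lambda>c d. c \<notin> D \<and> d \<notin> D \<and> (\<exists>q. sq v c q d))\<^sup>*\<^sup>* a b"
    if "D \<subseteq> {w. adj v w}" "\<And>c d. c \<in> D \<Longrightarrow> d \<in> D \<Longrightarrow> c \<noteq> d \<Longrightarrow> \<exists>q. sq v c q d"
      "adj v a" "adj v b" "a \<notin> D" "b \<notin> D" for v D a b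
    using links_connected[OF that(1,2,3,5,4,6)] .
  fix D v assume D: "finite D" "D \<noteq> {}" "D \<subseteq> {w. adj v w}"
    and sqs: "\<And>c d. c \<in> D \<Longrightarrow> d \<in> D \<Longrightarrow> c \<noteq> d \<Longrightarrow> \<exists>q. sq v c q d"
  obtain w where "adj v w" using D by blast
  then obtain x where x: "x \<in> cube_vertices X" "enc x = v" using adj_vertex by blast
  have "(\<lambda>d. cube_hull {enc x, d}) ` D \<in> vertex_link X x"
    using clique_in_link[OF x(1) D(1,2)] D(3) sqs x(2) by simp
  then obtain l A E where l: "l \<in> Ix" "A \<subseteq> {..<dm l}" "E \<subseteq> {..<dm l}" "vm l A = v"
    "(\<lambda>d. cube_hull {v, d}) ` D = (\<lambda>i. cube_hull {v, vm l (A \<oplus> {i})}) ` E"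
    unfolding vertex_link_iff[OF x(1)] x(2) by blast
  have "\<exists>i<dm l. b = vm l (A \<oplus> {i})" if b: "b \<in> D" for b
  proof -
    have "cube_hull {v, b} \<in> (\<lambda>i. cube_hull {v, vm l (A \<oplus> {i})}) ` E" using b l(5) by blast
    then obtain i where i: "i \<in> E" "cube_hull {v, b} = cube_hull {v, vm l (A \<oplus> {i})}" by blast
    have "adj v (vm l (A \<oplus> {i}))"
      unfolding adj_def using l(1-4) i(1) by (intro bexI[of _ l] exI[of _ A] exI[of _ i] conjI) auto
    then have "b = vm l (A \<oplus> {i})" using edge_eq_iff[of v b] b D(3) i(2) by blast
    then show ?thesis using i(1) l(3) by blast
  qed
  then show "\<exists>l\<in>Ix. \<exists>A\<subseteq>{..<dm l}. vm l A = v \<and> (\<forall>b\<in>D. \<exists>i<dm l. b = vm l (A \<oplus> {i}))"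
    using l(1,2,4) by blast
qed

text \<open>The cubes with vertices in one component of the 1-skeleton form an open and closed set,
  because two cubes that meet have a common vertex.\<close>

lemma all_reachable:
  assumes v0: "v0 \<in> \<Union>cells" and v: "c \<in> cells" "v \<in> c"
  shows "\<exists>p. walk p \<and> last p = v0 \<and> hd p = v"
proof -
  define reach where "reach u \<longleftrightarrow> (\<exists>p. walk p \<and> last p = v0 \<and> hd p = u)" for u
  have spread: "reach w" if c: "c \<in> cells" "u \<in> c" "w \<in> c" and u: "reach u" for c u w
  proof -
    obtain p where p: "walk p" "last p = v0" "hd p = u" using u reach_def by blast
    obtain m where "walk m" "hd m = w" "last m = u" using cell_walk[OF c(1,3,2)] by blast
    then show ?thesis using walk_join[of p m] p unfolding reach_def by metis
  qed
  \<comment> \<open>The union of the cubes with a reachable vertex.\<close>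
  define U where "U = {p \<in> topspace (cspace X). \<exists>l\<in>Ix. p \<in> cmap X l ` unit_cube (dm l) \<and> (\<exists>u\<in>cell l. reach u)}"
  have U_iff: "cmap X m y \<in> U \<longleftrightarrow> (\<exists>u\<in>cell m. reach u)" if m: "m \<in> Ix" "y \<in> unit_cube (dm m)" for m y
  proof
    assume "cmap X m y \<in> U"
    then obtain l x u where l: "l \<in> Ix" "x \<in> unit_cube (dm l)" "cmap X m y = cmap X l x" "u \<in> cell l" "reach u"
      by (auto simp: U_def)
    have b: "bary l x \<in> bsimplex (cell l)" "bary l x \<in> bsimplex (cell m)"
      using bary_in[OF l(1,2)] bary_in[OF m] bary_cong[OF l(1) m(1) l(2) m(2)] l(3) by auto
    obtain k where k: "k \<in> cell l" "0 < apply_bcontfun (bary l x) k" using simplexD(3)[OF b(1)] by blast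
    have "k \<in> cell m" using simplexD(2)[OF b(2), of k] k(2) by simp
    moreover have "reach k" using spread[of "cell l" u k] l k by (auto simp: cells_def)
    ultimately show "\<exists>u\<in>cell m. reach u" by blast
  next
    assume "\<exists>u\<in>cell m. reach u"
    then show "cmap X m y \<in> U" using m cube_complexD(1)[OF cc] unfolding U_def by blast
  qed
  have op: "openin (unit_cube_topology n) {x \<in> unit_cube n. P}" for n P
    using openin_topspace[of "unit_cube_topology n"] by (cases P) (auto simp: topspace_unit_cube_topology)
  have "openin (cspace X) U"
  proof -
    have "{x \<in> unit_cube (dm l). cmap X l x \<in> U} = {x \<in> unit_cube (dm l). \<exists>u\<in>cell l. reach u}" if "l \<in> Ix" for l
      using U_iff[OF that] by blast
    moreover have "U \<subseteq> topspace (cspace X)" by (auto simp: U_def)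
    ultimately show ?thesis using cube_complexD(2)[OF cc, of U] op by simp
  qed
  moreover have "openin (cspace X) (topspace (cspace X) - U)"
  proof -
    have "{x \<in> unit_cube (dm l). cmap X l x \<in> topspace (cspace X) - U} = {x \<in> unit_cube (dm l). \<not> (\<exists>u\<in>cell l. reach u)}" if "l \<in> Ix" for l
      using U_iff[OF that] cube_complexD(1)[OF cc] that by blast
    then show ?thesis using cube_complexD(2)[OF cc, of "topspace (cspace X) - U"] op by simp
  qed
  moreover have "U \<subseteq> topspace (cspace X)" by (auto simp: U_def)
  ultimately have "U = {} \<or> U = topspace (cspace X)"
    using cube_complexD(4)[OF cc] unfolding connected_space_clopen_in closedin_def by blast
  moreover have "U \<noteq> {}"
  proof -
    obtain l where l: "l \<in> Ix" "v0 \<in> cell l" using v0 by (auto simp: cells_def)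
    have "reach v0" unfolding reach_def by (intro exI[of _ "[v0]"]) simp
    then have "cmap X l (corner_of (dm l) {}) \<in> U" using U_iff[OF l(1) corner_of_cube] l(2) by blast
    then show ?thesis by blast
  qed
  ultimately have U: "U = topspace (cspace X)" by blast
  obtain l where l: "l \<in> Ix" "c = cell l" using v(1) by (auto simp: cells_def)
  have "cmap X l (corner_of (dm l) {}) \<in> topspace (cspace X)" using cube_complexD(1)[OF cc] l(1) corner_of_cube by blast
  then have "\<exists>u\<in>cell l. reach u" using U_iff[OF l(1) corner_of_cube] U by blast
  then have "reach v" using spread v l(2) by blast
  then show ?thesis by (simp add: reach_def)
qed

end

text \<open>The base point \<open>x0\<close> is arbitrary; \<open>v0\<close> is a vertex of the smallest
  cube that contains it.\<close>

locale based_npc_space = npc_space +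
  fixes x0 :: 'a and v0 :: nat
  assumes x0: "x0 \<in> topspace (cspace X)" and v0: "0 < apply_bcontfun (\<beta> x0) v0"
begin

abbreviation (input) "z0 \<equiv> \<beta> x0"

lemma z0_cell: "\<exists>c\<in>cells. z0 \<in> bsimplex c \<and> v0 \<in> c"
proof -
  obtain l where l: "l \<in> Ix" "z0 \<in> bsimplex (cell l)" using \<beta>_in[OF x0] by blast
  then have "v0 \<in> cell l" using simplexD(2)[OF l(2), of v0] v0 by simp
  then show ?thesis using l by (auto simp: cells_def)
qed

sublocale based_cubing Ix dm vm v0
proof
  show base: "v0 \<in> \<Union>cells" using z0_cell by blast
  show "\<exists>p. walk p \<and> last p = v0 \<and> hd p = v" if "c \<in> cells" "v \<in> c" for c v
    by (rule all_reachable[OF base that])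
qed

text \<open>The edge loop \<open>p\<close> at \<open>v0\<close>, turned into a loop at the base point.\<close>

definition circuit :: "nat list \<Rightarrow> real \<Rightarrow> nat \<Rightarrow>\<^sub>C real" where
  "circuit p = polyline (z0 # map delta p @ [z0])"

definition closed_walk :: "nat list \<Rightarrow> bool" where
  "closed_walk p \<longleftrightarrow> walk p \<and> hd p = v0 \<and> last p = v0"

definition \<theta> :: "nat list \<Rightarrow> (real \<Rightarrow> 'a) set" where
  "\<theta> p = {\<gamma> \<in> based_loops (cspace X) x0. homotopic_paths K (\<beta> \<circ> \<gamma>) (circuit p)}"

lemma \<beta>_loop:
  assumes "\<gamma> \<in> based_loops (cspace X) x0"
  shows "path (\<beta> \<circ> \<gamma>)" "path_image (\<beta> \<circ> \<gamma>) \<subseteq> K" "(\<beta> \<circ> \<gamma>) 0 = z0" "(\<beta> \<circ> \<gamma>) 1 = z0"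
proof -
  have "continuous_map (top_of_set {0..1}) (top_of_set K) (\<beta> \<circ> \<gamma>)"
    by (rule continuous_map_compose[OF _ continuous_\<beta>]) (use assms in \<open>simp add: based_loops_def pathin_def\<close>)
  then show "path (\<beta> \<circ> \<gamma>)" "path_image (\<beta> \<circ> \<gamma>) \<subseteq> K"
    by (auto simp: path_def path_image_def continuous_map_in_subtopology)
  show "(\<beta> \<circ> \<gamma>) 0 = z0" "(\<beta> \<circ> \<gamma>) 1 = z0" using assms by (auto simp: based_loops_def)
qed

lemma loop_in_space:
  assumes "\<gamma> \<in> based_loops (cspace X) x0" "t \<in> {0..1}"
  shows "\<gamma> t \<in> topspace (cspace X)"
  using assms unfolding based_loops_def pathin_def continuous_map_def by auto

lemma continuous_\<rho>': "continuous_map (top_of_set K) (cspace X) \<rho>"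
  by (rule continuous_\<rho>[OF finite_cube_vertices])

lemma \<rho>_path:
  assumes f: "path f" "path_image f \<subseteq> K" "f 0 = z0" "f 1 = z0"
  shows "\<rho> \<circ> f \<in> based_loops (cspace X) x0" "homotopic_paths K (\<beta> \<circ> (\<rho> \<circ> f)) f"
proof -
  have "continuous_map (top_of_set {0..1}) (top_of_set K) f"
    using f(1,2) by (auto simp: path_def path_image_def continuous_map_in_subtopology)
  then have "continuous_map (top_of_set {0..1}) (cspace X) (\<rho> \<circ> f)"
    by (rule continuous_map_compose[OF _ continuous_\<rho>'])
  then show l: "\<rho> \<circ> f \<in> based_loops (cspace X) x0"
    using f(3,4) \<rho>_\<beta>[OF x0] by (simp add: based_loops_def pathin_def)
  have "closed_segment ((\<beta> \<circ> (\<rho> \<circ> f)) t) (f t) \<subseteq> K" if t: "t \<in> {0..1}" for t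
  proof -
    have "f t \<in> K" using f(2) t by (auto simp: path_image_def)
    then obtain m where m: "m \<in> Ix" "f t \<in> bsimplex (cell m)" by (auto simp: polyhedron_def cells_def)
    have "closed_segment (\<beta> (\<rho> (f t))) (f t) \<subseteq> bsimplex (cell m)"
      by (rule segment_in_simplex[OF \<beta>_\<rho>[OF m] m(2)])
    then show ?thesis using m(1) by (auto simp: polyhedron_def cells_def)
  qed
  then show "homotopic_paths K (\<beta> \<circ> (\<rho> \<circ> f)) f"
    using \<beta>_loop[OF l] f by (intro homotopic_paths_linear) (auto simp: pathstart_def pathfinish_def)
qed

text \<open>Homotopies are pushed forward by \<open>\<beta>\<close> and back by the retraction
  \<open>\<rho>\<close>.\<close>

lemma loop_homotopic_iff:
  assumes "\<gamma> \<in> based_loops (cspace X) x0" "\<gamma>' \<in> based_loops (cspace X) x0"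
  shows "loop_homotopic (cspace X) x0 \<gamma> \<gamma>' \<longleftrightarrow> homotopic_paths K (\<beta> \<circ> \<gamma>) (\<beta> \<circ> \<gamma>')"
proof
  assume "loop_homotopic (cspace X) x0 \<gamma> \<gamma>'"
  then have h: "homotopic_with (\<lambda>r. r 0 = x0 \<and> r 1 = x0) (top_of_set {0..1}) (cspace X) \<gamma> \<gamma>'"
    by (simp add: loop_homotopic_def)
  show "homotopic_paths K (\<beta> \<circ> \<gamma>) (\<beta> \<circ> \<gamma>')"
    unfolding homotopic_paths_def
    by (rule homotopic_with_compose_continuous_map_left[OF h continuous_\<beta>])
      (use \<beta>_loop(3,4)[OF assms(1)] in \<open>auto simp: pathstart_def pathfinish_def\<close>)
next
  assume h: "homotopic_paths K (\<beta> \<circ> \<gamma>) (\<beta> \<circ> \<gamma>')"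
  have "homotopic_with (\<lambda>r. r 0 = x0 \<and> r 1 = x0) (top_of_set {0..1}) (cspace X) (\<rho> \<circ> (\<beta> \<circ> \<gamma>)) (\<rho> \<circ> (\<beta> \<circ> \<gamma>'))"
    by (rule homotopic_with_compose_continuous_map_left[OF h[unfolded homotopic_paths_def] continuous_\<rho>'])
      (use \<beta>_loop(3,4)[OF assms(1)] \<rho>_\<beta>[OF x0] in \<open>auto simp: pathstart_def pathfinish_def\<close>)
  then show "loop_homotopic (cspace X) x0 \<gamma> \<gamma>'"
    unfolding loop_homotopic_def
    by (rule homotopic_with_eq) (use loop_in_space[OF assms(1)] loop_in_space[OF assms(2)] \<rho>_\<beta> in auto)
qed

lemma loop_class_eq_\<theta>:
  assumes "\<gamma> \<in> based_loops (cspace X) x0" "homotopic_paths K (\<beta> \<circ> \<gamma>) (circuit p)"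
  shows "loop_class (cspace X) x0 \<gamma> = \<theta> p"
proof -
  have "homotopic_paths K (\<beta> \<circ> \<gamma>) (\<beta> \<circ> q) \<longleftrightarrow> homotopic_paths K (\<beta> \<circ> q) (circuit p)" for q
    using assms(2) homotopic_paths_sym homotopic_paths_trans by blast
  then show ?thesis unfolding loop_class_def \<theta>_def using loop_homotopic_iff[OF assms(1)] by blast
qed

lemma circuit_adm: "closed_walk p \<Longrightarrow> adm (z0 # map delta p @ [z0])"
  using walk_adm z0_cell v0 unfolding closed_walk_def by blast

lemma circuit_loop:
  assumes "closed_walk p"
  shows "\<rho> \<circ> circuit p \<in> \<theta> p" "loop_class (cspace X) x0 (\<rho> \<circ> circuit p) = \<theta> p"
proof -
  have "path (circuit p)" "path_image (circuit p) \<subseteq> K"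
    using poly_path(1) poly_image[OF circuit_adm[OF assms]] by (auto simp: circuit_def)
  moreover have "circuit p 0 = z0" "circuit p 1 = z0"
    using poly_path(2)[of "z0 # map delta p @ [z0]"] by (auto simp: circuit_def pathstart_def pathfinish_def)
  ultimately have "\<rho> \<circ> circuit p \<in> based_loops (cspace X) x0" "homotopic_paths K (\<beta> \<circ> (\<rho> \<circ> circuit p)) (circuit p)"
    using \<rho>_path by blast+
  then show "\<rho> \<circ> circuit p \<in> \<theta> p" "loop_class (cspace X) x0 (\<rho> \<circ> circuit p) = \<theta> p"
    using loop_class_eq_\<theta> by (auto simp: \<theta>_def)
qed

lemma circuit_homotopic:
  assumes "poly_eq (z0 # map delta p @ [z0]) (z0 # map delta q @ [z0])"
  shows "homotopic_paths K (circuit p) (circuit q)"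
  using assms by (simp add: poly_eq_def circuit_def)

lemma \<theta>_eq_iff:
  assumes p: "closed_walk p" and q: "closed_walk q"
  shows "\<theta> p = \<theta> q \<longleftrightarrow> develop p [v0] = develop q [v0]"
proof
  assume "\<theta> p = \<theta> q"
  then have "homotopic_paths K (\<beta> \<circ> (\<rho> \<circ> circuit p)) (circuit p)" "homotopic_paths K (\<beta> \<circ> (\<rho> \<circ> circuit p)) (circuit q)"
    using circuit_loop(1)[OF p] by (auto simp: \<theta>_def)
  then have h: "homotopic_paths K (circuit p) (circuit q)"
    using homotopic_paths_sym homotopic_paths_trans by blast
  obtain c where "c \<in> cells" "z0 \<in> bsimplex c" using z0_cell by blast
  then show "develop p [v0] = develop q [v0]"
    using homotopic_imp_develop_eq[of z0 c p q] v0 p q h unfolding circuit_def closed_walk_def by blast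
next
  assume eq: "develop p [v0] = develop q [v0]"
  have norm: "homotopic_paths K (circuit p) (circuit (develop p [v0]))" if p: "closed_walk p" for p
  proof -
    have "homot p (develop p [v0])" using homot_develop[of p] p by (simp add: closed_walk_def)
    then have "poly_eq ([z0] @ map delta p @ [z0]) ([z0] @ map delta (develop p [v0]) @ [z0])"
      by (rule homot_poly_eq) (use circuit_adm[OF p] in simp)
    then show ?thesis by (intro circuit_homotopic) simp
  qed
  have "homotopic_paths K (circuit p) (circuit q)"
    using norm[OF p] norm[OF q] eq homotopic_paths_sym homotopic_paths_trans by metis
  then have "homotopic_paths K f (circuit p) \<longleftrightarrow> homotopic_paths K f (circuit q)" for f
    using homotopic_paths_sym homotopic_paths_trans by blast
  then show "\<theta> p = \<theta> q" by (simp add: \<theta>_def)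
qed

lemma \<theta>_surjective:
  assumes "g \<in> carrier (fundamental_group (cspace X) x0)"
  shows "\<exists>p. closed_walk p \<and> \<theta> p = g"
proof -
  obtain \<gamma> where \<gamma>: "\<gamma> \<in> based_loops (cspace X) x0" "g = loop_class (cspace X) x0 \<gamma>"
    using assms by (auto simp: fundamental_group_def)
  obtain p where "walk p" "hd p = v0" "last p = v0" "homotopic_paths K (\<beta> \<circ> \<gamma>) (circuit p)"
    using loop_homotopic_walk[OF \<beta>_loop[OF \<gamma>(1)] v0] unfolding circuit_def by blast
  then show ?thesis using loop_class_eq_\<theta>[OF \<gamma>(1)] \<gamma>(2) unfolding closed_walk_def by blast
qed

text \<open>The base point in the middle of the concatenation is dropped, and the two visits of
  \<open>v0\<close> next to it are merged.\<close>

lemma circuit_join: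
  assumes p: "closed_walk p" and q: "closed_walk q"
  shows "homotopic_paths K (circuit p +++ circuit q) (circuit (q @ tl p))"
proof -
  obtain c where c: "c \<in> cells" "z0 \<in> bsimplex c" "v0 \<in> c" using z0_cell by blast
  then have dv: "delta v0 \<in> bsimplex c" using cell_simplex by blast
  obtain p' where p': "p = v0 # p'" using p by (cases p) (auto simp: closed_walk_def)
  obtain q' where q': "q = q' @ [v0]" using q by (cases q rule: rev_cases) (auto simp: closed_walk_def)
  let ?pre = "z0 # map delta q'" and ?post = "map delta p' @ [z0]"
  have "adm ((z0 # map delta q) @ z0 # (map delta p @ [z0]))"
    by (subst adm_append) (use circuit_adm[OF p] circuit_adm[OF q] in simp)
  note adm = this
  then have 1: "homotopic_paths K (polyline ((z0 # map delta q) @ z0 # (map delta p @ [z0]))) (circuit p +++ circuit q)"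
    using poly_append[OF adm] by (simp add: circuit_def)
  have 2: "poly_eq (?pre @ delta v0 # z0 # delta v0 # ?post) (?pre @ delta v0 # delta v0 # ?post)"
    by (rule poly_eq_drop[OF c(1) dv c(2) dv]) (use adm p' q' in simp)
  have wj: "closed_walk (q @ tl p)" using walk_join[of p q] p q by (simp add: closed_walk_def)
  have "poly_eq (?pre @ delta v0 # ?post) (?pre @ delta v0 # delta v0 # ?post)"
    by (rule poly_eq_double) (use circuit_adm[OF wj] p' q' in simp)
  then have "poly_eq (?pre @ delta v0 # z0 # delta v0 # ?post) (?pre @ delta v0 # ?post)"
    using 2 poly_eq_sym poly_eq_trans by blast
  then have "poly_eq ((z0 # map delta q) @ z0 # (map delta p @ [z0])) (z0 # map delta (q @ tl p) @ [z0])"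
    using p' q' by simp
  then have "homotopic_paths K (polyline ((z0 # map delta q) @ z0 # (map delta p @ [z0]))) (circuit (q @ tl p))"
    by (simp add: poly_eq_def circuit_def)
  then show ?thesis by (rule homotopic_paths_trans[OF homotopic_paths_sym[OF 1]])
qed

lemma concat_class:
  assumes p: "closed_walk p" "a \<in> \<theta> p" and q: "closed_walk q" "b \<in> \<theta> q"
  shows "loop_class (cspace X) x0 (loop_concat a b) = \<theta> (q @ tl p)"
proof -
  have a: "a \<in> based_loops (cspace X) x0" "homotopic_paths K (\<beta> \<circ> a) (circuit p)"
    and b: "b \<in> based_loops (cspace X) x0" "homotopic_paths K (\<beta> \<circ> b) (circuit q)"
    using p q by (auto simp: \<theta>_def)
  have ends: "pathfinish (\<beta> \<circ> a) = z0" "pathstart (\<beta> \<circ> b) = z0"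
    using \<beta>_loop(3,4)[OF a(1)] \<beta>_loop(3,4)[OF b(1)] by (auto simp: pathstart_def pathfinish_def)
  have eq: "\<beta> \<circ> loop_concat a b = (\<beta> \<circ> a) +++ (\<beta> \<circ> b)"
    by (auto simp: loop_concat_def joinpaths_def fun_eq_iff)
  have j: "path ((\<beta> \<circ> a) +++ (\<beta> \<circ> b))" "path_image ((\<beta> \<circ> a) +++ (\<beta> \<circ> b)) \<subseteq> K"
    using \<beta>_loop(1,2)[OF a(1)] \<beta>_loop(1,2)[OF b(1)] ends by (simp_all add: subset_path_image_join)
  have "((\<beta> \<circ> a) +++ (\<beta> \<circ> b)) 0 = z0" "((\<beta> \<circ> a) +++ (\<beta> \<circ> b)) 1 = z0"
    using \<beta>_loop(3,4)[OF a(1)] \<beta>_loop(3,4)[OF b(1)] by (auto simp: joinpaths_def)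
  note l = \<rho>_path(1)[OF j this]
  have in_space: "loop_concat a b t \<in> topspace (cspace X)" if "t \<in> {0..1}" for t
    using that loop_in_space[OF a(1), of "2 * t"] loop_in_space[OF b(1), of "2 * t - 1"]
    by (auto simp: loop_concat_def)
  have same: "(\<rho> \<circ> ((\<beta> \<circ> a) +++ (\<beta> \<circ> b))) t = loop_concat a b t" if "t \<in> {0..1}" for t
    using \<rho>_\<beta>[OF in_space[OF that]] fun_cong[OF eq, of t] by simp
  have "continuous_map (top_of_set {0..1}) (cspace X) (loop_concat a b)"
  proof (rule continuous_map_eq)
    show "continuous_map (top_of_set {0..1}) (cspace X) (\<rho> \<circ> ((\<beta> \<circ> a) +++ (\<beta> \<circ> b)))"
      using l unfolding based_loops_def pathin_def by blast
    show "(\<rho> \<circ> ((\<beta> \<circ> a) +++ (\<beta> \<circ> b))) t = loop_concat a b t" if "t \<in> topspace (top_of_set {0..1})" for t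
      using same[of t] that by simp
  qed
  then have "loop_concat a b \<in> based_loops (cspace X) x0"
    using a(1) b(1) by (simp add: based_loops_def pathin_def loop_concat_def)
  moreover have "homotopic_paths K (\<beta> \<circ> loop_concat a b) (circuit (q @ tl p))"
    unfolding eq
    by (rule homotopic_paths_trans[OF homotopic_paths_join[OF a(2) b(2)] circuit_join[OF p(1) q(1)]]) (simp add: ends)
  ultimately show ?thesis by (rule loop_class_eq_\<theta>)
qed

lemma \<theta>_concat:
  assumes p: "closed_walk p" and q: "closed_walk q"
  shows "\<theta> (q @ tl p) = \<theta> p \<otimes>\<^bsub>fundamental_group (cspace X) x0\<^esub> \<theta> q"
proof -
  have "\<theta> p \<noteq> {}" "\<theta> q \<noteq> {}" using circuit_loop(1) p q by blast+
  then have "(\<Union>a\<in>\<theta> p. \<Union>b\<in>\<theta> q. loop_class (cspace X) x0 (loop_concat a b)) = \<theta> (q @ tl p)"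
    using concat_class[OF p _ q] by simp
  then show ?thesis by (simp add: fundamental_group_def)
qed

lemma \<theta>_trivial: "\<theta> [v0] = \<one>\<^bsub>fundamental_group (cspace X) x0\<^esub>"
proof -
  obtain c where c: "c \<in> cells" "z0 \<in> bsimplex c" "v0 \<in> c" using z0_cell by blast
  then have dv: "delta v0 \<in> bsimplex c" using cell_simplex by blast
  have K: "z0 \<in> K" using c by (auto simp: polyhedron_def)
  have l: "(\<lambda>_. x0) \<in> based_loops (cspace X) x0" using x0 by (simp add: based_loops_def pathin_def)
  have "adm [z0]" using K by (simp add: adm_simps)
  then have "poly_eq [z0, delta v0, z0] [z0, z0]" "poly_eq [z0, z0] [z0]"
    using poly_drop_middle[OF c(1,2) dv c(2)] poly_drop_duplicate by auto
  then have "homotopic_paths K (circuit [v0]) (linepath z0 z0)"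
    using poly_eq_trans[of "[z0, delta v0, z0]" "[z0, z0]" "[z0]"] by (simp add: poly_eq_def circuit_def)
  moreover have "\<beta> \<circ> (\<lambda>_. x0) = linepath z0 z0" by (simp add: fun_eq_iff linepath_trivial)
  ultimately have "homotopic_paths K (\<beta> \<circ> (\<lambda>_. x0)) (circuit [v0])" by (simp add: homotopic_paths_sym)
  then have "loop_class (cspace X) x0 (\<lambda>_. x0) = \<theta> [v0]" by (rule loop_class_eq_\<theta>[OF l])
  then show ?thesis by (simp add: fundamental_group_def)
qed

theorem fundamental_group_one_end: "at_most_one_end (fundamental_group (cspace X) x0)"
proof -
  interpret edge_path_group adj sq "fundamental_group (cspace X) x0" v0 \<theta> "\<Union>cells"
  proof
    show "finite (\<Union>cells)" by (rule vertices_finite)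
    show "v0 \<in> \<Union>cells" by (rule base)
    show "u \<in> \<Union>cells" if "adj u v" for u v using adj_vertices[OF that] by blast
    show "\<theta> p \<in> carrier (fundamental_group (cspace X) x0)" if "walk p" "hd p = v0" "last p = v0" for p
    proof -
      have "closed_walk p" using that by (simp add: closed_walk_def)
      from circuit_loop[OF this] show ?thesis
        by (auto simp: fundamental_group_def \<theta>_def intro: rev_image_eqI)
    qed
    show "\<exists>p. walk p \<and> hd p = v0 \<and> last p = v0 \<and> \<theta> p = g" 
      if "g \<in> carrier (fundamental_group (cspace X) x0)" for g
      using \<theta>_surjective[OF that] unfolding closed_walk_def by blast
    show "\<theta> p = \<theta> q \<longleftrightarrow> develop p [v0] = develop q [v0]"
      if "walk p" "hd p = v0" "last p = v0" "walk q" "hd q = v0" "last q = v0" for p q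
      using \<theta>_eq_iff[of p q] that by (simp add: closed_walk_def)
    show "\<theta> (q @ tl p) = \<theta> p \<otimes>\<^bsub>fundamental_group (cspace X) x0\<^esub> \<theta> q"
      if "walk p" "hd p = v0" "last p = v0" "walk q" "hd q = v0" "last q = v0" for p q
      using \<theta>_concat[of p q] that by (simp add: closed_walk_def)
    show "\<theta> [v0] = \<one>\<^bsub>fundamental_group (cspace X) x0\<^esub>" by (rule \<theta>_trivial)
  qed
  show ?thesis by (rule one_end)
qed

end

theorem theoremE:
  fixes X :: "('a, 'i) cube_structure" and x0 :: 'a
  assumes "cube_complex X"
    and "compact_space (cspace X)"
    and "nonpositively_curved X"
    and "\<And>x. x \<in> cube_vertices X \<Longrightarrow>
           connected_space (simplicial_realization (vertex_link X x))"
    and "\<And>x s. x \<in> cube_vertices X \<Longrightarrow> \<not> cut_simplex (vertex_link X x) s"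
    and "x0 \<in> topspace (cspace X)"
  shows "at_most_one_end (fundamental_group (cspace X) x0)"
proof -
  have fin: "finite (cube_vertices X)" by (rule finite_cube_vertices[OF assms(1,2)])
  define enc where "enc = to_nat_on (cube_vertices X)"
  have "inj_on enc (cube_vertices X)"
    unfolding enc_def by (rule inj_on_to_nat_on) (use fin in \<open>simp add: countable_finite\<close>)
  then interpret npc_space X enc
    using assms fin by unfold_locales auto
  obtain l where "\<beta> x0 \<in> bsimplex (cell l)" using \<beta>_in[OF assms(6)] by blast
  then obtain v0 where "0 < apply_bcontfun (\<beta> x0) v0" using simplexD(3) by blast
  then interpret based_npc_space X enc x0 v0
    using assms(6) by unfold_locales
  show ?thesis by (rule fundamental_group_one_end)
qed

end
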